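(* Let $M$ be a compact Riemannian manifold, $f:M\to M$ a diffeomorphism of class at least $C^1$, and $W$ a $k$-dimensional $f$-invariant, uniformly expanding foliation of $M$ with oriented $C^1$ leaves. Suppose that $W$ carries a unique non-trivial homology $h_W\in H_k(M,\mathbb{R})$. Let $\lambda_W$ be the topological growth of $W$, i.e. the eigenvalue of $f_*:H_k(M,\mathbb{R})\to H_k(M,\mathbb{R})$ corresponding to the eigenvector $h_W$. Then for every $x\in M$ and every $r>0$, $$\chi(x,r)=\limsup_{i\to\infty}\frac1i\ln \mathrm{Vol}(f^i(W_r(x)))=\lim_{i\to\infty}\frac1i\ln \mathrm{Vol}(f^i(W_r(x)))=\ln\lambda_W .$$
   Context: Invariant: $f$ maps leaves of $W$ to leaves. $W(x)$ is the leaf through $x$; $W_r(x)$ is the $k$-dimensional disk of radius $r$ centered at $x$ in $W(x)$. $\mathrm{Vol}$ is $k$-dimensional Riemannian volume. Uniformly expanding: there are $\lambda>1$, $C>0$ with $\|Df^m_xv\|\ge C\lambda^m\|v\|$ for all $x\in M$, $v\in T_xW(x)$, $m\in\mathbb{N}$. Currents: for $x\in M$, $r>0$, $m\in\mathbb{N}$ set $C_m(\omega)=\frac{1}{\mathrm{Vol}(f^m(W_r(x)))}\int_{f^m(W_r(x))}\omega$ for $k$-forms $\omega$ on $M$, where $f^m(W_r(x))$ carries the image under $f^m$ of the orientation of $W_r(x)$, so that $\int_{f^m(W_r(x))}\omega=\int_{W_r(x)}(f^* )^m\omega$. These currents (depending on $x,r$) are uniformly bounded, so they have weak sub-sequential limits: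 $C(\omega)=\lim_i C_{m_i}(\omega)$ for all $\omega$, for some $m_i\to\infty$. A current $C$ is closed if $C(d\alpha)=0$ for every exact $k$-form $d\alpha$; a closed current has a homology class $[C]\in H_k(M,\mathbb{R})$, determined by its values on closed $k$-forms via the pairing with de Rham cohomology, and it is non-trivial if $C(\omega)\ne0$ for some closed $\omega$. $W$ carries a non-trivial homology $h\in H_k(M,\mathbb{R})$ if for some $x\in M$, $r>0$ the currents $C_m$ have a closed sub-sequential limit $C$ with $h=[C]\neq0$. $W$ carries a unique non-trivial homology (up to rescaling) if, for all $x\in M$ and all $r>0$, all sub-sequential limits of the currents $C_m$ are closed, and their homology classes are all positive scalar multiples of one nonzero class and are uniformly bounded away from zero (over all $x$, $r$ and all sub-sequential limits); $h_W$ denotes one such class. In this case $h_W$ is an eigenvector of $f_*$ on $H_k(M,\mathbb{R})$. *)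

theory Defs
  imports "HOL-Analysis.Analysis"
begin

section \<open>Maps of class $C^n$\<close>

text \<open>
  Only meant for open sets \<open>S\<close>; in finite dimension, continuity of all (iterated) directional
  derivatives of a differentiable map is the usual notion of class $C^n$.
\<close>

primrec Ck_on ::
  "nat \<Rightarrow> 'a::euclidean_space set \<Rightarrow> ('a \<Rightarrow> 'b::real_normed_vector) \<Rightarrow> bool" where
  "Ck_on 0 = (\<lambda>S F. continuous_on S F)"
| "Ck_on (Suc n) = (\<lambda>S F. (\<forall>x\<in>S. F differentiable (at x)) \<and>
      (\<forall>v. Ck_on n S (\<lambda>x. frechet_derivative F (at x) v)))"

section \<open>Manifolds and tangent vectors\<close>

type_synonym ('m, 'e) chart = "'m set \<times> ('m \<Rightarrow> 'e)"

definition smooth_atlas ::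
  "('m::t2_space, 'e::euclidean_space) chart set \<Rightarrow> bool" where
  "smooth_atlas A \<longleftrightarrow>
     (\<Union>(U, \<phi>)\<in>A. U) = UNIV \<and>
     (\<forall>(U, \<phi>)\<in>A. open U \<and> open (\<phi> ` U) \<and> homeomorphism U (\<phi> ` U) \<phi> (inv_into U \<phi>)) \<and>
     (\<forall>(U, \<phi>)\<in>A. \<forall>(V, \<psi>)\<in>A. \<forall>n. Ck_on n (\<phi> ` (U \<inter> V)) (\<psi> \<circ> inv_into U \<phi>))"

text \<open>
  The tangent space at \<open>x\<close> is modelled by a copy of \<open>'e\<close>: a tangent vector at \<open>x\<close> is given by its
  coordinates in one chart around \<open>x\<close>, chosen once and for all. The choices at different points
  are unrelated, so continuity and smoothness of tensors are always tested on coordinate vector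
  fields (\<open>coord_vec\<close>) of the charts of the atlas.
\<close>

definition chart_at :: "('m, 'e) chart set \<Rightarrow> 'm \<Rightarrow> ('m, 'e) chart" where
  "chart_at A x = (SOME c. c \<in> A \<and> x \<in> fst c)"

text \<open>The differential at \<open>u\<close> of a map \<open>p\<close> from a Euclidean space to the manifold; its values are
  tangent vectors at \<open>p u\<close>.\<close>

definition pdiff ::
  "('m, 'e::euclidean_space) chart set \<Rightarrow> ('d::euclidean_space \<Rightarrow> 'm) \<Rightarrow> 'd \<Rightarrow> 'd \<Rightarrow> 'e" where
  "pdiff A p u w = frechet_derivative (snd (chart_at A (p u)) \<circ> p) (at u) w"

text \<open>The tangent vector at \<open>y\<close> whose coordinates in the chart \<open>(U, \<phi>)\<close> are \<open>v\<close>.\<close>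

definition coord_vec ::
  "('m, 'e::euclidean_space) chart set \<Rightarrow> ('m, 'e) chart \<Rightarrow> 'm \<Rightarrow> 'e \<Rightarrow> 'e" where
  "coord_vec A = (\<lambda>(U, \<phi>) y v. pdiff A (inv_into U \<phi>) (\<phi> y) v)"

text \<open>The differential at \<open>x\<close> of a self-map of the manifold.\<close>

definition mdiff ::
  "('m, 'e::euclidean_space) chart set \<Rightarrow> ('m \<Rightarrow> 'm) \<Rightarrow> 'm \<Rightarrow> 'e \<Rightarrow> 'e" where
  "mdiff A F x v =
     (case chart_at A x of (U, \<phi>) \<Rightarrow> pdiff A (F \<circ> inv_into U \<phi>) (\<phi> x) v)"

definition C1_into ::
  "('m::t2_space, 'e::euclidean_space) chart set \<Rightarrow> 'd::euclidean_space set \<Rightarrow> ('d \<Rightarrow> 'm) \<Rightarrow> bool"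
  where
  "C1_into A S p \<longleftrightarrow>
     continuous_on S p \<and> (\<forall>(U, \<phi>)\<in>A. Ck_on 1 (S \<inter> p -` U) (\<phi> \<circ> p))"

definition C1_map ::
  "('m::t2_space, 'e::euclidean_space) chart set \<Rightarrow> ('m \<Rightarrow> 'm) \<Rightarrow> bool" where
  "C1_map A F \<longleftrightarrow>
     continuous_on UNIV F \<and>
     (\<forall>(U, \<phi>)\<in>A. \<forall>(V, \<psi>)\<in>A. Ck_on 1 (\<phi> ` (U \<inter> F -` V)) (\<psi> \<circ> F \<circ> inv_into U \<phi>))"

definition C1_diffeomorphism ::
  "('m::t2_space, 'e::euclidean_space) chart set \<Rightarrow> ('m \<Rightarrow> 'm) \<Rightarrow> bool" where
  "C1_diffeomorphism A f \<longleftrightarrow> bij f \<and> C1_map A f \<and> C1_map A (inv f)"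

definition riemannian_metric ::
  "('m::t2_space, 'e::euclidean_space) chart set \<Rightarrow> ('m \<Rightarrow> 'e \<Rightarrow> 'e \<Rightarrow> real) \<Rightarrow> bool" where
  "riemannian_metric A g \<longleftrightarrow>
     (\<forall>x. bilinear (g x) \<and> (\<forall>v w. g x v w = g x w v) \<and> (\<forall>v. v \<noteq> 0 \<longrightarrow> 0 < g x v v)) \<and>
     (\<forall>(U, \<phi>)\<in>A. \<forall>v w n. Ck_on n (\<phi> ` U)
        (\<lambda>z. g (inv_into U \<phi> z) (coord_vec A (U, \<phi>) (inv_into U \<phi> z) v)
                                (coord_vec A (U, \<phi>) (inv_into U \<phi> z) w)))"

definition tnorm :: "('m \<Rightarrow> 'e \<Rightarrow> 'e \<Rightarrow> real) \<Rightarrow> 'm \<Rightarrow> 'e \<Rightarrow> real" where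
  "tnorm g x v = sqrt (g x v v)"

section \<open>Foliations with oriented $C^1$ leaves\<close>

text \<open>
  A foliation is given by the map \<open>W\<close> sending a point to its leaf, and by an oriented $C^1$ atlas
  \<open>P\<close> of the leaves, consisting of parametrizations \<open>(V, p)\<close> with \<open>V\<close> open in \<open>real^'k\<close>; the
  dimension \<open>k\<close> of the leaves is \<open>CARD('k)\<close>. Orientations of different leaves are unrelated.
\<close>

type_synonym ('m, 'k) leaf_atlas = "((real^'k) set \<times> (real^'k \<Rightarrow> 'm)) set"

text \<open>
  Partition into path-connected sets which in suitable local coordinates look like a family of
  parallel \<open>k\<close>-dimensional slices of a cube. The plaques of a leaf in a foliation box are its path
  components there, since a leaf may return to the box infinitely often.
\<close>

definition foliation :: "'k::finite itself \<Rightarrow> 'e::euclidean_space itself \<Rightarrow>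
    ('m::t2_space \<Rightarrow> 'm set) \<Rightarrow> bool" where
  "foliation _ _ W \<longleftrightarrow>
     (\<forall>x. x \<in> W x \<and> path_connected (W x) \<and> (\<forall>y\<in>W x. W y = W x)) \<and>
     (\<forall>x. \<exists>U (\<Phi> :: 'm \<Rightarrow> 'e) \<Psi> K.
        open U \<and> x \<in> U \<and> homeomorphism U (box 0 One) \<Phi> \<Psi> \<and>
        K \<subseteq> Basis \<and> card K = CARD('k) \<and>
        (\<forall>y\<in>U. path_component_set (U \<inter> W y) y =
                {z\<in>U. \<forall>b\<in>Basis - K. \<Phi> z \<bullet> b = \<Phi> y \<bullet> b}))"

text \<open>Open sets of the intrinsic (leaf) topology, which is finer than the subspace topology.\<close>

definition leaf_open :: "('m::topological_space \<Rightarrow> 'm set) \<Rightarrow> 'm set \<Rightarrow> bool" where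
  "leaf_open W S \<longleftrightarrow>
     (\<forall>y\<in>S. \<exists>U. open U \<and> y \<in> U \<and> path_component_set (U \<inter> W y) y \<subseteq> S)"

definition oriented_C1_leaf_atlas ::
  "('m::t2_space, 'e::euclidean_space) chart set \<Rightarrow> ('m \<Rightarrow> 'm set) \<Rightarrow>
    ('m, 'k::{finite,wellorder}) leaf_atlas \<Rightarrow> bool" where
  "oriented_C1_leaf_atlas A W P \<longleftrightarrow>
     (\<Union>(V, p)\<in>P. p ` V) = UNIV \<and>
     (\<forall>(V, p)\<in>P. open V \<and> C1_into A V p \<and> inj_on p V \<and>
        (\<forall>u\<in>V. inj (pdiff A p u) \<and> p ` V \<subseteq> W (p u)) \<and>
        (\<forall>V'. open V' \<and> V' \<subseteq> V \<longrightarrow> leaf_open W (p ` V'))) \<and>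
     (\<forall>(V, p)\<in>P. \<forall>(V', q)\<in>P.
        Ck_on 1 (V \<inter> p -` (q ` V')) (inv_into V' q \<circ> p) \<and>
        (\<forall>u\<in>V \<inter> p -` (q ` V').
           0 < det (matrix (frechet_derivative (inv_into V' q \<circ> p) (at u)))))"

definition oriented_C1_foliation ::
  "('m::t2_space, 'e::euclidean_space) chart set \<Rightarrow> ('m \<Rightarrow> 'm set) \<Rightarrow>
    ('m, 'k::{finite,wellorder}) leaf_atlas \<Rightarrow> bool" where
  "oriented_C1_foliation A W P \<longleftrightarrow>
     foliation TYPE('k) TYPE('e) W \<and> oriented_C1_leaf_atlas A W P"

definition leaf_tangent ::
  "('m, 'e::euclidean_space) chart set \<Rightarrow> ('m, 'k::finite) leaf_atlas \<Rightarrow> 'm \<Rightarrow> 'e set" where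
  "leaf_tangent A P x = {pdiff A p u w | V p u w. (V, p) \<in> P \<and> u \<in> V \<and> p u = x}"

definition invariant_foliation :: "('m \<Rightarrow> 'm) \<Rightarrow> ('m \<Rightarrow> 'm set) \<Rightarrow> bool" where
  "invariant_foliation f W \<longleftrightarrow> (\<forall>x. f ` W x = W (f x))"

definition uniformly_expanding ::
  "('m, 'e::euclidean_space) chart set \<Rightarrow> ('m \<Rightarrow> 'e \<Rightarrow> 'e \<Rightarrow> real) \<Rightarrow> ('m \<Rightarrow> 'm) \<Rightarrow>
    ('m, 'k::finite) leaf_atlas \<Rightarrow> bool" where
  "uniformly_expanding A g f P \<longleftrightarrow>
     (\<exists>lam>1. \<exists>C>0. \<forall>x. \<forall>v\<in>leaf_tangent A P x. \<forall>m.
        C * lam ^ m * tnorm g x v \<le> tnorm g ((f ^^ m) x) (mdiff A (f ^^ m) x v))"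

text \<open>
  \<open>W\<^sub>r(x)\<close> is the open ball for the intrinsic distance of the leaf, the infimum of the
  lengths of $C^1$ curves in the leaf. The curves need not be regular, so that
  piecewise $C^1$ curves give the same distance.
\<close>

definition curve_length ::
  "('m, 'e::euclidean_space) chart set \<Rightarrow> ('m \<Rightarrow> 'e \<Rightarrow> 'e \<Rightarrow> real) \<Rightarrow> (real \<Rightarrow> 'm) \<Rightarrow> real" where
  "curve_length A g \<gamma> = integral {0..1} (\<lambda>t. tnorm g (\<gamma> t) (pdiff A \<gamma> t 1))"

definition leaf_dist ::
  "('m::t2_space, 'e::euclidean_space) chart set \<Rightarrow> ('m \<Rightarrow> 'e \<Rightarrow> 'e \<Rightarrow> real) \<Rightarrow> ('m \<Rightarrow> 'm set) \<Rightarrow>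
    'm \<Rightarrow> 'm \<Rightarrow> real" where
  "leaf_dist A g W x y =
     Inf {curve_length A g \<gamma> | \<gamma> S. open S \<and> {0..1} \<subseteq> S \<and> C1_into A S \<gamma> \<and>
            \<gamma> ` {0..1} \<subseteq> W x \<and> \<gamma> 0 = x \<and> \<gamma> 1 = y}"

definition leaf_disk ::
  "('m::t2_space, 'e::euclidean_space) chart set \<Rightarrow> ('m \<Rightarrow> 'e \<Rightarrow> 'e \<Rightarrow> real) \<Rightarrow> ('m \<Rightarrow> 'm set) \<Rightarrow>
    'm \<Rightarrow> real \<Rightarrow> 'm set" where
  "leaf_disk A g W x r = {y \<in> W x. leaf_dist A g W x y < r}"

section \<open>Volume and integration over pieces of leaves\<close>

text \<open>
  The set \<open>S\<close> is cut into finitely many disjoint Borel pieces lying in images of parametrizations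
  from \<open>P\<close>, and the integrand \<open>F p\<close> is integrated over the corresponding parameter sets.
  For the two integrands below, the change of variables formula makes the result independent
  of the decomposition.
\<close>

definition has_leaf_integral ::
  "('m, 'k::finite) leaf_atlas \<Rightarrow> ((real^'k \<Rightarrow> 'm) \<Rightarrow> real^'k \<Rightarrow> real) \<Rightarrow> 'm set \<Rightarrow> real \<Rightarrow> bool" where
  "has_leaf_integral P F S s \<longleftrightarrow>
     (\<exists>(N::nat) V p B.
        (\<forall>i<N. (V i, p i) \<in> P \<and> B i \<in> sets borel \<and> B i \<subseteq> V i \<and>
               set_integrable lborel (B i) (F (p i))) \<and>
        disjoint_family_on (\<lambda>i. p i ` B i) {..<N} \<and>
        S = (\<Union>i<N. p i ` B i) \<and>
        s = (\<Sum>i<N. LINT u:B i|lborel. F (p i) u))"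

definition leaf_integral ::
  "('m, 'k::finite) leaf_atlas \<Rightarrow> ((real^'k \<Rightarrow> 'm) \<Rightarrow> real^'k \<Rightarrow> real) \<Rightarrow> 'm set \<Rightarrow> real" where
  "leaf_integral P F S = (THE s. has_leaf_integral P F S s)"

definition leaf_vol ::
  "('m, 'e::euclidean_space) chart set \<Rightarrow> ('m \<Rightarrow> 'e \<Rightarrow> 'e \<Rightarrow> real) \<Rightarrow>
    ('m, 'k::finite) leaf_atlas \<Rightarrow> 'm set \<Rightarrow> real" where
  "leaf_vol A g P =
     leaf_integral P (\<lambda>p u. sqrt (det (\<chi> i j. g (p u) (pdiff A p u (axis i 1)) (pdiff A p u (axis j 1)))))"

text \<open>
  A \<open>j\<close>-form takes \<open>j\<close> tangent vectors at a point, given as the first \<open>j\<close> members of a sequence.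
  Forms are merely required to be continuous, a condition which is preserved by
  pullback under $C^1$ maps.
\<close>

type_synonym ('m, 'e) form = "'m \<Rightarrow> (nat \<Rightarrow> 'e) \<Rightarrow> real"

definition diff_form ::
  "('m::t2_space, 'e::euclidean_space) chart set \<Rightarrow> nat \<Rightarrow> ('m, 'e) form \<Rightarrow> bool" where
  "diff_form A j \<omega> \<longleftrightarrow>
     (\<forall>x v w. (\<forall>i<j. v i = w i) \<longrightarrow> \<omega> x v = \<omega> x w) \<and>
     (\<forall>x v. \<forall>i<j. linear (\<lambda>u. \<omega> x (v(i := u)))) \<and>
     (\<forall>x v i l. i < l \<and> l < j \<and> v i = v l \<longrightarrow> \<omega> x v = 0) \<and>
     (\<forall>c\<in>A. \<forall>v. continuous_on (fst c) (\<lambda>y. \<omega> y (\<lambda>i. coord_vec A c y (v i))))"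

definition pullback_form ::
  "('m, 'e::euclidean_space) chart set \<Rightarrow> ('m \<Rightarrow> 'm) \<Rightarrow> ('m, 'e) form \<Rightarrow> ('m, 'e) form" where
  "pullback_form A f \<omega> = (\<lambda>x v. \<omega> (f x) (\<lambda>i. mdiff A f x (v i)))"

text \<open>The standard ordered basis of \<open>real^'k\<close>; only the indices \<open>i < CARD('k)\<close> matter.\<close>

definition std_frame :: "nat \<Rightarrow> real^'k::{finite,wellorder}" where
  "std_frame i = axis (sorted_list_of_set UNIV ! i) 1"

definition form_integral ::
  "('m, 'e::euclidean_space) chart set \<Rightarrow> ('m, 'k::{finite,wellorder}) leaf_atlas \<Rightarrow>
    'm set \<Rightarrow> ('m, 'e) form \<Rightarrow> real" where
  "form_integral A P S \<omega> =
     leaf_integral P (\<lambda>p u. \<omega> (p u) (\<lambda>i. pdiff A p u (std_frame i))) S"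

definition image_atlas :: "('m \<Rightarrow> 'm) \<Rightarrow> ('m, 'k) leaf_atlas \<Rightarrow> ('m, 'k) leaf_atlas" where
  "image_atlas F P = (\<lambda>(V, p). (V, F \<circ> p)) ` P"

section \<open>Exterior derivative and de Rham classes\<close>

text \<open>
  As \<open>f\<close> is only $C^1$, the pullback under \<open>f\<close> of a smooth form is in general only continuous. The
  exterior derivative is therefore understood in the sense of Whitney's regular forms (Geometric
  Integration Theory, Chapter III): the continuous form \<open>\<eta>\<close> is the exterior derivative of the
  continuous form \<open>\<alpha>\<close> if Stokes' formula holds on all singular $C^1$ cubes. By Stokes' theorem this
  is the classical notion on $C^1$ forms; it is compatible with $C^1$ pullbacks and yields the same
  de Rham cohomology.

  The cubes are parametrized by the unit cube of \<open>'d\<close>, so that \<open>\<alpha>\<close> has degree \<open>DIM('d) - 1\<close> and \<open>\<eta>\<close>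
  has degree \<open>DIM('d)\<close>. Reordering the basis \<open>bs\<close> multiplies both sides by the same sign.
  An integral over a face is written as an integral over the whole cube of a function that does
  not depend on the coordinate orthogonal to the face.
\<close>

definition cube_face :: "'d::euclidean_space \<Rightarrow> real \<Rightarrow> 'd \<Rightarrow> 'd" where
  "cube_face b c u = u + (c - u \<bullet> b) *\<^sub>R b"

definition face_integral ::
  "('m, 'e::euclidean_space) chart set \<Rightarrow> ('m, 'e) form \<Rightarrow> ('d::euclidean_space \<Rightarrow> 'm) \<Rightarrow>
    'd list \<Rightarrow> nat \<Rightarrow> real \<Rightarrow> real" where
  "face_integral A \<alpha> \<sigma> bs i c =
     integral (cbox 0 One)
       (\<lambda>u. \<alpha> (\<sigma> (cube_face (bs ! i) c u))
              (\<lambda>l. pdiff A \<sigma> (cube_face (bs ! i) c u) (bs ! (if l < i then l else Suc l))))"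

definition has_ext_deriv ::
  "('m::t2_space, 'e::euclidean_space) chart set \<Rightarrow> 'd::euclidean_space itself \<Rightarrow>
    ('m, 'e) form \<Rightarrow> ('m, 'e) form \<Rightarrow> bool" where
  "has_ext_deriv A _ \<alpha> \<eta> \<longleftrightarrow>
     (\<forall>(\<sigma> :: 'd \<Rightarrow> 'm) S bs.
        open S \<and> cbox 0 One \<subseteq> S \<and> C1_into A S \<sigma> \<and> distinct bs \<and> set bs = Basis \<longrightarrow>
        integral (cbox 0 One) (\<lambda>u. \<eta> (\<sigma> u) (\<lambda>i. pdiff A \<sigma> u (bs ! i))) =
        (\<Sum>i<DIM('d). (-1) ^ i * (face_integral A \<alpha> \<sigma> bs i 1 - face_integral A \<alpha> \<sigma> bs i 0)))"

definition closed_form ::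
  "('m::t2_space, 'e::euclidean_space) chart set \<Rightarrow> 'k::finite itself \<Rightarrow> ('m, 'e) form \<Rightarrow> bool"
  where
  "closed_form A _ \<omega> \<longleftrightarrow>
     diff_form A CARD('k) \<omega> \<and> has_ext_deriv A TYPE((real^'k) \<times> real) \<omega> (\<lambda>x v. 0)"

definition exact_form ::
  "('m::t2_space, 'e::euclidean_space) chart set \<Rightarrow> 'k::finite itself \<Rightarrow> ('m, 'e) form \<Rightarrow> bool"
  where
  "exact_form A _ \<eta> \<longleftrightarrow>
     diff_form A CARD('k) \<eta> \<and>
     (\<exists>\<alpha>. diff_form A (CARD('k) - 1) \<alpha> \<and> has_ext_deriv A TYPE(real^'k) \<alpha> \<eta>)"

text \<open>
  Real homology in degree \<open>k\<close>, realized as the dual of de Rham cohomology: linear functionals on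
  closed \<open>k\<close>-forms vanishing on exact ones. They are extended by 0 to arguments that are not
  closed forms, so that equality of classes is equality of functions.
\<close>

definition real_homology ::
  "('m::t2_space, 'e::euclidean_space) chart set \<Rightarrow> 'k::finite itself \<Rightarrow>
    (('m, 'e) form \<Rightarrow> real) set" where
  "real_homology A T =
     {h. (\<forall>\<omega>. \<not> closed_form A T \<omega> \<longrightarrow> h \<omega> = 0) \<and>
         (\<forall>\<omega> \<omega>' a b. closed_form A T \<omega> \<and> closed_form A T \<omega>' \<longrightarrow>
            h (\<lambda>x v. a * \<omega> x v + b * \<omega>' x v) = a * h \<omega> + b * h \<omega>') \<and>
         (\<forall>\<omega>. exact_form A T \<omega> \<longrightarrow> h \<omega> = 0)}"

definition homology_push ::
  "('m::t2_space, 'e::euclidean_space) chart set \<Rightarrow> 'k::finite itself \<Rightarrow> ('m \<Rightarrow> 'm) \<Rightarrow>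
    (('m, 'e) form \<Rightarrow> real) \<Rightarrow> ('m, 'e) form \<Rightarrow> real" where
  "homology_push A T f h =
     (\<lambda>\<omega>. if closed_form A T \<omega> then h (pullback_form A f \<omega>) else 0)"

section \<open>Currents carried by the foliation\<close>

definition closed_current ::
  "('m::t2_space, 'e::euclidean_space) chart set \<Rightarrow> 'k::finite itself \<Rightarrow>
    (('m, 'e) form \<Rightarrow> real) \<Rightarrow> bool" where
  "closed_current A T C \<longleftrightarrow> (\<forall>\<eta>. exact_form A T \<eta> \<longrightarrow> C \<eta> = 0)"

definition current_class ::
  "('m::t2_space, 'e::euclidean_space) chart set \<Rightarrow> 'k::finite itself \<Rightarrow>
    (('m, 'e) form \<Rightarrow> real) \<Rightarrow> ('m, 'e) form \<Rightarrow> real" where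
  "current_class A T C = (\<lambda>\<omega>. if closed_form A T \<omega> then C \<omega> else 0)"

definition iterate_vol ::
  "('m::t2_space, 'e::euclidean_space) chart set \<Rightarrow> ('m \<Rightarrow> 'e \<Rightarrow> 'e \<Rightarrow> real) \<Rightarrow> ('m \<Rightarrow> 'm) \<Rightarrow>
    ('m \<Rightarrow> 'm set) \<Rightarrow> ('m, 'k::{finite,wellorder}) leaf_atlas \<Rightarrow> 'm \<Rightarrow> real \<Rightarrow> nat \<Rightarrow> real" where
  "iterate_vol A g f W P x r m = leaf_vol A g P ((f ^^ m) ` leaf_disk A g W x r)"

definition iterate_current ::
  "('m::t2_space, 'e::euclidean_space) chart set \<Rightarrow> ('m \<Rightarrow> 'e \<Rightarrow> 'e \<Rightarrow> real) \<Rightarrow> ('m \<Rightarrow> 'm) \<Rightarrow>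
    ('m \<Rightarrow> 'm set) \<Rightarrow> ('m, 'k::{finite,wellorder}) leaf_atlas \<Rightarrow> 'm \<Rightarrow> real \<Rightarrow> nat \<Rightarrow>
    ('m, 'e) form \<Rightarrow> real" where
  "iterate_current A g f W P x r m \<omega> =
     form_integral A (image_atlas (f ^^ m) P) ((f ^^ m) ` leaf_disk A g W x r) \<omega>
       / iterate_vol A g f W P x r m"

definition subsequential_limit ::
  "('m::t2_space, 'e::euclidean_space) chart set \<Rightarrow> ('m \<Rightarrow> 'e \<Rightarrow> 'e \<Rightarrow> real) \<Rightarrow> ('m \<Rightarrow> 'm) \<Rightarrow>
    ('m \<Rightarrow> 'm set) \<Rightarrow> ('m, 'k::{finite,wellorder}) leaf_atlas \<Rightarrow> 'm \<Rightarrow> real \<Rightarrow>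
    (('m, 'e) form \<Rightarrow> real) \<Rightarrow> bool" where
  "subsequential_limit A g f W P x r C \<longleftrightarrow>
     (\<exists>s :: nat \<Rightarrow> nat. filterlim s at_top sequentially \<and>
        (\<forall>\<omega>. diff_form A CARD('k) \<omega> \<longrightarrow>
           (\<lambda>i. iterate_current A g f W P x r (s i) \<omega>) \<longlonglongrightarrow> C \<omega>))"

text \<open>
  \<open>W\<close> carries a unique non-trivial homology, with representative \<open>h\<close>. As all classes are multiples
  of the nonzero class \<open>h\<close>, being bounded away from zero is a bound on the factors.
\<close>

definition carries_unique_homology ::
  "('m::t2_space, 'e::euclidean_space) chart set \<Rightarrow> ('m \<Rightarrow> 'e \<Rightarrow> 'e \<Rightarrow> real) \<Rightarrow> ('m \<Rightarrow> 'm) \<Rightarrow>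
    ('m \<Rightarrow> 'm set) \<Rightarrow> ('m, 'k::{finite,wellorder}) leaf_atlas \<Rightarrow>
    (('m, 'e) form \<Rightarrow> real) \<Rightarrow> bool" where
  "carries_unique_homology A g f W P h \<longleftrightarrow>
     h \<in> real_homology A TYPE('k) \<and> h \<noteq> (\<lambda>\<omega>. 0) \<and>
     (\<exists>\<delta>>0. \<forall>x r C. 0 < r \<and> subsequential_limit A g f W P x r C \<longrightarrow>
        closed_current A TYPE('k) C \<and>
        (\<exists>c\<ge>\<delta>. current_class A TYPE('k) C = (\<lambda>\<omega>. c * h \<omega>)))"

definition topological_growth ::
  "('m::t2_space, 'e::euclidean_space) chart set \<Rightarrow> 'k::finite itself \<Rightarrow> ('m \<Rightarrow> 'm) \<Rightarrow>
    (('m, 'e) form \<Rightarrow> real) \<Rightarrow> real" where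
  "topological_growth A T f h = (THE lam. homology_push A T f h = (\<lambda>\<omega>. lam * h \<omega>))"

definition volume_growth ::
  "('m::t2_space, 'e::euclidean_space) chart set \<Rightarrow> ('m \<Rightarrow> 'e \<Rightarrow> 'e \<Rightarrow> real) \<Rightarrow> ('m \<Rightarrow> 'm) \<Rightarrow>
    ('m \<Rightarrow> 'm set) \<Rightarrow> ('m, 'k::{finite,wellorder}) leaf_atlas \<Rightarrow> 'm \<Rightarrow> real \<Rightarrow> ereal" where
  "volume_growth A g f W P x r =
     limsup (\<lambda>i. ereal (1 / real i * ln (iterate_vol A g f W P x r i)))"

end

theory Submission
  imports Defs "HOL-Library.Diagonal_Subsequence"
begin

text \<open>
  Let \<open>V m\<close> be the volume of the \<open>m\<close>-th iterate of the disk, let \<open>a m\<close> be the integral over it of a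
  closed form \<open>\<omega>\<close> on which the class \<open>h\<close> does not vanish, and let \<open>C m\<close> be the normalized current, so
  that \<open>a m = V m * C m \<omega>\<close> and \<open>a (Suc m) = V m * C m (f\<^sup>* \<omega>)\<close>. The currents are bounded and continuous
  forms are a separable space, so every sequence of iterates has a subsequence along which they
  converge, to a current of class \<open>c * h\<close> with \<open>c \<ge> \<delta>\<close>. Since \<open>h (f\<^sup>* \<omega>) = \<lambda> * h \<omega>\<close>, this yields that
  \<open>C m \<omega>\<close> is eventually bounded away from 0 and that \<open>C m (f\<^sup>* \<omega>) - \<lambda> * C m \<omega>\<close> tends to 0. Hence
  \<open>a (Suc m) / a m\<close> tends to \<open>\<lambda>\<close>, and \<open>V m\<close> grows like \<open>a m\<close>.

  The integrals exist because a leaf disk is open in its leaf and covered by finitely many compact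
  pieces of parametrizations: a short curve in a leaf stays in a compact part of a single plaque
  of a foliation box, with bounds that are uniform by compactness of the manifold.
\<close>

section \<open>Maps of class $C^1$ between charts\<close>

text \<open>Both integrals are \<open>THE\<close>-terms over arbitrary decompositions, so any
  statement about them rests on existence and uniqueness. They become computable by one device: a
  single decomposition of the disk is carried along by all iterates, so that volumes and form
  integrals at every time are sums of Lebesgue integrals over the same parameter sets
  \<open>B i\<close>, and comparing time \<open>m\<close> with time \<open>Suc m\<close> is a
  pointwise comparison of densities. The volume is measured in the atlas \<open>P\<close>, the form
  in the image of \<open>P\<close> under \<open>f ^^ m\<close>. The volume density ignores
  orientation and may be compared across atlases; a form is only ever compared within one image
  atlas, whose transition maps are those of \<open>P\<close> and hence have positive determinants.
  Two topologies compete. Leaves may return to a foliation box infinitely often, so compactness of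
  the manifold says nothing about a leaf directly; path components of leaf pieces in boxes mediate
  between the two. Convergence of the currents is never claimed for the full sequence. Limits are
  extracted along times at which a desired estimate is supposed to fail.\<close>

definition C1_on :: "'a::euclidean_space set \<Rightarrow> ('a \<Rightarrow> 'b::real_normed_vector) \<Rightarrow> bool" where
  "C1_on S F \<longleftrightarrow> (\<forall>x\<in>S. F differentiable (at x)) \<and>
      (\<forall>v. continuous_on S (\<lambda>x. frechet_derivative F (at x) v))"

lemma Ck_on_1 [simp]: "Ck_on 1 = C1_on" "Ck_on (Suc 0) = C1_on"
  by (simp_all add: C1_on_def fun_eq_iff)

declare Ck_on.simps [simp del]

lemma C1_on_I:
  assumes "\<And>x. x \<in> S \<Longrightarrow> (F has_derivative D x) (at x)" "\<And>v. continuous_on S (\<lambda>x. D x v)"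
  shows "C1_on S F"
  unfolding C1_on_def
proof (intro conjI ballI allI)
  show "F differentiable at x" if "x \<in> S" for x
    using assms(1)[OF that] by (auto simp: differentiable_def)
  show "continuous_on S (\<lambda>x. frechet_derivative F (at x) v)" for v
    using assms(2)[of v] by (rule continuous_on_eq) (metis assms(1) frechet_derivative_at)
qed

lemma C1_on_has_derivative:
  "C1_on S F \<Longrightarrow> x \<in> S \<Longrightarrow> (F has_derivative frechet_derivative F (at x)) (at x)"
  unfolding C1_on_def by (simp flip: frechet_derivative_works)

lemma C1_on_continuous_derivative:
  "C1_on S F \<Longrightarrow> continuous_on S (\<lambda>x. frechet_derivative F (at x) v)"
  unfolding C1_on_def by blast

lemma C1_on_continuous_on: "C1_on S F \<Longrightarrow> continuous_on S F"
  by (meson C1_on_has_derivative has_derivative_continuous continuous_at_imp_continuous_on)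

lemma C1_on_mono: "C1_on S F \<Longrightarrow> T \<subseteq> S \<Longrightarrow> C1_on T F"
  unfolding C1_on_def by (meson continuous_on_subset subsetD)

lemma C1_on_cong:
  assumes "C1_on S F" "open S" "\<And>x. x \<in> S \<Longrightarrow> F x = G x"
  shows "C1_on S G"
proof (rule C1_on_I)
  show "(G has_derivative frechet_derivative F (at x)) (at x)" if "x \<in> S" for x
    using has_derivative_transform_within_open[OF C1_on_has_derivative[OF assms(1) that] assms(2) that]
      assms(3) by blast
qed (rule C1_on_continuous_derivative[OF assms(1)])

lemma linear_sum_Basis: "linear L \<Longrightarrow> L v = (\<Sum>b\<in>Basis. (v \<bullet> b) *\<^sub>R L b)"
  for v :: "'a::euclidean_space"
  using linear_sum[of L "\<lambda>b. (v \<bullet> b) *\<^sub>R b" Basis] by (simp add: euclidean_representation linear_cmul)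

text \<open>The definition controls the derivative only in a fixed direction. Expanding the moving
  direction \<open>b u\<close> in the basis reduces to finitely many fixed ones.\<close>

lemma C1_on_continuous_derivative_along:
  fixes F :: "'a::euclidean_space \<Rightarrow> 'b::real_normed_vector"
  assumes "C1_on S F" "continuous_on T a" "continuous_on T b" "a ` T \<subseteq> S"
  shows "continuous_on T (\<lambda>u. frechet_derivative F (at (a u)) (b u))"
proof -
  have "continuous_on T (\<lambda>u. \<Sum>i\<in>Basis. (b u \<bullet> i) *\<^sub>R frechet_derivative F (at (a u)) i)"
    by (intro continuous_intros assms
      continuous_on_compose2[OF C1_on_continuous_derivative[OF assms(1)] assms(2,4)])
  moreover have "(\<Sum>i\<in>Basis. (b u \<bullet> i) *\<^sub>R frechet_derivative F (at (a u)) i) =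
      frechet_derivative F (at (a u)) (b u)" if "u \<in> T" for u
  proof -
    have "linear (frechet_derivative F (at (a u)))"
      using C1_on_has_derivative[OF assms(1)] assms(4) that has_derivative_linear by blast
    from linear_sum_Basis[OF this, of "b u"] show ?thesis
      by simp
  qed
  ultimately show ?thesis
    using continuous_on_eq by fastforce
qed

lemma C1_on_compose:
  fixes F :: "'a::euclidean_space \<Rightarrow> 'b::euclidean_space"
    and G :: "'b \<Rightarrow> 'c::real_normed_vector"
  assumes "C1_on S F" "C1_on T G" "F ` S \<subseteq> T"
  shows "C1_on S (G \<circ> F)"
proof (rule C1_on_I)
  show "(G \<circ> F has_derivative
      (\<lambda>v. frechet_derivative G (at (F x)) (frechet_derivative F (at x) v))) (at x)" if "x \<in> S" for x
    using diff_chain_at[OF C1_on_has_derivative[OF assms(1) that]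
        C1_on_has_derivative[OF assms(2), of "F x"]] that assms(3)
    by (auto simp: o_def)
  show "continuous_on S (\<lambda>x. frechet_derivative G (at (F x)) (frechet_derivative F (at x) v))" for v
    by (intro C1_on_continuous_derivative_along[OF assms(2)] C1_on_continuous_on
      C1_on_continuous_derivative assms)
qed

lemma continuous_on_local:
  fixes F :: "'a::topological_space \<Rightarrow> 'b::topological_space"
  assumes "\<And>x. x \<in> S \<Longrightarrow> \<exists>N. open N \<and> x \<in> N \<and> continuous_on (N \<inter> S) F"
  shows "continuous_on S F"
  unfolding continuous_on_def
proof
  fix x assume "x \<in> S"
  then obtain N where N: "open N" "x \<in> N" "continuous_on (N \<inter> S) F"
    using assms by blast
  then have "(F \<longlongrightarrow> F x) (at x within N \<inter> S)"
    using \<open>x \<in> S\<close> by (auto simp: continuous_on_def)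
  then show "(F \<longlongrightarrow> F x) (at x within S)"
    using N at_within_nhd[of x N "N \<inter> S" S] by (simp add: Int_ac)
qed

lemma C1_on_local:
  assumes "\<And>x. x \<in> S \<Longrightarrow> \<exists>N. open N \<and> x \<in> N \<and> C1_on (N \<inter> S) F"
  shows "C1_on S F"
  unfolding C1_on_def
proof (intro conjI allI ballI)
  show "F differentiable at x" if "x \<in> S" for x
    using assms[OF that] that by (auto simp: C1_on_def)
  fix v
  have "\<exists>N. open N \<and> x \<in> N \<and> continuous_on (N \<inter> S) (\<lambda>x. frechet_derivative F (at x) v)" if "x \<in> S" for x
    using assms[OF that] unfolding C1_on_def by blast
  then show "continuous_on S (\<lambda>x. frechet_derivative F (at x) v)"
    by (rule continuous_on_local)
qed

lemma has_derivative_cong_nhds: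
  assumes "(G has_derivative D) (at u)" "\<forall>\<^sub>F x in nhds u. G x = F x"
  shows "(F has_derivative D) (at u)"
proof -
  obtain S where "open S" "u \<in> S" "\<And>x. x \<in> S \<Longrightarrow> G x = F x"
    using assms(2) by (auto simp: eventually_nhds)
  then show ?thesis
    using has_derivative_transform_within_open[OF assms(1)] by blast
qed

lemma frechet_derivative_eq_nhds:
  assumes "(G has_derivative D) (at u)" "\<forall>\<^sub>F x in nhds u. G x = F x"
  shows "frechet_derivative F (at u) = D"
  using frechet_derivative_at has_derivative_cong_nhds[OF assms] by fastforce

lemma open_Int_vimage: "continuous_on S f \<Longrightarrow> open S \<Longrightarrow> open U \<Longrightarrow> open (S \<inter> f -` U)"
  using continuous_on_open_vimage[of S f] by (auto simp: Int_commute)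

lemma C1_into_iff:
  "C1_into A S p \<longleftrightarrow> continuous_on S p \<and> (\<forall>c\<in>A. C1_on (S \<inter> p -` fst c) (snd c \<circ> p))"
  by (simp add: C1_into_def case_prod_beta)

lemma C1_map_iff:
  "C1_map A F \<longleftrightarrow> continuous_on UNIV F \<and> (\<forall>c\<in>A. \<forall>d\<in>A.
    C1_on (snd c ` (fst c \<inter> F -` fst d)) (snd d \<circ> F \<circ> inv_into (fst c) (snd c)))"
  by (simp add: C1_map_def case_prod_beta)

section \<open>Differentiability of maps into the manifold\<close>

locale atlas =
  fixes A :: "('m::t2_space, 'e::euclidean_space) chart set"
  assumes smooth_atlas: "smooth_atlas A"
begin

abbreviation cinv :: "('m, 'e) chart \<Rightarrow> 'e \<Rightarrow> 'm" where
  "cinv c \<equiv> inv_into (fst c) (snd c)"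

lemma chart_at_in [simp]: "chart_at A x \<in> A" "x \<in> fst (chart_at A x)"
proof -
  have "\<exists>c. c \<in> A \<and> x \<in> fst c"
    using smooth_atlas unfolding smooth_atlas_def by (force simp: set_eq_iff)
  then show "chart_at A x \<in> A" "x \<in> fst (chart_at A x)"
    unfolding chart_at_def by (metis (mono_tags, lifting) someI_ex)+
qed

lemma chart_homeomorphism:
  assumes "c \<in> A"
  shows "open (fst c)" "open (snd c ` fst c)" "homeomorphism (fst c) (snd c ` fst c) (snd c) (cinv c)"
  using assms smooth_atlas unfolding smooth_atlas_def by (cases c; force)+

lemma chart_simps [simp]:
  assumes "c \<in> A"
  shows "x \<in> fst c \<Longrightarrow> cinv c (snd c x) = x"
    "z \<in> snd c ` fst c \<Longrightarrow> snd c (cinv c z) = z"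
    "z \<in> snd c ` fst c \<Longrightarrow> cinv c z \<in> fst c"
  using chart_homeomorphism(3)[OF assms] unfolding homeomorphism_def by (force simp: inv_into_into)+

lemma chart_continuous:
  assumes "c \<in> A"
  shows "continuous_on (fst c) (snd c)" "continuous_on (snd c ` fst c) (cinv c)"
  using chart_homeomorphism(3)[OF assms] unfolding homeomorphism_def by blast+

lemma transition_C1:
  assumes "c \<in> A" "d \<in> A"
  shows "C1_on (snd c ` (fst c \<inter> fst d)) (snd d \<circ> cinv c)"
proof -
  have "\<forall>c\<in>A. \<forall>d\<in>A. \<forall>n. Ck_on n (snd c ` (fst c \<inter> fst d)) (snd d \<circ> cinv c)"
    using smooth_atlas unfolding smooth_atlas_def case_prod_beta by blast
  then show ?thesis
    using assms Ck_on_1(1) by metis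
qed

lemma C1_into_chart:
  "C1_into A S p \<Longrightarrow> c \<in> A \<Longrightarrow> C1_on (S \<inter> p -` fst c) (snd c \<circ> p)"
  unfolding C1_into_iff by blast

text \<open>\<open>C1_into\<close> tests every chart, also those met by the image only in part. The
  transition maps reduce this to a single chart per point, on a neighbourhood whose image lies
  entirely in it.\<close>

lemma C1_into_local:
  fixes p :: "'d::euclidean_space \<Rightarrow> 'm"
  assumes "open S" "\<And>u. u \<in> S \<Longrightarrow> isCont p u \<and>
    (\<exists>c\<in>A. \<exists>N. open N \<and> u \<in> N \<and> p ` N \<subseteq> fst c \<and> C1_on N (snd c \<circ> p))"
  shows "C1_into A S p"
  unfolding C1_into_iff
proof (intro conjI ballI)
  show cont: "continuous_on S p"
    by (simp add: assms(2) continuous_at_imp_continuous_on)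
  show "C1_on (S \<inter> p -` fst d) (snd d \<circ> p)" if d: "d \<in> A" for d
  proof (rule C1_on_local)
    fix u assume u: "u \<in> S \<inter> p -` fst d"
    then obtain c N where c: "c \<in> A" "open N" "u \<in> N" "p ` N \<subseteq> fst c" "C1_on N (snd c \<circ> p)"
      using assms(2) by blast
    have o: "open (S \<inter> p -` fst d)"
      using open_Int_vimage[OF cont assms(1) chart_homeomorphism(1)[OF d]] .
    let ?N = "N \<inter> (S \<inter> p -` fst d)"
    have "C1_on ?N ((snd d \<circ> cinv c) \<circ> (snd c \<circ> p))"
      by (rule C1_on_compose[OF _ transition_C1[OF c(1) d]])
        (use c in \<open>auto intro: C1_on_mono\<close>)
    then have "C1_on ?N (snd d \<circ> p)"
      by (rule C1_on_cong) (use c o in auto)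
    then show "\<exists>N. open N \<and> u \<in> N \<and> C1_on (N \<inter> (S \<inter> p -` fst d)) (snd d \<circ> p)"
      using c u by blast
  qed
qed

lemma C1_into_isCont: "C1_into A S p \<Longrightarrow> open S \<Longrightarrow> u \<in> S \<Longrightarrow> isCont p u"
  unfolding C1_into_def by (simp add: continuous_on_eq_continuous_at)

lemma C1_into_nbhd:
  assumes "C1_into A S p" "open S" "u \<in> S" "c \<in> A" "p u \<in> fst c"
  obtains N where "open N" "u \<in> N" "N \<subseteq> S" "p ` N \<subseteq> fst c" "C1_on N (snd c \<circ> p)"
proof
  show "open (S \<inter> p -` fst c)"
    using assms chart_homeomorphism(1)[OF assms(4)] open_Int_vimage unfolding C1_into_iff by blast
  show "C1_on (S \<inter> p -` fst c) (snd c \<circ> p)"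
    using C1_into_chart[OF assms(1,4)] .
qed (use assms in auto)

lemma C1_into_reparam:
  fixes \<sigma> :: "'c::euclidean_space \<Rightarrow> 'd::euclidean_space"
  assumes "C1_into A S p" "open S" "open T" "C1_on T \<sigma>" "\<sigma> ` T \<subseteq> S"
  shows "C1_into A T (p \<circ> \<sigma>)"
proof (rule C1_into_local[OF assms(3)])
  fix u assume u: "u \<in> T"
  have cont: "continuous_on T \<sigma>"
    using C1_on_continuous_on[OF assms(4)] .
  obtain N where N: "open N" "\<sigma> u \<in> N" "N \<subseteq> S" "p ` N \<subseteq> fst (chart_at A (p (\<sigma> u)))"
      "C1_on N (snd (chart_at A (p (\<sigma> u))) \<circ> p)"
    using C1_into_nbhd[OF assms(1,2), of "\<sigma> u" "chart_at A (p (\<sigma> u))"] u assms(5) by auto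
  have "open (T \<inter> \<sigma> -` N)"
    using open_Int_vimage[OF cont assms(3) N(1)] .
  moreover have "C1_on (T \<inter> \<sigma> -` N) ((snd (chart_at A (p (\<sigma> u))) \<circ> p) \<circ> \<sigma>)"
    by (rule C1_on_compose[OF C1_on_mono[OF assms(4)] N(5)]) auto
  moreover have "isCont (p \<circ> \<sigma>) u"
    using u assms(3,5) cont C1_into_isCont[OF assms(1,2), of "\<sigma> u"]
    by (intro continuous_at_compose) (auto simp: continuous_on_eq_continuous_at)
  ultimately show "isCont (p \<circ> \<sigma>) u \<and> (\<exists>c\<in>A. \<exists>N. open N \<and> u \<in> N \<and> (p \<circ> \<sigma>) ` N \<subseteq> fst c \<and>
      C1_on N (snd c \<circ> (p \<circ> \<sigma>)))"
    using N u by (intro conjI bexI[of _ "chart_at A (p (\<sigma> u))"] exI[of _ "T \<inter> \<sigma> -` N"])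
      (auto simp: o_assoc)
qed

text \<open>The pointwise counterpart of \<open>C1_into\<close>, so that chain rules need not carry
  an open domain along. One chart is enough, and continuity keeps nearby points inside its
  domain.\<close>

definition mdifferentiable :: "('d::euclidean_space \<Rightarrow> 'm) \<Rightarrow> 'd \<Rightarrow> bool" where
  "mdifferentiable p u \<longleftrightarrow> isCont p u \<and> (\<exists>c\<in>A. p u \<in> fst c \<and> (snd c \<circ> p) differentiable (at u))"

lemma eventually_in_chart: "isCont p u \<Longrightarrow> c \<in> A \<Longrightarrow> p u \<in> fst c \<Longrightarrow> \<forall>\<^sub>F x in nhds u. p x \<in> fst c"
  using chart_homeomorphism(1)[of c] by (auto simp: continuous_at_open eventually_nhds)

lemma mdifferentiable_chart:
  assumes "mdifferentiable p u" "c \<in> A" "p u \<in> fst c"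
  shows "(snd c \<circ> p has_derivative frechet_derivative (snd c \<circ> p) (at u)) (at u)"
proof -
  obtain d where d: "d \<in> A" "p u \<in> fst d" "(snd d \<circ> p) differentiable (at u)" "isCont p u"
    using assms(1) unfolding mdifferentiable_def by blast
  have "(snd c \<circ> cinv d) differentiable (at ((snd d \<circ> p) u))"
    using transition_C1[OF d(1) assms(2)] d(2) assms(3) unfolding C1_on_def by auto
  then have "((snd c \<circ> cinv d) \<circ> (snd d \<circ> p)) differentiable (at u)"
    using d(3) differentiable_chain_at by blast
  moreover have "\<forall>\<^sub>F x in nhds u. ((snd c \<circ> cinv d) \<circ> (snd d \<circ> p)) x = (snd c \<circ> p) x"
    using eventually_in_chart[OF d(4,1,2)] by eventually_elim (use d in auto)
  ultimately have "(snd c \<circ> p) differentiable (at u)"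
    unfolding differentiable_def using has_derivative_cong_nhds by blast
  then show ?thesis
    by (simp flip: frechet_derivative_works)
qed

lemma C1_into_mdifferentiable:
  assumes "C1_into A S p" "open S" "u \<in> S"
  shows "mdifferentiable p u"
  unfolding mdifferentiable_def
  using C1_into_chart[OF assms(1), of "chart_at A (p u)"] C1_into_isCont[OF assms] assms(3)
  by (auto simp: C1_on_def intro!: bexI[of _ "chart_at A (p u)"])

lemma chart_inverse_C1_into:
  assumes "c \<in> A"
  shows "C1_into A (snd c ` fst c) (cinv c)"
  unfolding C1_into_iff
proof (intro conjI ballI)
  show "continuous_on (snd c ` fst c) (cinv c)" using chart_continuous[OF assms] by blast
  fix d assume d: "d \<in> A"
  have "snd c ` fst c \<inter> cinv c -` fst d = snd c ` (fst c \<inter> fst d)"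
    using assms by auto
  then show "C1_on (snd c ` fst c \<inter> cinv c -` fst d) (snd d \<circ> cinv c)"
    using transition_C1[OF assms d] by simp
qed

lemma mdifferentiable_chart_inverse:
  "c \<in> A \<Longrightarrow> y \<in> fst c \<Longrightarrow> mdifferentiable (cinv c) (snd c y)"
  by (rule C1_into_mdifferentiable[OF chart_inverse_C1_into chart_homeomorphism(2)]) auto

lemma coord_vec_eq_pdiff: "coord_vec A c y v = pdiff A (cinv c) (snd c y) v"
  by (cases c) (simp add: coord_vec_def)

lemma pdiff_chain:
  fixes p :: "'d::euclidean_space \<Rightarrow> 'm" and F :: "'m \<Rightarrow> 'm"
  assumes p: "mdifferentiable p u" and c: "c \<in> A" "p u \<in> fst c"
    and F: "mdifferentiable (F \<circ> cinv c) (snd c (p u))"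
  shows "mdifferentiable (F \<circ> p) u"
    "pdiff A (F \<circ> p) u w =
      pdiff A (F \<circ> cinv c) (snd c (p u)) (frechet_derivative (snd c \<circ> p) (at u) w)"
proof -
  let ?d = "chart_at A (F (p u))"
  have cont: "isCont p u" "isCont (F \<circ> cinv c) (snd c (p u))"
    using p F unfolding mdifferentiable_def by blast+
  have ev: "\<forall>\<^sub>F x in nhds u. (snd ?d \<circ> (F \<circ> cinv c) \<circ> (snd c \<circ> p)) x = (snd ?d \<circ> (F \<circ> p)) x"
    using eventually_in_chart[OF cont(1) c] by eventually_elim (use c in auto)
  have 1: "(snd c \<circ> p has_derivative frechet_derivative (snd c \<circ> p) (at u)) (at u)"
    using mdifferentiable_chart[OF p c] .
  have 2: "(snd ?d \<circ> (F \<circ> cinv c) has_derivative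
      frechet_derivative (snd ?d \<circ> (F \<circ> cinv c)) (at ((snd c \<circ> p) u))) (at ((snd c \<circ> p) u))"
    using mdifferentiable_chart[OF F, of ?d] c by simp
  note 3 = diff_chain_at[OF 1 2]
  show "pdiff A (F \<circ> p) u w =
      pdiff A (F \<circ> cinv c) (snd c (p u)) (frechet_derivative (snd c \<circ> p) (at u) w)"
    using frechet_derivative_eq_nhds[OF 3 ev] c unfolding pdiff_def by (simp add: comp_def)
  have "isCont ((F \<circ> cinv c) \<circ> (snd c \<circ> p)) u"
    using continuous_at_compose[OF has_derivative_continuous[OF 1]] cont(2) by simp
  moreover have "\<forall>\<^sub>F x in nhds u. ((F \<circ> cinv c) \<circ> (snd c \<circ> p)) x = (F \<circ> p) x"
    using eventually_in_chart[OF cont(1) c] by eventually_elim (use c in auto)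
  ultimately have "isCont (F \<circ> p) u"
    using isCont_cong by blast
  moreover have "(snd ?d \<circ> (F \<circ> p)) differentiable (at u)"
    unfolding differentiable_def using has_derivative_cong_nhds[OF 3 ev] by blast
  ultimately show "mdifferentiable (F \<circ> p) u"
    unfolding mdifferentiable_def by (auto intro!: bexI[of _ ?d])
qed

text \<open>The chain rule with \<open>F = id\<close>. It splits a tangent vector into a coordinate
  vector field, against which continuity of tensors is tested, and an ordinary derivative in the
  chart.\<close>

lemma pdiff_chart:
  assumes "mdifferentiable p u" "c \<in> A" "p u \<in> fst c"
  shows "pdiff A p u w = coord_vec A c (p u) (frechet_derivative (snd c \<circ> p) (at u) w)"
  using pdiff_chain(2)[OF assms, of id w] mdifferentiable_chart_inverse[OF assms(2,3)]
  by (simp add: coord_vec_eq_pdiff)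

lemma coord_vec_chart_at: "coord_vec A (chart_at A y) y v = v"
proof -
  let ?c = "chart_at A y"
  have "\<forall>\<^sub>F z in nhds (snd ?c y). z = (snd ?c \<circ> cinv ?c) z"
    using eventually_nhds_in_open[OF chart_homeomorphism(2)[of ?c], of "snd ?c y"]
    by (auto elim!: eventually_mono)
  then have "frechet_derivative (snd ?c \<circ> cinv ?c) (at (snd ?c y)) = (\<lambda>x. x)"
    by (rule frechet_derivative_eq_nhds[rotated]) simp
  then show ?thesis
    by (simp add: coord_vec_eq_pdiff pdiff_def)
qed

lemma linear_pdiff: "mdifferentiable p u \<Longrightarrow> linear (pdiff A p u)"
  unfolding pdiff_def
  using mdifferentiable_chart[of p u "chart_at A (p u)"]
  by (simp add: has_derivative_linear)

lemma linear_coord_vec: "c \<in> A \<Longrightarrow> y \<in> fst c \<Longrightarrow> linear (coord_vec A c y)"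
  using linear_pdiff[OF mdifferentiable_chart_inverse, of c y] by (simp add: coord_vec_eq_pdiff[abs_def])

lemma coord_vec_surj:
  assumes "c \<in> A" "y \<in> fst c"
  obtains w where "v = coord_vec A c y w"
proof -
  let ?d = "chart_at A y"
  have "v = pdiff A (cinv ?d) (snd ?d y) v"
    by (metis coord_vec_chart_at coord_vec_eq_pdiff)
  also have "\<dots> = coord_vec A c y (frechet_derivative (snd c \<circ> cinv ?d) (at (snd ?d y)) v)"
    using pdiff_chart[OF mdifferentiable_chart_inverse, of ?d y c] assms by simp
  finally show thesis using that by blast
qed

lemma coord_vec_inj:
  assumes "c \<in> A" "y \<in> fst c"
  shows "inj (coord_vec A c y)"
  by (rule linear_surj_imp_inj[OF linear_coord_vec[OF assms]])
    (metis coord_vec_surj[OF assms] surj_def)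

lemma mdiff_pdiff:
  assumes "mdifferentiable p u"
    and "mdifferentiable (F \<circ> cinv (chart_at A (p u))) (snd (chart_at A (p u)) (p u))"
  shows "mdiff A F (p u) (pdiff A p u w) = pdiff A (F \<circ> p) u w"
proof -
  let ?c = "chart_at A (p u)"
  have "mdiff A F (p u) v = pdiff A (F \<circ> cinv ?c) (snd ?c (p u)) v" for v
    by (simp add: mdiff_def case_prod_beta)
  then show ?thesis
    using pdiff_chain(2)[OF assms(1) _ _ assms(2), of w] pdiff_chart[OF assms(1), of ?c w]
    by (simp add: coord_vec_chart_at)
qed

lemma C1_map_compose_into:
  assumes "C1_map A F" "C1_into A S p" "open S"
  shows "C1_into A S (F \<circ> p)"
proof (rule C1_into_local[OF assms(3)])
  fix u assume u: "u \<in> S"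
  let ?c = "chart_at A (p u)" and ?d = "chart_at A (F (p u))"
  have F: "continuous_on UNIV F" "C1_on (snd ?c ` (fst ?c \<inter> F -` fst ?d)) (snd ?d \<circ> F \<circ> cinv ?c)"
    using assms(1) unfolding C1_map_iff by auto
  obtain N where N: "open N" "u \<in> N" "N \<subseteq> S" "p ` N \<subseteq> fst ?c" "C1_on N (snd ?c \<circ> p)"
    using C1_into_nbhd[OF assms(2,3) u, of ?c] by auto
  have cont: "isCont (F \<circ> p) x" if "x \<in> S" for x
    using F(1) C1_into_isCont[OF assms(2,3) that]
    by (intro continuous_at_compose) (simp_all add: continuous_on_eq_continuous_at)
  let ?N = "N \<inter> (F \<circ> p) -` fst ?d"
  have o: "open ?N"
    using N cont chart_homeomorphism(1)[of ?d]
    by (intro open_Int_vimage continuous_at_imp_continuous_on) auto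
  have "C1_on ?N ((snd ?d \<circ> F \<circ> cinv ?c) \<circ> (snd ?c \<circ> p))"
    by (rule C1_on_compose[OF C1_on_mono[OF N(5)] F(2)]) (use N in auto)
  then have "C1_on ?N (snd ?d \<circ> (F \<circ> p))"
    by (rule C1_on_cong[OF _ o]) (use N in auto)
  then show "isCont (F \<circ> p) u \<and>
      (\<exists>c\<in>A. \<exists>N. open N \<and> u \<in> N \<and> (F \<circ> p) ` N \<subseteq> fst c \<and> C1_on N (snd c \<circ> (F \<circ> p)))"
    using cont[OF u] N o by (intro conjI bexI[of _ ?d] exI[of _ ?N]) auto
qed

lemma C1_map_mdifferentiable:
  assumes "C1_map A F" "c \<in> A" "y \<in> fst c"
  shows "mdifferentiable (F \<circ> cinv c) (snd c y)"
  using C1_into_mdifferentiable[OF C1_map_compose_into[OF assms(1) chart_inverse_C1_into[OF assms(2)]]]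
    chart_homeomorphism(2)[OF assms(2)] assms(3) by blast

lemma mdiff_pdiff_C1:
  assumes "C1_map A F" "mdifferentiable p u"
  shows "mdifferentiable (F \<circ> p) u" "mdiff A F (p u) (pdiff A p u w) = pdiff A (F \<circ> p) u w"
  using pdiff_chain(1)[OF assms(2), of "chart_at A (p u)" F] mdiff_pdiff[OF assms(2), of F w]
    C1_map_mdifferentiable[OF assms(1), of "chart_at A (p u)" "p u"] by auto

lemma mdiff_coord_vec:
  assumes "C1_map A F" "c \<in> A" "y \<in> fst c"
  shows "mdiff A F y (coord_vec A c y w) = pdiff A (F \<circ> cinv c) (snd c y) w"
  using mdiff_pdiff_C1(2)[OF assms(1) mdifferentiable_chart_inverse[OF assms(2,3)]] assms
  by (simp add: coord_vec_eq_pdiff)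

lemma C1_map_id: "C1_map A id"
  using transition_C1 by (simp add: C1_map_iff flip: id_def)

lemma C1_map_compose:
  assumes "C1_map A F" "C1_map A G"
  shows "C1_map A (G \<circ> F)"
  unfolding C1_map_iff
proof (intro conjI ballI)
  show "continuous_on UNIV (G \<circ> F)"
    using assms unfolding C1_map_iff by (meson continuous_on_compose continuous_on_subset subset_UNIV)
  fix c d assume c: "c \<in> A" and d: "d \<in> A"
  have "C1_into A (snd c ` fst c) (G \<circ> (F \<circ> cinv c))"
    by (intro C1_map_compose_into assms chart_inverse_C1_into c chart_homeomorphism)
  from C1_into_chart[OF this d]
  have "C1_on (snd c ` fst c \<inter> (G \<circ> (F \<circ> cinv c)) -` fst d) (snd d \<circ> (G \<circ> F) \<circ> cinv c)"
    by (simp add: o_assoc)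
  then show "C1_on (snd c ` (fst c \<inter> (G \<circ> F) -` fst d)) (snd d \<circ> (G \<circ> F) \<circ> cinv c)"
    by (rule C1_on_mono) (use c in auto)
qed

lemma mdiff_compose:
  assumes "C1_map A F" "C1_map A G"
  shows "mdiff A (G \<circ> F) y v = mdiff A G (F y) (mdiff A F y v)"
proof -
  let ?c = "chart_at A y"
  have v: "v = coord_vec A ?c y v"
    by (simp add: coord_vec_chart_at)
  have F: "mdifferentiable (F \<circ> cinv ?c) (snd ?c y)"
    using C1_map_mdifferentiable[OF assms(1)] by simp
  show ?thesis
    using mdiff_pdiff_C1(2)[OF assms(2) F, of v] mdiff_coord_vec[OF assms(1), of ?c y v]
      mdiff_coord_vec[OF C1_map_compose[OF assms], of ?c y v] v by (simp add: o_assoc)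
qed

lemma mdiff_id: "mdiff A id y v = v"
  using mdiff_coord_vec[OF C1_map_id, of "chart_at A y" y v]
  by (simp add: coord_vec_chart_at flip: coord_vec_eq_pdiff)

lemma linear_mdiff: 
  assumes "C1_map A F" shows "linear (mdiff A F y)"
proof -
  have "mdiff A F y = pdiff A (F \<circ> cinv (chart_at A y)) (snd (chart_at A y) y)"
    using mdiff_coord_vec[OF assms, of "chart_at A y" y] by (auto simp: coord_vec_chart_at)
  then show ?thesis
    using linear_pdiff[OF C1_map_mdifferentiable[OF assms, of "chart_at A y" y]] by simp
qed

end

section \<open>Continuous tensors and pullback of forms\<close>

lemma compact_nbhd_cover:
  assumes "compact S" "\<And>z. z \<in> S \<Longrightarrow> open (U z)" "\<And>z. z \<in> S \<Longrightarrow> z \<in> U z"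
  obtains Z where "Z \<subseteq> S" "finite Z" "S \<subseteq> (\<Union>z\<in>Z. U z)"
proof (rule compactE_image[OF assms(1), of S U])
  show "S \<subseteq> (\<Union>z\<in>S. U z)"
    using assms(3) by blast
qed (use assms(2) that in auto)

context atlas begin

text \<open>Forms without the alternating property, so that the metric, a tensor of degree 2, is
  covered by the same continuity and boundedness results.\<close>

definition tensor :: "nat \<Rightarrow> ('m, 'e) form \<Rightarrow> bool" where
  "tensor j \<omega> \<longleftrightarrow>
     (\<forall>x v w. (\<forall>i<j. v i = w i) \<longrightarrow> \<omega> x v = \<omega> x w) \<and>
     (\<forall>x v. \<forall>i<j. linear (\<lambda>u. \<omega> x (v(i := u)))) \<and>
     (\<forall>c\<in>A. \<forall>v. continuous_on (fst c) (\<lambda>y. \<omega> y (\<lambda>i. coord_vec A c y (v i))))"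

lemma diff_form_tensor: "diff_form A j \<omega> \<Longrightarrow> tensor j \<omega>"
  unfolding diff_form_def tensor_def by blast

lemma tensor_cong: "tensor j \<omega> \<Longrightarrow> (\<And>i. i < j \<Longrightarrow> v i = w i) \<Longrightarrow> \<omega> x v = \<omega> x w"
  unfolding tensor_def by blast

lemma tensor_linear: "tensor j \<omega> \<Longrightarrow> i < j \<Longrightarrow> linear (\<lambda>u. \<omega> x (v(i := u)))"
  unfolding tensor_def by blast

text \<open>One step of a multilinear expansion: slot \<open>n\<close> is traded for a basis vector,
  while the slots below \<open>n\<close> still hold general vectors and those above come from
  \<open>w\<close>. Induction on \<open>n\<close> reduces general arguments to constant
  coordinates.\<close>

lemma tensor_expand:
  assumes \<omega>: "tensor j \<omega>" and c: "c \<in> A" "y \<in> fst c" and n: "n < j"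
  shows "\<omega> y (\<lambda>i. coord_vec A c y (if i < Suc n then a i else w i)) =
    (\<Sum>b\<in>Basis. (a n \<bullet> b) * \<omega> y (\<lambda>i. coord_vec A c y (if i < n then a i else (w(n := b)) i)))"
proof -
  define z where "z = (\<lambda>i. coord_vec A c y (if i < n then a i else w i))"
  have "linear ((\<lambda>u. \<omega> y (z(n := u))) \<circ> coord_vec A c y)"
    by (intro linear_compose linear_coord_vec c tensor_linear[OF \<omega> n])
  note linear_sum_Basis[OF this, of "a n"]
  moreover have "z(n := coord_vec A c y u) =
      (\<lambda>i. coord_vec A c y (if i < n then a i else (w(n := u)) i))" for u
    by (auto simp: z_def fun_eq_iff)
  moreover have "z(n := coord_vec A c y (a n)) =
      (\<lambda>i. coord_vec A c y (if i < Suc n then a i else w i))"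
    by (auto simp: z_def fun_eq_iff less_Suc_eq)
  ultimately show ?thesis by simp
qed

text \<open>Continuity is given only for constant coordinates. The full expansion is a polynomial in
  the coordinates of the vectors \<open>a i u\<close> whose coefficients are of that kind.\<close>

lemma tensor_continuous_frame:
  fixes p :: "'d::topological_space \<Rightarrow> 'm"
  assumes \<omega>: "tensor j \<omega>" and c: "c \<in> A" and p: "continuous_on N p" "p ` N \<subseteq> fst c"
    and a: "\<And>i. i < j \<Longrightarrow> continuous_on N (a i)"
  shows "continuous_on N (\<lambda>u. \<omega> (p u) (\<lambda>i. coord_vec A c (p u) (a i u)))"
proof -
  have "continuous_on N (\<lambda>u. \<omega> (p u) (\<lambda>i. coord_vec A c (p u) (if i < n then a i u else w i)))"
    if "n \<le> j" for n w
    using that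
  proof (induction n arbitrary: w)
    case 0
    have "continuous_on (fst c) (\<lambda>y. \<omega> y (\<lambda>i. coord_vec A c y (w i)))"
      using \<omega> c unfolding tensor_def by blast
    from continuous_on_compose2[OF this p] show ?case by simp
  next
    case (Suc n)
    have "continuous_on N (\<lambda>u. \<Sum>b\<in>Basis. (a n u \<bullet> b) *
        \<omega> (p u) (\<lambda>i. coord_vec A c (p u) (if i < n then a i u else (w(n := b)) i)))"
      using Suc.prems by (intro continuous_intros a Suc.IH) auto
    then show ?case
      by (rule continuous_on_eq) (subst tensor_expand[OF \<omega> c], use p Suc.prems in auto)
  qed
  from this[of j "\<lambda>_. 0"] show ?thesis
    by (rule continuous_on_eq[OF _ tensor_cong[OF \<omega>]]) auto
qed

text \<open>Each of the \<open>j\<close> expansion steps costs a sum over \<open>DIM('e)\<close>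
  basis vectors with coefficients of size at most \<open>K\<close>; this produces the factor
  \<open>(real DIM('e) * K) ^ j\<close>.\<close>

lemma tensor_bound_frame:
  fixes K m :: real
  assumes \<omega>: "tensor j \<omega>" and c: "c \<in> A" "y \<in> fst c" and "0 \<le> K"
    and m: "\<And>b. b \<in> {..<j} \<rightarrow>\<^sub>E Basis \<Longrightarrow> \<bar>\<omega> y (\<lambda>i. coord_vec A c y (b i))\<bar> \<le> m"
    and a: "\<And>i. i < j \<Longrightarrow> norm (a i) \<le> K"
  shows "\<bar>\<omega> y (\<lambda>i. coord_vec A c y (a i))\<bar> \<le> (real DIM('e) * K) ^ j * m"
proof -
  have "\<bar>\<omega> y (\<lambda>i. coord_vec A c y (if i < n then a i else w i))\<bar> \<le> (real DIM('e) * K) ^ n * m"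
    if "n \<le> j" "\<And>i. i < j \<Longrightarrow> w i \<in> Basis" for n w
    using that
  proof (induction n arbitrary: w)
    case 0
    have "\<omega> y (\<lambda>i. coord_vec A c y (w i)) = \<omega> y (\<lambda>i. coord_vec A c y (restrict w {..<j} i))"
      by (rule tensor_cong[OF \<omega>]) simp
    with m[of "restrict w {..<j}"] 0 show ?case by simp
  next
    case (Suc n)
    have "\<bar>(a n \<bullet> b) * \<omega> y (\<lambda>i. coord_vec A c y (if i < n then a i else (w(n := b)) i))\<bar>
        \<le> K * ((real DIM('e) * K) ^ n * m)" if "b \<in> Basis" for b
      unfolding abs_mult
    proof (intro mult_mono)
      show "\<bar>a n \<bullet> b\<bar> \<le> K"
        using Basis_le_norm[OF that, of "a n"] a[of n] Suc.prems(1) by simp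
      show "\<bar>\<omega> y (\<lambda>i. coord_vec A c y (if i < n then a i else (w(n := b)) i))\<bar> \<le> (real DIM('e) * K) ^ n * m"
        using Suc that by (intro Suc.IH) auto
    qed (use \<open>0 \<le> K\<close> in auto)
    then have "(\<Sum>b\<in>Basis. \<bar>(a n \<bullet> b) * \<omega> y (\<lambda>i. coord_vec A c y (if i < n then a i else (w(n := b)) i))\<bar>)
        \<le> of_nat DIM('e) * (K * ((real DIM('e) * K) ^ n * m))"
      by (rule sum_bounded_above)
    then show ?case
      using Suc.prems by (subst tensor_expand[OF \<omega> c])
        (auto intro!: order_trans[OF sum_abs] simp: mult_ac)
  qed
  from this[of j "\<lambda>_. SOME b. b \<in> Basis"] some_in_eq[of Basis] show ?thesis
    using tensor_cong[OF \<omega>, of "\<lambda>i. coord_vec A c y (if i < j then a i else (SOME b. b \<in> Basis))"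
      "\<lambda>i. coord_vec A c y (a i)" y] by auto
qed

text \<open>The values of \<open>pdiff\<close> may jump with the chart chosen at \<open>p u\<close>.
  Rewriting them near each point in one fixed chart turns them into coordinate vectors with
  continuous coefficients.\<close>

lemma tensor_continuous_pdiff:
  fixes p :: "'d::euclidean_space \<Rightarrow> 'm"
  assumes \<omega>: "tensor j \<omega>" and p: "C1_into A S p" "open S"
  shows "continuous_on S (\<lambda>u. \<omega> (p u) (\<lambda>i. pdiff A p u (w i)))"
proof (rule continuous_on_local)
  fix u assume u: "u \<in> S"
  let ?c = "chart_at A (p u)"
  obtain N where N: "open N" "u \<in> N" "N \<subseteq> S" "p ` N \<subseteq> fst ?c" "C1_on N (snd ?c \<circ> p)"
    using C1_into_nbhd[OF p u, of ?c] by auto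
  have "continuous_on N (\<lambda>u. \<omega> (p u) (\<lambda>i. coord_vec A ?c (p u)
      (frechet_derivative (snd ?c \<circ> p) (at u) (w i))))"
    using p N by (intro tensor_continuous_frame[OF \<omega>])
      (auto simp: C1_into_iff intro: C1_on_continuous_derivative continuous_on_subset)
  then have "continuous_on N (\<lambda>u. \<omega> (p u) (\<lambda>i. pdiff A p u (w i)))"
    by (rule continuous_on_eq) (use N in \<open>subst pdiff_chart[OF C1_into_mdifferentiable[OF p], where c = ?c], auto\<close>)
  then show "\<exists>N. open N \<and> u \<in> N \<and> continuous_on (N \<inter> S) (\<lambda>u. \<omega> (p u) (\<lambda>i. pdiff A p u (w i)))"
    using N by (metis inf.absorb1)
qed

text \<open>The coefficients of the pullback in a chart \<open>c\<close> are the values of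
  \<open>\<omega>\<close> along the \<open>C1\<close> map \<open>F \<circ> cinv c\<close>, which
  gives their continuity.\<close>

lemma diff_form_pullback:
  assumes \<omega>: "diff_form A j \<omega>" and F: "C1_map A F"
  shows "diff_form A j (pullback_form A F \<omega>)"
  unfolding diff_form_def
proof (intro conjI allI impI ballI)
  fix x v w assume "\<forall>i<j. (v i :: 'e) = w i"
  then show "pullback_form A F \<omega> x v = pullback_form A F \<omega> x w"
    unfolding pullback_form_def by (intro tensor_cong[OF diff_form_tensor[OF \<omega>]]) auto
next
  fix x and v :: "nat \<Rightarrow> 'e" and i assume i: "i < j"
  have "linear ((\<lambda>u. \<omega> (F x) ((\<lambda>l. mdiff A F x (v l))(i := u))) \<circ> mdiff A F x)"
    by (intro linear_compose linear_mdiff F tensor_linear[OF diff_form_tensor[OF \<omega>] i])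
  moreover have "(\<lambda>l. mdiff A F x (v l))(i := mdiff A F x u) = (\<lambda>l. mdiff A F x ((v(i := u)) l))" for u
    by auto
  ultimately show "linear (\<lambda>u. pullback_form A F \<omega> x (v(i := u)))"
    by (simp add: pullback_form_def o_def)
next
  fix x and v :: "nat \<Rightarrow> 'e" and i l assume "i < l \<and> l < j \<and> v i = v l"
  then show "pullback_form A F \<omega> x v = 0"
    using \<omega> unfolding diff_form_def pullback_form_def by metis
next
  fix c and v :: "nat \<Rightarrow> 'e" assume c: "c \<in> A"
  have "continuous_on (snd c ` fst c) (\<lambda>z. \<omega> ((F \<circ> cinv c) z) (\<lambda>i. pdiff A (F \<circ> cinv c) z (v i)))"
    by (intro tensor_continuous_pdiff[OF diff_form_tensor[OF \<omega>]] C1_map_compose_into F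
        chart_inverse_C1_into chart_homeomorphism c)
  then have "continuous_on (fst c) (\<lambda>y. \<omega> ((F \<circ> cinv c) (snd c y)) (\<lambda>i. pdiff A (F \<circ> cinv c) (snd c y) (v i)))"
    by (rule continuous_on_compose2[OF _ chart_continuous(1)[OF c]]) auto
  then show "continuous_on (fst c) (\<lambda>y. pullback_form A F \<omega> y (\<lambda>i. coord_vec A c y (v i)))"
    by (rule continuous_on_eq) (simp add: pullback_form_def mdiff_coord_vec[OF F] c)
qed

text \<open>Since closedness means Stokes' formula on all cubes, the pullback need not be
  differentiated: its face integrals over \<open>\<sigma>\<close> are those of
  \<open>\<omega>\<close> over the cube \<open>F \<circ> \<sigma>\<close>, which is again
  \<open>C1\<close>.\<close>

lemma closed_form_pullback:
  assumes \<omega>: "closed_form A TYPE('k::finite) \<omega>" and F: "C1_map A F"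
  shows "closed_form A TYPE('k) (pullback_form A F \<omega>)"
  unfolding closed_form_def has_ext_deriv_def
proof (intro conjI allI impI)
  show "diff_form A CARD('k) (pullback_form A F \<omega>)"
    using \<omega> F diff_form_pullback unfolding closed_form_def by blast
  fix \<sigma> :: "(real^'k) \<times> real \<Rightarrow> 'm" and S and bs :: "((real^'k) \<times> real) list"
  assume *: "open S \<and> cbox 0 One \<subseteq> S \<and> C1_into A S \<sigma> \<and> distinct bs \<and> set bs = Basis"
  then have len: "length bs = DIM((real^'k) \<times> real)"
    using distinct_card by metis
  have "C1_into A S (F \<circ> \<sigma>)"
    using C1_map_compose_into[OF F] * by blast
  moreover have "has_ext_deriv A TYPE((real^'k) \<times> real) \<omega> (\<lambda>x v. 0)"
    using \<omega> unfolding closed_form_def by blast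
  ultimately have "integral (cbox 0 One) (\<lambda>u :: (real^'k) \<times> real. 0 :: real) = (\<Sum>i<DIM((real^'k) \<times> real). (-1) ^ i *
      (face_integral A \<omega> (F \<circ> \<sigma>) bs i 1 - face_integral A \<omega> (F \<circ> \<sigma>) bs i 0))"
    using * unfolding has_ext_deriv_def by meson
  moreover have "face_integral A (pullback_form A F \<omega>) \<sigma> bs i d = face_integral A \<omega> (F \<circ> \<sigma>) bs i d"
    if i: "i < DIM((real^'k) \<times> real)" and d: "d \<in> {0,1}" for i d
    unfolding face_integral_def
  proof (rule integral_cong)
    fix u :: "(real^'k) \<times> real" assume u: "u \<in> cbox 0 One"
    have "bs ! i \<in> Basis"
      using * i len by (metis nth_mem)
    then have "cube_face (bs ! i) d u \<in> cbox 0 One"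
      using u d by (auto simp: mem_box cube_face_def inner_add_left inner_Basis)
    then have "mdifferentiable \<sigma> (cube_face (bs ! i) d u)"
      using * C1_into_mdifferentiable by blast
    then show "pullback_form A F \<omega> (\<sigma> (cube_face (bs ! i) d u))
         (\<lambda>l. pdiff A \<sigma> (cube_face (bs ! i) d u) (bs ! (if l < i then l else Suc l))) =
      \<omega> ((F \<circ> \<sigma>) (cube_face (bs ! i) d u))
         (\<lambda>l. pdiff A (F \<circ> \<sigma>) (cube_face (bs ! i) d u) (bs ! (if l < i then l else Suc l)))"
      by (simp add: pullback_form_def mdiff_pdiff_C1(2)[OF F])
  qed
  ultimately show "integral (cbox 0 One) (\<lambda>u :: (real^'k) \<times> real. 0 :: real) = (\<Sum>i<DIM((real^'k) \<times> real). (-1) ^ i *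
      (face_integral A (pullback_form A F \<omega>) \<sigma> bs i 1 - face_integral A (pullback_form A F \<omega>) \<sigma> bs i 0))"
    by simp
qed

lemma pullback_form_inverse:
  assumes "C1_map A F" "C1_map A G" "\<And>x. G (F x) = x"
  shows "pullback_form A F (pullback_form A G \<omega>) = \<omega>"
proof -
  have "G \<circ> F = id"
    using assms(3) by auto
  then have "mdiff A G (F x) (mdiff A F x v) = v" for x v
    using mdiff_compose[OF assms(1,2), of x v] by (simp add: mdiff_id)
  then show ?thesis
    by (simp add: pullback_form_def assms(3))
qed

end

section \<open>The Riemannian metric in charts and bounds for forms\<close>

locale riemannian_atlas = atlas A for A :: "('m::t2_space, 'e::euclidean_space) chart set" +
  fixes g :: "'m \<Rightarrow> 'e \<Rightarrow> 'e \<Rightarrow> real"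
  assumes metric: "riemannian_metric A g"
begin

lemma metric_inner:
  shows "bilinear (g x)" "g x v w = g x w v" "v \<noteq> 0 \<Longrightarrow> 0 < g x v v" "0 \<le> g x v v"
proof -
  show 1: "bilinear (g x)" and "g x v w = g x w v" and 2: "v \<noteq> 0 \<Longrightarrow> 0 < g x v v"
    using metric unfolding riemannian_metric_def by blast+
  show "0 \<le> g x v v"
    using 2 by (cases "v = 0") (auto simp: bilinear_lzero[OF 1])
qed

lemma metric_tensor: "tensor 2 (\<lambda>y v. g y (v 0) (v 1))"
  unfolding tensor_def
proof (intro conjI allI impI ballI)
  fix x and v :: "nat \<Rightarrow> 'e" and i :: nat assume "i < 2"
  then consider "i = 0" | "i = 1" by linarith
  then show "linear (\<lambda>u. g x ((v(i := u)) 0) ((v(i := u)) 1))"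
    using metric_inner(1)[of x] by cases (auto simp: bilinear_def)
next
  fix c v assume c: "c \<in> A"
  obtain U \<phi> where c_eq: "c = (U, \<phi>)"
    by (cases c)
  have "Ck_on 0 (\<phi> ` U)
        (\<lambda>z. g (inv_into U \<phi> z) (coord_vec A (U, \<phi>) (inv_into U \<phi> z) (v 0))
                                (coord_vec A (U, \<phi>) (inv_into U \<phi> z) (v 1)))"
    using metric c unfolding riemannian_metric_def c_eq by blast
  then have "continuous_on (snd c ` fst c) (\<lambda>z. g (cinv c z) (coord_vec A c (cinv c z) (v 0))
                                (coord_vec A c (cinv c z) (v 1)))"
    by (simp add: Ck_on.simps(1) c_eq)
  then have "continuous_on (fst c) (\<lambda>y. g (cinv c (snd c y)) (coord_vec A c (cinv c (snd c y)) (v 0))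
                                (coord_vec A c (cinv c (snd c y)) (v 1)))"
    by (rule continuous_on_compose2[OF _ chart_continuous(1)[OF c]]) auto
  then show "continuous_on (fst c) (\<lambda>y. g y (coord_vec A c y (v 0)) (coord_vec A c y (v 1)))"
    by (rule continuous_on_eq) (simp add: c)
qed auto

lemma tnorm_nonneg [simp]: "0 \<le> tnorm g x v"
  by (simp add: tnorm_def metric_inner(4))

lemma tnorm_scale: "tnorm g x (a *\<^sub>R v) = \<bar>a\<bar> * tnorm g x v"
  by (simp add: tnorm_def bilinear_lmul[OF metric_inner(1)] bilinear_rmul[OF metric_inner(1)]
      real_sqrt_mult flip: mult.assoc)

text \<open>On the compact product of a closed coordinate ball with the Euclidean unit sphere the
  metric attains a positive minimum; \<open>K\<close> is the inverse of its square root.\<close>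

lemma chart_norm_le:
  assumes c: "c \<in> A" "z \<in> fst c"
  obtains K \<rho> where "0 < K" "0 < \<rho>" "cball (snd c z) \<rho> \<subseteq> snd c ` fst c"
    "\<And>y v. y \<in> fst c \<Longrightarrow> snd c y \<in> cball (snd c z) \<rho> \<Longrightarrow> norm v \<le> K * tnorm g y (coord_vec A c y v)"
proof -
  obtain \<rho> where \<rho>: "\<rho> > 0" "cball (snd c z) \<rho> \<subseteq> snd c ` fst c"
    using chart_homeomorphism(2)[OF c(1)] c(2) by (meson imageI open_contains_cball)
  let ?S = "cball (snd c z) \<rho> \<times> sphere (0::'e) 1"
  let ?G = "\<lambda>x. g (cinv c (fst x)) (coord_vec A c (cinv c (fst x)) (snd x)) (coord_vec A c (cinv c (fst x)) (snd x))"
  have cont: "continuous_on ?S (\<lambda>x. cinv c (fst x))"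
    by (rule continuous_on_compose2[OF chart_continuous(2)[OF c(1)]])
      (use \<rho> in \<open>auto intro: continuous_intros\<close>)
  have "continuous_on ?S ?G"
    using tensor_continuous_frame[OF metric_tensor c(1) cont, of "\<lambda>i x. snd x"] \<rho> c(1)
      continuous_on_snd[OF continuous_on_id] by (force simp: subset_eq)
  moreover have "compact ?S" "?S \<noteq> {}"
    using \<rho> by (auto intro: compact_Times)
  ultimately obtain x0 where x0: "x0 \<in> ?S" "\<And>x. x \<in> ?S \<Longrightarrow> ?G x0 \<le> ?G x"
    using continuous_attains_inf[of ?S ?G] by blast
  have "cinv c (fst x0) \<in> fst c"
    using x0(1) \<rho>(2) c(1) by auto
  moreover have "snd x0 \<noteq> 0"
    using x0(1) by auto
  ultimately have "coord_vec A c (cinv c (fst x0)) (snd x0) \<noteq> 0"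
    using linear_injective_0[OF linear_coord_vec[OF c(1)]] coord_vec_inj[OF c(1)] by blast
  then have m: "?G x0 > 0"
    using metric_inner(3) by blast
  have "norm v \<le> 1 / sqrt (?G x0) * tnorm g y (coord_vec A c y v)"
    if y: "y \<in> fst c" "snd c y \<in> cball (snd c z) \<rho>" for y v
  proof (cases "v = 0")
    case False
    have "sqrt (?G x0) \<le> tnorm g y (coord_vec A c y (v /\<^sub>R norm v))"
      using x0(2)[of "(snd c y, v /\<^sub>R norm v)"] y c(1) False by (simp add: tnorm_def)
    also have "\<dots> = tnorm g y (coord_vec A c y v) / norm v"
      by (simp add: linear_cmul[OF linear_coord_vec[OF c(1) y(1)]] tnorm_scale divide_inverse_commute)
    finally show ?thesis
      using m False by (simp add: field_simps)
  qed (use m in simp)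
  with \<rho> m show thesis
    by (intro that[of "1 / sqrt (?G x0)" \<rho>]) auto
qed

lemma continuous_on_tnorm_pdiff:
  fixes p :: "'d::euclidean_space \<Rightarrow> 'm"
  assumes "C1_into A S p" "open S"
  shows "continuous_on S (\<lambda>u. tnorm g (p u) (pdiff A p u w))"
  using tensor_continuous_pdiff[OF metric_tensor assms, of "\<lambda>_. w"]
  unfolding tnorm_def by (intro continuous_intros) auto

text \<open>A bound in the manner of the comass. Arguments are measured with \<open>g\<close>, so
  that it can be played off against Riemannian volume.\<close>

definition form_bound :: "nat \<Rightarrow> ('m, 'e) form \<Rightarrow> real \<Rightarrow> bool" where
  "form_bound j \<omega> M \<longleftrightarrow> (\<forall>y v. (\<forall>i<j. tnorm g y (v i) \<le> 1) \<longrightarrow> \<bar>\<omega> y v\<bar> \<le> M)"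

lemma tensor_bound_unit_frame:
  fixes K m :: real
  assumes \<omega>: "tensor j \<omega>" and c: "c \<in> A" "y \<in> fst c"
    and K: "\<And>v. norm v \<le> K * tnorm g y (coord_vec A c y v)" "0 \<le> K"
    and m: "\<And>b. b \<in> {..<j} \<rightarrow>\<^sub>E Basis \<Longrightarrow> \<bar>\<omega> y (\<lambda>i. coord_vec A c y (b i))\<bar> \<le> m"
    and v: "\<And>i. i < j \<Longrightarrow> tnorm g y (v i) \<le> 1"
  shows "\<bar>\<omega> y v\<bar> \<le> (real DIM('e) * K) ^ j * m"
proof -
  have "\<exists>w. v i = coord_vec A c y w" for i
    by (rule coord_vec_surj[OF c, of "v i"]) blast
  then obtain a where a: "\<And>i. v i = coord_vec A c y (a i)"
    by (meson choice)
  have "norm (a i) \<le> K" if "i < j" for i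
    using K(1)[of "a i"] v[OF that] a[of i] mult_left_mono[of "tnorm g y (v i)" 1 K] K(2) by simp
  moreover have "v = (\<lambda>i. coord_vec A c y (a i))"
    using a by auto
  ultimately show ?thesis
    using tensor_bound_frame[OF \<omega> c K(2) m] by simp
qed

text \<open>Near \<open>z\<close> the coefficients are at most \<open>?f z + 1\<close> by
  continuity, and \<open>tensor_bound_unit_frame\<close> turns this into a local bound. By
  compactness finitely many local bounds suffice, and their sum dominates each of them.\<close>

lemma ex_form_bound:
  assumes "compact (UNIV :: 'm set)" "tensor j \<omega>"
  obtains M where "0 \<le> M" "form_bound j \<omega> M"
proof -
  have "\<forall>z. \<exists>Q. open (fst Q) \<and> z \<in> fst Q \<and>
      (\<forall>y\<in>fst Q. \<forall>v. (\<forall>i<j. tnorm g y (v i) \<le> 1) \<longrightarrow> \<bar>\<omega> y v\<bar> \<le> snd Q)"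
  proof
    fix z
    let ?c = "chart_at A z" and ?I = "{..<j} \<rightarrow>\<^sub>E (Basis::'e set)"
    let ?f = "\<lambda>y. \<Sum>b\<in>?I. \<bar>\<omega> y (\<lambda>i. coord_vec A ?c y (b i))\<bar>"
    obtain K \<rho> where K: "0 < K" "0 < \<rho>" "cball (snd ?c z) \<rho> \<subseteq> snd ?c ` fst ?c"
      "\<And>y v. y \<in> fst ?c \<Longrightarrow> snd ?c y \<in> cball (snd ?c z) \<rho> \<Longrightarrow> norm v \<le> K * tnorm g y (coord_vec A ?c y v)"
      using chart_norm_le[of ?c z] by auto
    have cont: "continuous_on (fst ?c) ?f"
      using assms(2) unfolding tensor_def by (intro continuous_intros) auto
    have op: "open (fst ?c)"
      using chart_homeomorphism(1) by auto
    let ?U = "(fst ?c \<inter> snd ?c -` ball (snd ?c z) \<rho>) \<inter> (fst ?c \<inter> ?f -` {..<?f z + 1})"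
    have "open ?U"
      by (intro open_Int open_Int_vimage cont op chart_continuous) auto
    moreover have "z \<in> ?U"
      using K by auto
    moreover have "\<bar>\<omega> y v\<bar> \<le> (real DIM('e) * K) ^ j * (?f z + 1)"
      if "y \<in> ?U" "\<And>i. i < j \<Longrightarrow> tnorm g y (v i) \<le> 1" for y v
    proof (rule tensor_bound_unit_frame[OF assms(2) chart_at_in(1)[of z]])
      fix b assume b: "b \<in> ?I"
      have "finite ?I"
        by (intro finite_PiE) auto
      then have "\<bar>\<omega> y (\<lambda>i. coord_vec A ?c y (b i))\<bar> \<le> ?f y"
        using b by (intro member_le_sum) auto
      then show "\<bar>\<omega> y (\<lambda>i. coord_vec A ?c y (b i))\<bar> \<le> ?f z + 1"
        using that by auto
    qed (use that K in auto)
    ultimately show "\<exists>Q. open (fst Q) \<and> z \<in> fst Q \<and>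
      (\<forall>y\<in>fst Q. \<forall>v. (\<forall>i<j. tnorm g y (v i) \<le> 1) \<longrightarrow> \<bar>\<omega> y v\<bar> \<le> snd Q)"
      by (intro exI[of _ "(?U, (real DIM('e) * K) ^ j * (?f z + 1))"]) simp
  qed
  from choice[OF this] obtain Q where Q: "\<forall>z. open (fst (Q z)) \<and> z \<in> fst (Q z) \<and>
      (\<forall>y\<in>fst (Q z). \<forall>v. (\<forall>i<j. tnorm g y (v i) \<le> 1) \<longrightarrow> \<bar>\<omega> y v\<bar> \<le> snd (Q z))" ..
  define U M where "U = fst \<circ> Q" and "M = snd \<circ> Q"
  then have U: "\<And>z. open (U z)" "\<And>z. z \<in> U z"
    and M: "\<And>z y v. y \<in> U z \<Longrightarrow> (\<forall>i<j. tnorm g y (v i) \<le> 1) \<Longrightarrow> \<bar>\<omega> y v\<bar> \<le> M z"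
    using Q by simp_all
  obtain Z where Z: "finite Z" "UNIV \<subseteq> (\<Union>z\<in>Z. U z)"
    by (rule compact_nbhd_cover[OF assms(1), of U]) (use U in auto)
  have "\<bar>\<omega> y v\<bar> \<le> (\<Sum>z\<in>Z. \<bar>M z\<bar>)" if v: "\<forall>i<j. tnorm g y (v i) \<le> 1" for y v
  proof -
    obtain z where "z \<in> Z" "y \<in> U z"
      using Z(2) by blast
    then show ?thesis
      using M[OF _ v, of z] member_le_sum[of z Z "\<lambda>z. \<bar>M z\<bar>"] Z(1) by force
  qed
  then show thesis
    using that[of "\<Sum>z\<in>Z. \<bar>M z\<bar>"] by (auto simp: form_bound_def sum_nonneg)
qed

end

section \<open>The leaf topology\<close>

text \<open>Composing \<open>Q\<close> with a left inverse of \<open>Q'\<close> gives a map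
  \<open>k\<close> whose derivative at \<open>h u\<close> is the identity. Near \<open>u\<close> the
  increments of \<open>h\<close> are then close to those of \<open>k \<circ> h\<close>, which is
  differentiable. Only differentiability of \<open>Q\<close> at one point and continuity of
  \<open>h\<close> enter, so no inverse function theorem is involved.\<close>

lemma has_derivative_left_factor:
  fixes h :: "'a::euclidean_space \<Rightarrow> 'b::euclidean_space" and Q :: "'b \<Rightarrow> 'c::euclidean_space"
  assumes h: "isCont h u" and Q: "(Q has_derivative Q') (at (h u))" "inj Q'"
    and D: "(Q \<circ> h has_derivative D) (at u)"
  obtains H where "(h has_derivative H) (at u)" "\<And>w. Q' (H w) = D w"
proof -
  obtain L where L: "linear L" "L \<circ> Q' = id"
    using linear_injective_left_inverse[OF has_derivative_linear[OF Q(1)] Q(2)] by blast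
  have bL: "bounded_linear L"
    using L(1) by (rule linear_conv_bounded_linear[THEN iffD1])
  define k where "k = L \<circ> Q"
  define H where "H = L \<circ> D"
  have k: "(k has_derivative (\<lambda>x. x)) (at (h u))"
    using diff_chain_at[OF Q(1) bounded_linear_imp_has_derivative[OF bL]] L(2)
    by (simp add: k_def id_def)
  have kh: "(k \<circ> h has_derivative H) (at u)"
    using diff_chain_at[OF D bounded_linear_imp_has_derivative[OF bL]]
    by (simp add: k_def H_def o_assoc)
  have bH: "bounded_linear H"
    using kh has_derivative_bounded_linear by blast
  from bounded_linear.pos_bounded[OF this] obtain B where "B > 0" "\<forall>x. norm (H x) \<le> norm x * B"
    by blast
  then have B: "B > 0" "\<And>x. norm (H x) \<le> B * norm x"
    by (simp_all add: mult.commute)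
  have near: "\<exists>d>0. \<forall>y. norm (y - u) < d \<longrightarrow> norm (k (h y) - k (h u) - (h y - h u)) \<le> e * norm (h y - h u)"
    if e: "e > 0" for e
  proof -
    obtain d1 where d1: "d1 > 0" "\<And>z. norm (z - h u) < d1 \<Longrightarrow> norm (k z - k (h u) - (z - h u)) \<le> e * norm (z - h u)"
      using k e unfolding has_derivative_at_alt by blast
    obtain d where "d > 0" "\<And>y. dist y u < d \<Longrightarrow> dist (h y) (h u) < d1"
      using h d1(1) unfolding continuous_at_eps_delta by blast
    then show ?thesis
      using d1(2) by (auto simp: dist_norm)
  qed
  have nearH: "\<exists>d>0. \<forall>y. norm (y - u) < d \<longrightarrow> norm (k (h y) - k (h u) - H (y - u)) \<le> e * norm (y - u)"
    if "e > 0" for e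
    using kh that unfolding has_derivative_at_alt by (simp add: o_def)
  have hH: "(h has_derivative H) (at u)"
    unfolding has_derivative_at_alt
  proof (intro conjI bH allI impI)
    fix e :: real assume e: "0 < e"
    \<comment> \<open>A Lipschitz constant for \<open>h\<close> at \<open>u\<close>: the increment
      of \<open>k \<circ> h\<close> is at most \<open>B + 1\<close> times that of the argument, and
      since \<open>e' \<le> 1/2\<close> it is at least half the increment of \<open>h\<close>. The
      choice of \<open>e'\<close> then makes the remaining error at most
      \<open>e / 2\<close>.\<close>
    define C where "C = 2 * (B + 1)"
    have C: "C > 0" using B by (simp add: C_def)
    define e' where "e' = min (1/2) (e / (2 * C))"
    have e': "e' > 0" "e' \<le> 1/2" "e' * C \<le> e / 2"
      using e C by (auto simp: e'_def field_simps min_def)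
    obtain d1 where d1: "d1 > 0"
      "\<And>y. norm (y - u) < d1 \<Longrightarrow> norm (k (h y) - k (h u) - (h y - h u)) \<le> e' * norm (h y - h u)"
      using near[OF e'(1)] by blast
    obtain d2 where d2: "d2 > 0"
      "\<And>y. norm (y - u) < d2 \<Longrightarrow> norm (k (h y) - k (h u) - H (y - u)) \<le> min (e / 2) 1 * norm (y - u)"
      using nearH[of "min (e / 2) 1"] e by auto
    have "norm (h y - h u - H (y - u)) \<le> e * norm (y - u)" if y: "norm (y - u) < min d1 d2" for y
    proof -
      let ?a = "k (h y) - k (h u)"
      have 1: "norm (?a - (h y - h u)) \<le> e' * norm (h y - h u)"
        using d1(2) y by simp
      have 2: "norm (?a - H (y - u)) \<le> min (e / 2) 1 * norm (y - u)"
        using d2(2) y by simp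
      have "min (e / 2) 1 * norm (y - u) \<le> 1 * norm (y - u)"
        by (intro mult_right_mono) auto
      then have "norm ?a \<le> (B + 1) * norm (y - u)"
        using 2 B(2)[of "y - u"] norm_triangle_sub[of ?a "H (y - u)"]
        by (simp add: distrib_right)
      moreover have "e' * norm (h y - h u) \<le> 1/2 * norm (h y - h u)"
        using e' by (intro mult_right_mono) auto
      then have "norm (h y - h u) \<le> 2 * norm ?a"
        using 1 norm_triangle_sub[of "h y - h u" ?a] norm_minus_commute[of "h y - h u" ?a] by simp
      ultimately have 3: "norm (h y - h u) \<le> C * norm (y - u)"
        unfolding C_def by linarith
      have "e' * norm (h y - h u) \<le> e' * (C * norm (y - u))"
        using 3 e'(1) by (intro mult_left_mono) auto
      also have "\<dots> \<le> e / 2 * norm (y - u)"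
        using mult_right_mono[OF e'(3) norm_ge_zero[of "y - u"]] by (simp add: mult_ac)
      finally have 4: "norm (?a - (h y - h u)) \<le> e / 2 * norm (y - u)"
        using 1 by linarith
      have 5: "norm (?a - H (y - u)) \<le> e / 2 * norm (y - u)"
        by (rule order_trans[OF 2]) (intro mult_right_mono, auto)
      have "h y - h u - H (y - u) = (?a - H (y - u)) - (?a - (h y - h u))"
        by simp
      then have "norm (h y - h u - H (y - u)) \<le> norm (?a - H (y - u)) + norm (?a - (h y - h u))"
        by (simp only: norm_triangle_ineq4)
      then show ?thesis
        using 4 5 by simp
    qed
    then show "\<exists>d>0. \<forall>y. norm (y - u) < d \<longrightarrow> norm (h y - h u - H (y - u)) \<le> e * norm (y - u)"
      using d1(1) d2(1) by (intro exI[of _ "min d1 d2"]) auto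
  qed
  moreover have "Q' (H w) = D w" for w
    using has_derivative_unique[OF diff_chain_at[OF hH Q(1)] D] by (metis comp_apply)
  ultimately show thesis using that by blast
qed

locale foliated_manifold = riemannian_atlas A g
  for A :: "('m::t2_space, 'e::euclidean_space) chart set" and g +
  fixes W :: "'m \<Rightarrow> 'm set" and P :: "('m, 'k::{finite,wellorder}) leaf_atlas"
  assumes foliation: "foliation TYPE('k) TYPE('e) W"
    and leaf_atlas: "oriented_C1_leaf_atlas A W P"
begin

lemma leaf_refl: "x \<in> W x"
  and leaf_path_connected: "path_connected (W x)"
  and leaf_eq: "y \<in> W x \<Longrightarrow> W y = W x"
  using foliation unfolding foliation_def by blast+

lemma param:
  assumes "(V, p) \<in> P"
  shows "open V" "C1_into A V p" "inj_on p V" "u \<in> V \<Longrightarrow> inj (pdiff A p u)"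
    "u \<in> V \<Longrightarrow> p ` V \<subseteq> W (p u)" "open V' \<Longrightarrow> V' \<subseteq> V \<Longrightarrow> leaf_open W (p ` V')"
  using assms leaf_atlas unfolding oriented_C1_leaf_atlas_def by blast+

lemma param_cover:
  obtains V p u where "(V, p) \<in> P" "u \<in> V" "p u = y"
proof -
  have "(\<Union>(V, p)\<in>P. p ` V) = UNIV"
    using leaf_atlas unfolding oriented_C1_leaf_atlas_def by (rule conjunct1)
  then have "y \<in> (\<Union>(V, p)\<in>P. p ` V)"
    by simp
  then show thesis using that by auto
qed

lemma param_transition_det:
  assumes "(V, p) \<in> P" "(V', q) \<in> P" "u \<in> V" "p u \<in> q ` V'"
  shows "0 < det (matrix (frechet_derivative (inv_into V' q \<circ> p) (at u)))"
proof -
  note * = leaf_atlas[unfolded oriented_C1_leaf_atlas_def, THEN conjunct2, THEN conjunct2]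
  from bspec[OF bspec[OF * assms(1), unfolded case_prod_conv] assms(2), unfolded case_prod_conv]
    assms(3,4) show ?thesis by blast
qed

text \<open>Maps staying in one leaf and continuous for the topology of the manifold. On convex or
  open domains they are automatically continuous for the finer leaf topology, as shown next.\<close>

definition leafwise :: "'d::real_normed_vector set \<Rightarrow> ('d \<Rightarrow> 'm) \<Rightarrow> bool" where
  "leafwise N c \<longleftrightarrow> continuous_on N c \<and> (\<forall>u\<in>N. c ` N \<subseteq> W (c u))"

lemma leafwise_subset: "leafwise N c \<Longrightarrow> T \<subseteq> N \<Longrightarrow> leafwise T c"
  unfolding leafwise_def by (meson continuous_on_subset image_mono subset_eq)

lemma param_leafwise: "(V, p) \<in> P \<Longrightarrow> leafwise V p"
  using param[of V p] unfolding leafwise_def C1_into_iff by blast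

lemma leafwise_path_component:
  assumes "leafwise N c" "path_connected N" "u \<in> N" "v \<in> N" "c ` N \<subseteq> U"
  shows "c v \<in> path_component_set (U \<inter> W (c u)) (c u)"
proof -
  have "path_connected (c ` N)"
    using assms path_connected_continuous_image unfolding leafwise_def by blast
  then have "c ` N \<subseteq> path_component_set (U \<inter> W (c u)) (c u)"
    using assms unfolding leafwise_def by (intro path_component_maximal) auto
  then show ?thesis using assms by blast
qed

text \<open>A small convex neighbourhood of \<open>u\<close> has a path connected image inside
  \<open>U\<close>, which therefore stays in the path component of \<open>c u\<close>. It cannot
  jump to another plaque, even if the leaf returns to \<open>U\<close>.\<close>

lemma leafwise_into_leaf_open:
  assumes c: "leafwise N c" "convex N" "u \<in> N" and S: "leaf_open W S" "c u \<in> S"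
  obtains e where "e > 0" "c ` (ball u e \<inter> N) \<subseteq> S"
proof -
  obtain U where U: "open U" "c u \<in> U" "path_component_set (U \<inter> W (c u)) (c u) \<subseteq> S"
    using S unfolding leaf_open_def by blast
  have "\<exists>T. open T \<and> u \<in> T \<and> (\<forall>y\<in>N \<inter> T. c y \<in> U)"
    using c(1,3) U(1,2) unfolding leafwise_def continuous_on_topological by (metis IntE)
  then obtain T where T: "open T" "u \<in> T" "\<And>y. y \<in> N \<Longrightarrow> y \<in> T \<Longrightarrow> c y \<in> U"
    by blast
  then obtain e where e: "e > 0" "ball u e \<subseteq> T"
    by (meson open_contains_ball)
  have "c v \<in> S" if v: "v \<in> ball u e \<inter> N" for v
  proof -
    have "path_connected (ball u e \<inter> N)"
      using c(2) by (intro convex_imp_path_connected convex_Int) auto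
    from leafwise_path_component[OF leafwise_subset[OF c(1)] this _ v, of u U]
    show ?thesis
      using U(3) T(3) e c(3) by auto
  qed
  with e(1) that show thesis by blast
qed

lemma leaf_open_vimage:
  assumes "leafwise N c" "open N" "leaf_open W S"
  shows "open (N \<inter> c -` S)"
  unfolding open_contains_ball
proof
  fix u assume u: "u \<in> N \<inter> c -` S"
  then obtain r where r: "r > 0" "ball u r \<subseteq> N"
    using assms(2) by (meson IntE open_contains_ball)
  obtain e where "e > 0" "c ` (ball u e \<inter> ball u r) \<subseteq> S"
    by (rule leafwise_into_leaf_open[OF leafwise_subset[OF assms(1) r(2)] convex_ball _ assms(3), of u])
      (use u r in auto)
  with r have "ball u (min e r) \<subseteq> N \<inter> c -` S"
    by (auto simp: subset_iff image_subset_iff)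
  with \<open>e > 0\<close> \<open>r > 0\<close> show "\<exists>e>0. ball u e \<subseteq> N \<inter> c -` S"
    by (intro exI[of _ "min e r"]) auto
qed

lemma open_vimage_param:
  "leafwise N c \<Longrightarrow> open N \<Longrightarrow> (V, q) \<in> P \<Longrightarrow> open (N \<inter> c -` (q ` V))"
  using leaf_open_vimage param(1,6) by blast

lemma leaf_coordinates_continuous:
  assumes c: "leafwise N c" "open N" and q: "(V, q) \<in> P"
  shows "continuous_on (N \<inter> c -` (q ` V)) (inv_into V q \<circ> c)"
proof (subst continuous_on_open_vimage[OF open_vimage_param[OF c q]], intro allI impI)
  fix B :: "(real^'k::{finite,wellorder}) set" assume B: "open B"
  have "(inv_into V q \<circ> c) -` B \<inter> (N \<inter> c -` (q ` V)) = N \<inter> c -` (q ` (V \<inter> B))"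
    using param(3)[OF q] by (auto simp: inv_into_f_f f_inv_into_f)
  then show "open ((inv_into V q \<circ> c) -` B \<inter> (N \<inter> c -` (q ` V)))"
    using leaf_open_vimage[OF c param(6)[OF q, of "V \<inter> B"]] B param(1)[OF q] by auto
qed

text \<open>The parametrization \<open>q\<close> is an immersion and
  \<open>q \<circ> (inv_into V q \<circ> c)\<close> agrees with \<open>c\<close> near
  \<open>u\<close>, so \<open>has_derivative_left_factor\<close> applies to the continuous leaf
  coordinates of \<open>c\<close>.\<close>

lemma leaf_coordinates_derivative:
  fixes c :: "'d::euclidean_space \<Rightarrow> 'm"
  assumes c: "leafwise N c" "open N" and q: "(V, q) \<in> P"
    and u: "u \<in> N" "c u \<in> q ` V" and md: "mdifferentiable c u"
  shows "(inv_into V q \<circ> c has_derivative frechet_derivative (inv_into V q \<circ> c) (at u)) (at u)"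
    and "pdiff A c u w =
      pdiff A q (inv_into V q (c u)) (frechet_derivative (inv_into V q \<circ> c) (at u) w)"
proof -
  let ?h = "inv_into V q \<circ> c" and ?c = "chart_at A (c u)"
  have hu: "q (?h u) = c u" "?h u \<in> V"
    using u(2) by (auto simp: f_inv_into_f inv_into_into)
  have o: "open (N \<inter> c -` (q ` V))"
    using open_vimage_param[OF c q] .
  have cont: "isCont ?h u"
    using iffD1[OF continuous_on_eq_continuous_at[OF o] leaf_coordinates_continuous[OF c q]] u
    by blast
  have Q: "(snd ?c \<circ> q has_derivative pdiff A q (?h u)) (at (?h u))"
    using mdifferentiable_chart[OF C1_into_mdifferentiable[OF param(2,1)[OF q] hu(2)], of ?c] hu
    by (simp add: pdiff_def[abs_def])
  have ev: "\<forall>\<^sub>F x in nhds u. (snd ?c \<circ> c) x = (snd ?c \<circ> q \<circ> ?h) x"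
    using eventually_nhds_in_open[OF o, of u] u
    by (auto elim!: eventually_mono simp: f_inv_into_f)
  have "(snd ?c \<circ> c has_derivative pdiff A c u) (at u)"
    using mdifferentiable_chart[OF md, of ?c] by (simp add: pdiff_def[abs_def])
  from has_derivative_cong_nhds[OF this ev]
  obtain H where H: "(?h has_derivative H) (at u)" "\<And>w. pdiff A q (?h u) (H w) = pdiff A c u w"
    using has_derivative_left_factor[OF cont Q param(4)[OF q hu(2)]] by blast
  have "H = frechet_derivative ?h (at u)"
    using frechet_derivative_at[OF H(1)] .
  with H show "(?h has_derivative frechet_derivative ?h (at u)) (at u)"
    "pdiff A c u w = pdiff A q (inv_into V q (c u)) (frechet_derivative ?h (at u) w)"
    by simp_all
qed

text \<open>Coverings by finitely many compact pieces stand in for relative compactness in the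
  leaf topology.\<close>

definition compactly_covered :: "'m set \<Rightarrow> bool" where
  "compactly_covered S \<longleftrightarrow> (\<exists>\<C>. finite \<C> \<and>
     (\<forall>(V, p, C)\<in>\<C>. (V, p) \<in> P \<and> compact C \<and> C \<subseteq> V) \<and> S \<subseteq> (\<Union>(V, p, C)\<in>\<C>. p ` C))"

lemma compactly_covered_subset: "compactly_covered S \<Longrightarrow> T \<subseteq> S \<Longrightarrow> compactly_covered T"
  unfolding compactly_covered_def by (meson order_trans)

lemma compactly_covered_piece:
  "(V, p) \<in> P \<Longrightarrow> compact C \<Longrightarrow> C \<subseteq> V \<Longrightarrow> compactly_covered (p ` C)"
  unfolding compactly_covered_def by (intro exI[of _ "{(V, p, C)}"]) auto

lemma compactly_covered_empty: "compactly_covered {}"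
  unfolding compactly_covered_def by (intro exI[of _ "{}"]) auto

lemma compactly_covered_Un:
  assumes "compactly_covered S" "compactly_covered T"
  shows "compactly_covered (S \<union> T)"
proof -
  obtain \<C> \<D> where "finite \<C>" "\<forall>(V, p, C)\<in>\<C>. (V, p) \<in> P \<and> compact C \<and> C \<subseteq> V"
      "S \<subseteq> (\<Union>(V, p, C)\<in>\<C>. p ` C)"
    "finite \<D>" "\<forall>(V, p, C)\<in>\<D>. (V, p) \<in> P \<and> compact C \<and> C \<subseteq> V" "T \<subseteq> (\<Union>(V, p, C)\<in>\<D>. p ` C)"
    using assms unfolding compactly_covered_def by blast
  then show ?thesis
    unfolding compactly_covered_def by (intro exI[of _ "\<C> \<union> \<D>"]) auto
qed

lemma compactly_covered_UN:
  "finite I \<Longrightarrow> (\<And>i. i \<in> I \<Longrightarrow> compactly_covered (S i)) \<Longrightarrow> compactly_covered (\<Union>i\<in>I. S i)"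
  by (induction rule: finite_induct) (auto intro: compactly_covered_empty compactly_covered_Un)

lemma compactly_covered_singleton: "compactly_covered {x}"
proof -
  obtain V p u where "(V, p) \<in> P" "u \<in> V" "p u = x"
    by (rule param_cover)
  then show ?thesis
    using compactly_covered_piece[of V p "{u}"] by simp
qed

text \<open>The Heine-Borel argument in the parameter domains, packaged once: later coverings need
  only a local case, stability under unions and passage to subsets.\<close>

lemma compactly_covered_induct [consumes 1, case_names empty Un subset local]:
  assumes S: "compactly_covered S" and empty: "R {}"
    and Un: "\<And>S T. R S \<Longrightarrow> R T \<Longrightarrow> R (S \<union> T)" and sub: "\<And>S T. R S \<Longrightarrow> T \<subseteq> S \<Longrightarrow> R T"
    and local: "\<And>V p u. (V, p) \<in> P \<Longrightarrow> u \<in> V \<Longrightarrow> \<exists>r>0. R (p ` (ball u r \<inter> V))"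
  shows "R S"
proof -
  from S[unfolded compactly_covered_def] obtain \<C> where fin: "finite \<C>"
    and pieces: "\<forall>(V, p, C)\<in>\<C>. (V, p) \<in> P \<and> compact C \<and> C \<subseteq> V"
    and cov: "S \<subseteq> (\<Union>(V, p, C)\<in>\<C>. p ` C)"
    by (elim exE conjE)
  have UN: "R (\<Union>i\<in>I. T i)" if "finite I" "\<And>i. i \<in> I \<Longrightarrow> R (T i)" for I :: "'i set" and T
    using that by (induction rule: finite_induct) (auto intro: empty Un)
  have "R (p ` C)" if C: "(V, p, C) \<in> \<C>" for V p C
  proof -
    have piece: "(V, p) \<in> P" "compact C" "C \<subseteq> V"
      using bspec[OF pieces C] by simp_all
    have "\<forall>u\<in>C. \<exists>r>0. R (p ` (ball u r \<inter> V))"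
      using piece local by blast
    from bchoice[OF this] obtain r where r: "\<forall>u\<in>C. r u > 0 \<and> R (p ` (ball u (r u) \<inter> V))" ..
    obtain Z where Z: "Z \<subseteq> C" "finite Z" "C \<subseteq> (\<Union>u\<in>Z. ball u (r u))"
      by (rule compact_nbhd_cover[of C "\<lambda>u. ball u (r u)"]) (use r piece in auto)
    have "R (\<Union>u\<in>Z. p ` (ball u (r u) \<inter> V))"
      by (rule UN[OF Z(2)]) (use Z(1) r in blast)
    moreover have "p ` C \<subseteq> (\<Union>u\<in>Z. p ` (ball u (r u) \<inter> V))"
      using Z(3) piece(3) by blast
    ultimately show ?thesis
      using sub by blast
  qed
  then have "R (\<Union>(V, p, C)\<in>\<C>. p ` C)"
    by (intro UN[OF fin]) auto
  then show ?thesis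
    by (rule sub[OF _ cov])
qed

section \<open>Diffeomorphisms preserving the foliation\<close>

definition leaf_map :: "('m \<Rightarrow> 'm) \<Rightarrow> bool" where
  "leaf_map F \<longleftrightarrow> C1_diffeomorphism A F \<and> invariant_foliation F W"

lemma leaf_mapD:
  assumes "leaf_map F"
  shows "C1_map A F" "C1_map A (inv F)" "bij F" "F ` W x = W (F x)"
    "continuous_on S F" "continuous_on S (inv F)"
  using assms unfolding leaf_map_def C1_diffeomorphism_def invariant_foliation_def C1_map_iff
  by (auto intro: continuous_on_subset)

lemma leaf_map_leafwise:
  assumes "leaf_map F" "leafwise N c"
  shows "leafwise N (F \<circ> c)"
  unfolding leafwise_def
proof (intro conjI ballI)
  show "continuous_on N (F \<circ> c)"
    using assms(2) leaf_mapD(5)[OF assms(1)] continuous_on_compose unfolding leafwise_def by blast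
  fix u assume "u \<in> N"
  then have "F ` c ` N \<subseteq> F ` W (c u)"
    using assms(2) unfolding leafwise_def by (intro image_mono) blast
  then show "(F \<circ> c) ` N \<subseteq> W ((F \<circ> c) u)"
    by (simp only: leaf_mapD(4)[OF assms(1)] image_comp comp_apply)
qed

text \<open>The image of \<open>U\<close> is open because \<open>inv F\<close> is continuous. A path
  component of a leaf in it is carried back by \<open>inv F\<close> to a path connected part of
  \<open>U \<inter> W z\<close>, as leaves correspond to leaves.\<close>

lemma leaf_map_leaf_open:
  assumes F: "leaf_map F" and S: "leaf_open W S"
  shows "leaf_open W (F ` S)"
  unfolding leaf_open_def
proof
  fix y assume "y \<in> F ` S"
  then obtain z where z: "y = F z" "z \<in> S" by blast
  obtain U where U: "open U" "z \<in> U" "path_component_set (U \<inter> W z) z \<subseteq> S"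
    using S z(2) unfolding leaf_open_def by blast
  have bij: "inv F (F x) = x" "F (inv F x) = x" for x
    using leaf_mapD(3)[OF F] by (auto simp: bij_is_inj bij_is_surj surj_f_inv_f)
  have "F ` U = UNIV \<inter> inv F -` U"
  proof (intro equalityI subsetI)
    fix x assume "x \<in> UNIV \<inter> inv F -` U"
    then have "F (inv F x) \<in> F ` U" by blast
    then show "x \<in> F ` U" by (simp only: bij)
  qed (auto simp: bij)
  then have "open (F ` U)"
    using open_Int_vimage[OF leaf_mapD(6)[OF F] open_UNIV U(1)] by simp
  moreover have "path_component_set (F ` U \<inter> W y) y \<subseteq> F ` S"
  proof
    fix t assume t: "t \<in> path_component_set (F ` U \<inter> W y) y"
    let ?T = "path_component_set (F ` U \<inter> W y) y"
    have yU: "y \<in> F ` U \<inter> W y"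
      using z U leaf_refl by blast
    have "path_connected (inv F ` ?T)"
      by (intro path_connected_continuous_image leaf_mapD(6)[OF F]) simp
    moreover have "z \<in> inv F ` ?T"
    proof -
      have "y \<in> ?T"
        using yU by (simp add: path_component_refl)
      then have "inv F y \<in> inv F ` ?T" by (rule imageI)
      then show ?thesis by (simp only: z(1) bij)
    qed
    moreover have "?T \<subseteq> F ` (U \<inter> W z)"
    proof -
      have "F ` U \<inter> W y = F ` (U \<inter> W z)"
        using leaf_mapD(4)[OF F, of z] z(1) leaf_mapD(3)[OF F] by (simp add: image_Int bij_is_inj)
      then show ?thesis
        using path_component_subset[of "F ` U \<inter> W y" y] by simp
    qed
    then have "inv F ` ?T \<subseteq> U \<inter> W z"
      using bij by fastforce
    ultimately have "inv F ` ?T \<subseteq> path_component_set (U \<inter> W z) z"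
      by (intro path_component_maximal) auto
    then have "inv F t \<in> S"
      using t U(3) by blast
    then show "t \<in> F ` S"
      using bij(2)[of t] by (metis imageI)
  qed
  ultimately show "\<exists>U. open U \<and> y \<in> U \<and> path_component_set (U \<inter> W y) y \<subseteq> F ` S"
    using z U(2) by (intro exI[of _ "F ` U"]) auto
qed

text \<open>The composition \<open>F \<circ> p\<close> need not belong to \<open>P\<close>. The
  image of a small closed ball is therefore rewritten in the leaf coordinates of a parametrization
  around \<open>F (p u)\<close>, where it stays compact by continuity.\<close>

lemma leaf_map_compactly_covered:
  assumes F: "leaf_map F" and S: "compactly_covered S"
  shows "compactly_covered (F ` S)"
  using S
proof (induction rule: compactly_covered_induct)
  case (local V p u)
  obtain V' q v where q: "(V', q) \<in> P" "v \<in> V'" "q v = F (p u)"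
    by (rule param_cover)
  note c = leaf_map_leafwise[OF F param_leafwise[OF local(1)]]
  let ?D = "V \<inter> (F \<circ> p) -` (q ` V')"
  have "open ?D"
    by (rule open_vimage_param[OF c param(1)[OF local(1)] q(1)])
  moreover have "u \<in> ?D"
    using local(2) q by (auto intro: rev_image_eqI)
  ultimately obtain r where r: "r > 0" "cball u r \<subseteq> ?D"
    by (meson open_contains_cball)
  let ?C = "(inv_into V' q \<circ> (F \<circ> p)) ` cball u r"
  have "compact ?C"
    by (intro compact_continuous_image continuous_on_subset[OF leaf_coordinates_continuous[OF c param(1)[OF local(1)] q(1)]])
      (use r in auto)
  moreover have "?C \<subseteq> V'"
    using r(2) by (auto simp: subset_iff inv_into_into)
  ultimately have "compactly_covered (q ` ?C)"
    by (rule compactly_covered_piece[OF q(1)])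
  moreover have "F ` p ` (ball u r \<inter> V) \<subseteq> q ` ?C"
  proof clarify
    fix w assume w: "w \<in> ball u r"
    then have "w \<in> cball u r" by simp
    then have "F (p w) = q ((inv_into V' q \<circ> (F \<circ> p)) w)"
      using r(2) by (auto simp: subset_iff f_inv_into_f)
    then show "F (p w) \<in> q ` ?C"
      using \<open>w \<in> cball u r\<close> by blast
  qed
  ultimately show ?case
    using r(1) compactly_covered_subset by blast
qed (auto simp: image_Un intro: compactly_covered_empty compactly_covered_Un compactly_covered_subset)

end

section \<open>Curves in leaves and leaf disks\<close>

context riemannian_atlas begin

text \<open>A first exit argument. Up to the exit time the curve is in the chart, where its
  coordinate length is at most \<open>K\<close> times its Riemannian length and so less than
  \<open>\<rho> / 2\<close>; starting within \<open>\<rho> / 2\<close> of the centre, it cannot have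
  reached the boundary.\<close>

lemma curve_stays_in_ball:
  fixes \<gamma> :: "real \<Rightarrow> 'm"
  assumes c: "c \<in> A" and \<rho>: "cball z \<rho> \<subseteq> snd c ` fst c" and K: "0 < K"
    "\<And>y v. y \<in> fst c \<Longrightarrow> snd c y \<in> cball z \<rho> \<Longrightarrow> norm v \<le> K * tnorm g y (coord_vec A c y v)"
    and \<gamma>: "C1_into A S \<gamma>" "open S" "{a..b} \<subseteq> S"
    and start: "\<gamma> a \<in> fst c" "dist z (snd c (\<gamma> a)) < \<rho> / 2"
    and len: "K * integral {a..b} (\<lambda>t. tnorm g (\<gamma> t) (pdiff A \<gamma> t 1)) < \<rho> / 2"
    and t: "t \<in> {a..b}"
  shows "\<gamma> t \<in> cinv c ` ball z \<rho>"
proof (rule ccontr)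
  assume neg: "\<gamma> t \<notin> cinv c ` ball z \<rho>"
  let ?s = "\<lambda>t. tnorm g (\<gamma> t) (pdiff A \<gamma> t 1)"
  let ?O = "cinv c ` ball z \<rho>" and ?K = "cinv c ` cball z \<rho>"
  have O_eq: "?O = fst c \<inter> snd c -` ball z \<rho>"
  proof (intro equalityI subsetI)
    fix x assume "x \<in> fst c \<inter> snd c -` ball z \<rho>"
    then show "x \<in> ?O"
      using c by (intro image_eqI[of _ _ "snd c x"]) auto
  next
    fix x assume "x \<in> ?O"
    then obtain w where w: "w \<in> ball z \<rho>" "x = cinv c w" by blast
    then have "w \<in> snd c ` fst c"
      using \<rho> by auto
    then show "x \<in> fst c \<inter> snd c -` ball z \<rho>"
      using w c by simp
  qed
  have opO: "open ?O"
    unfolding O_eq by (intro open_Int_vimage chart_continuous chart_homeomorphism c) simp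
  have cK: "compact ?K"
    by (intro compact_continuous_image continuous_on_subset[OF chart_continuous(2)[OF c] \<rho>]) simp
  have KU: "?K \<subseteq> fst c"
    using \<rho> c by (auto simp: subset_eq)
  have cont: "continuous_on {a..b} \<gamma>"
    using \<gamma> unfolding C1_into_iff by (meson continuous_on_subset)
  have scont: "continuous_on {a..b} ?s"
    by (rule continuous_on_subset[OF continuous_on_tnorm_pdiff[OF \<gamma>(1,2)] \<gamma>(3)])
  let ?B = "{a..b} \<inter> \<gamma> -` (- ?O)"
  have "closed ?B"
    using opO by (intro continuous_closed_preimage cont) auto
  then have "compact ({a..b} \<inter> ?B)"
    by (intro compact_Int_closed) auto
  then have "compact ?B"
    by simp
  moreover have "?B \<noteq> {}"
    using neg t by auto
  ultimately have "\<exists>s\<in>?B. \<forall>t\<in>?B. s \<le> t"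
    by (rule compact_attains_inf)
  then obtain \<tau> where \<tau>: "\<tau> \<in> ?B" "\<And>x. x \<in> ?B \<Longrightarrow> \<tau> \<le> x"
    by fast
  have "\<gamma> a \<in> ?O"
    using start unfolding O_eq by simp (smt (verit) zero_le_dist)
  then have "a < \<tau>"
    using \<tau>(1) by (metis Int_iff ComplD vimageD atLeastAtMost_iff order_le_less)
  have before: "\<gamma> x \<in> ?O" if "a \<le> x" "x < \<tau>" for x
    using \<tau>(2)[of x] \<tau>(1) that by force
  \<comment> \<open>The exit point is outside the open ball, but the estimate must run up to
    \<open>\<tau>\<close> inclusive. As a limit of earlier points it lies in the compact image of
    the closed ball, which is still inside the chart.\<close>
  have "\<gamma> \<tau> \<in> ?K"
  proof -
    have "closed ({a..\<tau>} \<inter> \<gamma> -` ?K)"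
      using \<tau>(1) by (intro continuous_closed_preimage continuous_on_subset[OF cont] compact_imp_closed cK) auto
    moreover have "{a..<\<tau>} \<subseteq> {a..\<tau>} \<inter> \<gamma> -` ?K"
      using before by fastforce
    ultimately have "closure {a..<\<tau>} \<subseteq> {a..\<tau>} \<inter> \<gamma> -` ?K"
      by (intro closure_minimal)
    moreover have "\<tau> \<in> closure {a..<\<tau>}"
      using \<open>a < \<tau>\<close> by simp
    ultimately have "\<tau> \<in> {a..\<tau>} \<inter> \<gamma> -` ?K"
      by (rule subsetD)
    then show ?thesis
      by blast
  qed
  have inK: "\<gamma> x \<in> ?K" if "x \<in> {a..\<tau>}" for x
    using that before[of x] \<open>\<gamma> \<tau> \<in> ?K\<close> by (cases "x = \<tau>") (auto simp: subset_iff)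
  have inK': "\<gamma> x \<in> fst c" "snd c (\<gamma> x) \<in> cball z \<rho>" if "x \<in> {a..\<tau>}" for x
    using inK[OF that] KU \<rho> c by auto
  let ?D = "\<lambda>x. frechet_derivative (snd c \<circ> \<gamma>) (at x) 1"
  have md: "mdifferentiable \<gamma> x" if "x \<in> {a..\<tau>}" for x
  proof (rule C1_into_mdifferentiable[OF \<gamma>(1,2)])
    have "x \<in> {a..b}"
      using \<tau>(1) that by simp
    then show "x \<in> S"
      using \<gamma>(3) by blast
  qed
  have der: "(snd c \<circ> \<gamma> has_vector_derivative ?D x) (at x)" if "x \<in> {a..\<tau>}" for x
  proof -
    note d = mdifferentiable_chart[OF md[OF that] c inK'(1)[OF that]]
    have "frechet_derivative (snd c \<circ> \<gamma>) (at x) h = h *\<^sub>R ?D x" for h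
      using linear_cmul[OF has_derivative_linear[OF d], of h 1] by (simp del: comp_apply)
    then show ?thesis
      unfolding has_vector_derivative_def by (intro has_derivative_eq_rhs[OF d] ext)
  qed
  have int: "(?D has_integral (snd c \<circ> \<gamma>) \<tau> - (snd c \<circ> \<gamma>) a) {a..\<tau>}"
  proof (rule fundamental_theorem_of_calculus)
    show "(snd c \<circ> \<gamma> has_vector_derivative ?D x) (at x within {a..\<tau>})" if "x \<in> {a..\<tau>}" for x
      by (rule has_vector_derivative_at_within[OF der[OF that]])
  qed (use \<open>a < \<tau>\<close> in simp)
  have le: "norm (?D x) \<le> K * ?s x" if "x \<in> {a..\<tau>}" for x
    using K(2)[OF inK'[OF that], of "?D x"] pdiff_chart[OF md[OF that] c inK'(1)[OF that], of 1]
    by simp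
  have sint: "?s integrable_on {a..b}" "?s integrable_on {a..\<tau>}"
    using \<tau>(1) by (auto intro!: integrable_continuous_real continuous_on_subset[OF scont])
  have "norm (snd c (\<gamma> \<tau>) - snd c (\<gamma> a)) \<le> integral {a..\<tau>} (\<lambda>x. K * ?s x)"
    using integral_norm_bound_integral[of ?D "{a..\<tau>}" "\<lambda>x. K * ?s x"] int sint le
      integrable_cmul[OF sint(2), of K] by (auto simp: has_integral_iff)
  also have "\<dots> = K * integral {a..\<tau>} ?s"
    by simp
  also have "\<dots> \<le> K * integral {a..b} ?s"
    using K(1) \<tau>(1) by (intro mult_left_mono integral_subset_le sint) auto
  finally have "dist (snd c (\<gamma> \<tau>)) (snd c (\<gamma> a)) < \<rho> / 2"
    using len by (simp add: dist_norm)
  then have "dist z (snd c (\<gamma> \<tau>)) < \<rho>"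
    using start(2) dist_triangle[of z "snd c (\<gamma> \<tau>)" "snd c (\<gamma> a)"]
    by (simp add: dist_commute)
  then have "\<gamma> \<tau> \<in> ?O"
    unfolding O_eq using inK'(1)[of \<tau>] \<open>a < \<tau>\<close> by simp
  then show False
    using \<tau>(1) by blast
qed

end

context foliated_manifold begin

definition leaf_curve :: "(real \<Rightarrow> 'm) \<Rightarrow> real \<Rightarrow> real \<Rightarrow> bool" where
  "leaf_curve \<gamma> a b \<longleftrightarrow> a \<le> b \<and> \<gamma> ` {a..b} \<subseteq> W (\<gamma> a) \<and>
     (\<exists>S. open S \<and> {a..b} \<subseteq> S \<and> C1_into A S \<gamma>)"

definition arc_length :: "(real \<Rightarrow> 'm) \<Rightarrow> real \<Rightarrow> real \<Rightarrow> real" where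
  "arc_length \<gamma> a b = integral {a..b} (\<lambda>t. tnorm g (\<gamma> t) (pdiff A \<gamma> t 1))"

lemma foliation_box:
  obtains U and \<Phi> :: "'m \<Rightarrow> 'e" and \<Psi> B where "open U" "z \<in> U" "homeomorphism U (box 0 One) \<Phi> \<Psi>"
    "\<forall>y\<in>U. path_component_set (U \<inter> W y) y = {w\<in>U. \<forall>b\<in>Basis - B. \<Phi> w \<bullet> b = \<Phi> y \<bullet> b}"
proof -
  have "\<exists>U (\<Phi> :: 'm \<Rightarrow> 'e) \<Psi> K.
        open U \<and> z \<in> U \<and> homeomorphism U (box 0 One) \<Phi> \<Psi> \<and>
        K \<subseteq> Basis \<and> card K = CARD('k) \<and>
        (\<forall>y\<in>U. path_component_set (U \<inter> W y) y =
                {z\<in>U. \<forall>b\<in>Basis - K. \<Phi> z \<bullet> b = \<Phi> y \<bullet> b})"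
    using foliation unfolding foliation_def by (elim conjE) (erule spec)
  then show thesis
    using that by blast
qed

text \<open>A plaque is a slice, closed in the box, so it meets \<open>K\<close> in a compact set of
  the manifold. On one plaque the two topologies agree: a small piece of the slice is convex in box
  coordinates, hence lies in a single path component and thus in one parametrized ball. Finitely
  many such pieces suffice.\<close>

lemma compact_plaque_compactly_covered:
  assumes box: "open U" "homeomorphism U (box 0 One) \<Phi> \<Psi>"
    "\<And>y. y \<in> U \<Longrightarrow> path_component_set (U \<inter> W y) y =
      {w\<in>U. \<forall>b\<in>Basis - B. \<Phi> w \<bullet> b = \<Phi> y \<bullet> b}"
    and K: "compact K" "K \<subseteq> U" and y: "y \<in> U"
  shows "compactly_covered (K \<inter> path_component_set (U \<inter> W y) y)"
proof -
  let ?\<pi> = "path_component_set (U \<inter> W y) y"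
  let ?G = "\<lambda>w. \<Sum>b\<in>Basis - B. \<bar>\<Phi> w \<bullet> b - \<Phi> y \<bullet> b\<bar>"
  have \<Phi>: "continuous_on U \<Phi>" "continuous_on (box 0 One) \<Psi>" "\<Phi> ` U = box 0 One"
    "\<And>x. x \<in> U \<Longrightarrow> \<Psi> (\<Phi> x) = x" "\<Psi> ` box 0 One = U" "\<And>s. s \<in> box 0 One \<Longrightarrow> \<Phi> (\<Psi> s) = s"
    using box(2) unfolding homeomorphism_def by blast+
  have "K \<inter> ?\<pi> = K \<inter> ?G -` {0}"
  proof -
    have "?G w = 0 \<longleftrightarrow> (\<forall>b\<in>Basis - B. \<Phi> w \<bullet> b = \<Phi> y \<bullet> b)" for w
      by (subst sum_nonneg_eq_0_iff) auto
    then show ?thesis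
      using K(2) unfolding box(3)[OF y] by auto
  qed
  moreover have "closed (K \<inter> ?G -` {0})"
    by (intro continuous_closed_preimage continuous_intros continuous_on_subset[OF \<Phi>(1) K(2)]
      compact_imp_closed K) simp
  ultimately have cpt: "compact (K \<inter> ?\<pi>)"
    using compact_Int_closed[OF K(1), of "K \<inter> ?\<pi>"] by (simp add: Int_absorb1)
  have "\<forall>w\<in>K \<inter> ?\<pi>. \<exists>N. open N \<and> w \<in> N \<and> compactly_covered (N \<inter> (K \<inter> ?\<pi>))"
  proof
    fix w assume w: "w \<in> K \<inter> ?\<pi>"
    then have wU: "w \<in> U" and wW: "w \<in> W y"
      using K(2) path_component_subset[of "U \<inter> W y" y] by auto
    obtain V q v where q: "(V, q) \<in> P" "v \<in> V" "q v = w"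
      by (rule param_cover)
    obtain r where r: "r > 0" "cball v r \<subseteq> V"
      using param(1)[OF q(1)] q(2) by (meson open_contains_cball)
    have "leaf_open W (q ` ball v r)"
      using r by (intro param(6)[OF q(1)]) (auto simp: subset_iff)
    moreover have "w \<in> q ` ball v r"
      using q(3) r(1) by auto
    ultimately obtain U' where U': "open U'" "w \<in> U'" "path_component_set (U' \<inter> W w) w \<subseteq> q ` ball v r"
      unfolding leaf_open_def by meson
    have o: "open (box 0 One \<inter> \<Psi> -` U')"
      by (intro open_Int_vimage \<Phi> U' open_box)
    have "\<Phi> w \<in> box 0 One \<inter> \<Psi> -` U'"
      using \<Phi>(3,4) wU U'(2) by auto
    then obtain s where s: "s > 0" "ball (\<Phi> w) s \<subseteq> box 0 One \<inter> \<Psi> -` U'"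
      using o by (meson open_contains_ball)
    let ?N = "U \<inter> \<Phi> -` ball (\<Phi> w) s"
    let ?X = "ball (\<Phi> w) s \<inter> {t. \<forall>b\<in>Basis - B. t \<bullet> b = \<Phi> y \<bullet> b}"
    have wX: "\<Phi> w \<in> ?X"
      using w s(1) unfolding box(3)[OF y] by simp
    have "convex {t. \<forall>b\<in>Basis - B. t \<bullet> b = \<Phi> y \<bullet> b}"
      by (auto simp: convex_def inner_add_left simp flip: distrib_right)
    then have "path_connected (\<Psi> ` ?X)"
      using s(2) by (intro path_connected_continuous_image continuous_on_subset[OF \<Phi>(2)]
          convex_imp_path_connected convex_Int) auto
    moreover have "\<Psi> ` ?X \<subseteq> U' \<inter> W w"
    proof
      fix x assume "x \<in> \<Psi> ` ?X"
      then obtain t where t: "x = \<Psi> t" "t \<in> ?X" by blast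
      then have tb: "t \<in> box 0 One" "x \<in> U'"
        using s(2) by auto
      then have "x \<in> ?\<pi>"
        unfolding box(3)[OF y] using t \<Phi>(5,6) by auto
      then have "x \<in> W y"
        using path_component_subset[of "U \<inter> W y" y] by blast
      then show "x \<in> U' \<inter> W w"
        using tb leaf_eq[OF wW] by simp
    qed
    moreover have "w \<in> \<Psi> ` ?X"
    proof -
      have "\<Psi> (\<Phi> w) \<in> \<Psi> ` ?X"
        using wX by (rule imageI)
      then show ?thesis
        by (simp only: \<Phi>(4)[OF wU])
    qed
    ultimately have "\<Psi> ` ?X \<subseteq> path_component_set (U' \<inter> W w) w"
      by (intro path_component_maximal)
    then have 1: "\<Psi> ` ?X \<subseteq> q ` ball v r"
      using U'(3) by blast
    have 2: "?N \<inter> (K \<inter> ?\<pi>) \<subseteq> \<Psi> ` ?X"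
    proof
      fix x assume x: "x \<in> ?N \<inter> (K \<inter> ?\<pi>)"
      then have "\<Phi> x \<in> ?X"
        unfolding box(3)[OF y] by simp
      then show "x \<in> \<Psi> ` ?X"
        using \<Phi>(4)[of x] x image_eqI[of x \<Psi> "\<Phi> x" ?X] by simp
    qed
    have "compactly_covered (q ` cball v r)"
      using r by (intro compactly_covered_piece[OF q(1)]) auto
    moreover have "?N \<inter> (K \<inter> ?\<pi>) \<subseteq> q ` cball v r"
      by (rule order_trans[OF 2 order_trans[OF 1 image_mono[OF ball_subset_cball]]])
    ultimately have "compactly_covered (?N \<inter> (K \<inter> ?\<pi>))"
      by (rule compactly_covered_subset)
    moreover have "open ?N"
      by (intro open_Int_vimage \<Phi> box) simp
    ultimately show "\<exists>N. open N \<and> w \<in> N \<and> compactly_covered (N \<inter> (K \<inter> ?\<pi>))"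
      using wU s(1) by (intro exI[of _ ?N]) simp
  qed
  from bchoice[OF this] obtain N where
    N: "\<forall>w\<in>K \<inter> ?\<pi>. open (N w) \<and> w \<in> N w \<and> compactly_covered (N w \<inter> (K \<inter> ?\<pi>))" ..
  obtain Z where Z: "Z \<subseteq> K \<inter> ?\<pi>" "finite Z" "K \<inter> ?\<pi> \<subseteq> (\<Union>w\<in>Z. N w)"
    by (rule compact_nbhd_cover[OF cpt, of N]) (use N in auto)
  have "compactly_covered (\<Union>w\<in>Z. N w \<inter> (K \<inter> ?\<pi>))"
    by (rule compactly_covered_UN[OF Z(2)]) (use Z(1) N in blast)
  then show ?thesis
    by (rule compactly_covered_subset) (use Z(3) in blast)
qed

text \<open>A curve from the half ball \<open>X\<close> of length below
  \<open>\<rho> / (2 * K)\<close> stays in the compact set \<open>K'\<close> inside the foliation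
  box. Being connected, it also stays on the plaque of its starting point, so \<open>K'\<close>
  intersected with that plaque contains all end points at once.\<close>

lemma short_curves_local:
  obtains U \<epsilon> where "open U" "z \<in> U" "0 < \<epsilon>"
    "\<And>y. y \<in> U \<Longrightarrow> \<exists>Q. compactly_covered Q \<and>
      (\<forall>\<gamma> a b. leaf_curve \<gamma> a b \<and> \<gamma> a \<in> path_component_set (U \<inter> W y) y \<and> arc_length \<gamma> a b < \<epsilon> \<longrightarrow> \<gamma> b \<in> Q)"
proof -
  obtain U and \<Phi> :: "'m \<Rightarrow> 'e" and \<Psi> B where box: "open U" "z \<in> U" "homeomorphism U (box 0 One) \<Phi> \<Psi>"
    "\<forall>y\<in>U. path_component_set (U \<inter> W y) y = {w\<in>U. \<forall>b\<in>Basis - B. \<Phi> w \<bullet> b = \<Phi> y \<bullet> b}"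
    by (rule foliation_box[of z])
  define c where "c = chart_at A z"
  have c: "c \<in> A" "z \<in> fst c"
    by (simp_all add: c_def)
  obtain K \<rho>' where K: "0 < K" "0 < \<rho>'" "cball (snd c z) \<rho>' \<subseteq> snd c ` fst c"
    "\<And>y v. y \<in> fst c \<Longrightarrow> snd c y \<in> cball (snd c z) \<rho>' \<Longrightarrow> norm v \<le> K * tnorm g y (coord_vec A c y v)"
    by (rule chart_norm_le[OF c]) blast
  have "open (snd c ` fst c \<inter> cinv c -` U)"
    by (intro open_Int_vimage chart_continuous chart_homeomorphism c box)
  moreover have "snd c z \<in> snd c ` fst c \<inter> cinv c -` U"
    using c box(2) by simp
  ultimately obtain \<rho>'' where \<rho>'': "\<rho>'' > 0" "cball (snd c z) \<rho>'' \<subseteq> snd c ` fst c \<inter> cinv c -` U"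
    by (meson open_contains_cball)
  \<comment> \<open>The radius \<open>\<rho>'\<close> makes the metric comparable with the Euclidean
    norm, and \<open>\<rho>''\<close> keeps the ball inside the foliation box.\<close>
  define \<rho> where "\<rho> = min \<rho>' \<rho>''"
  have sub: "cball (snd c z) \<rho> \<subseteq> cball (snd c z) \<rho>'" "cball (snd c z) \<rho> \<subseteq> cball (snd c z) \<rho>''"
    by (auto simp: \<rho>_def)
  have \<rho>: "0 < \<rho>" "cball (snd c z) \<rho> \<subseteq> snd c ` fst c" "cinv c ` cball (snd c z) \<rho> \<subseteq> U"
    using K(2,3) \<rho>'' sub by (auto simp: \<rho>_def)
  define K' where "K' = cinv c ` cball (snd c z) \<rho>"
  have cK: "compact K'"
    unfolding K'_def
    by (intro compact_continuous_image continuous_on_subset[OF chart_continuous(2)[OF c(1)] \<rho>(2)]) simp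
  define X where "X = fst c \<inter> snd c -` ball (snd c z) (\<rho> / 2)"
  have "open X"
    unfolding X_def by (intro open_Int_vimage chart_continuous chart_homeomorphism c) simp
  moreover have "z \<in> X"
    using c \<rho>(1) by (simp add: X_def)
  moreover have "0 < \<rho> / (2 * K)"
    using \<rho>(1) K(1) by simp
  moreover have "\<exists>Q. compactly_covered Q \<and> (\<forall>\<gamma> a b. leaf_curve \<gamma> a b \<and>
      \<gamma> a \<in> path_component_set (X \<inter> W y) y \<and> arc_length \<gamma> a b < \<rho> / (2 * K) \<longrightarrow> \<gamma> b \<in> Q)"
    if y: "y \<in> X" for y
  proof -
    have XU: "X \<subseteq> U"
    proof
      fix x assume x: "x \<in> X"
      then have "snd c x \<in> cball (snd c z) \<rho>"
        using \<rho>(1) by (simp add: X_def)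
      then have "cinv c (snd c x) \<in> U"
        using \<rho>(3) by blast
      then show "x \<in> U"
        using x c by (simp add: X_def)
    qed
    have "\<gamma> b \<in> K' \<inter> path_component_set (U \<inter> W y) y"
      if curve: "leaf_curve \<gamma> a b" "\<gamma> a \<in> path_component_set (X \<inter> W y) y" "arc_length \<gamma> a b < \<rho> / (2 * K)"
      for \<gamma> a b
    proof -
      obtain S where S: "open S" "{a..b} \<subseteq> S" "C1_into A S \<gamma>" and ab: "a \<le> b"
          and leaf: "\<gamma> ` {a..b} \<subseteq> W (\<gamma> a)"
        using curve(1) unfolding leaf_curve_def by blast
      have start: "\<gamma> a \<in> X \<inter> W y"
        using curve(2) path_component_subset by blast
      have "\<gamma> t \<in> cinv c ` ball (snd c z) \<rho>" if "t \<in> {a..b}" for t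
      proof (rule curve_stays_in_ball[OF c(1) \<rho>(2) K(1) _ S(3,1,2) _ _ _ that])
        show "\<gamma> a \<in> fst c" "dist (snd c z) (snd c (\<gamma> a)) < \<rho> / 2"
          using start by (auto simp: X_def)
        show "K * integral {a..b} (\<lambda>t. tnorm g (\<gamma> t) (pdiff A \<gamma> t 1)) < \<rho> / 2"
          using curve(3) K(1) by (simp add: arc_length_def field_simps)
        show "norm v \<le> K * tnorm g y (coord_vec A c y v)"
          if "y \<in> fst c" "snd c y \<in> cball (snd c z) \<rho>" for y v
          using K(4) that sub by blast
      qed
      then have inK: "\<gamma> ` {a..b} \<subseteq> K'"
        unfolding K'_def using ball_subset_cball by blast
      have "path_connected (\<gamma> ` {a..b})"
        using S unfolding C1_into_iff
        by (intro path_connected_continuous_image convex_imp_path_connected)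
          (auto intro: continuous_on_subset)
      moreover have "\<gamma> ` {a..b} \<subseteq> U \<inter> W y"
        using inK leaf leaf_eq[of "\<gamma> a" y] start \<rho>(3) unfolding K'_def by blast
      ultimately have "\<gamma> ` {a..b} \<subseteq> path_component_set (U \<inter> W y) (\<gamma> a)"
        using ab by (intro path_component_maximal) auto
      moreover have "path_component (X \<inter> W y) y (\<gamma> a)"
        using curve(2) by simp
      then have "path_component (U \<inter> W y) y (\<gamma> a)"
        by (rule path_component_of_subset[rotated]) (use XU in blast)
      then have "path_component_set (U \<inter> W y) (\<gamma> a) = path_component_set (U \<inter> W y) y"
        using path_component_eq by (metis mem_Collect_eq)
      moreover have "\<gamma> b \<in> \<gamma> ` {a..b}"
        using ab by simp
      ultimately show ?thesis
        using inK by blast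
    qed
    moreover have "compactly_covered (K' \<inter> path_component_set (U \<inter> W y) y)"
      using compact_plaque_compactly_covered[OF box(1,3) bspec[OF box(4)] cK] y XU \<rho>(3) unfolding K'_def by blast
    ultimately show ?thesis by blast
  qed
  ultimately show thesis by (rule that)
qed

text \<open>The length \<open>\<epsilon>\<close> is the minimum over a finite cover of the manifold
  and does not depend on \<open>S\<close>; only \<open>S'\<close> does. This uniformity is what
  allows iterating the enlargement any number of times.\<close>

lemma short_curves:
  assumes "compact (UNIV :: 'm set)"
  obtains \<epsilon> where "0 < \<epsilon>" "\<And>S. compactly_covered S \<Longrightarrow> \<exists>S'. compactly_covered S' \<and>
    (\<forall>\<gamma> a b. leaf_curve \<gamma> a b \<and> \<gamma> a \<in> S \<and> arc_length \<gamma> a b < \<epsilon> \<longrightarrow> \<gamma> b \<in> S')"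
proof -
  define short where "short S \<epsilon> Q \<longleftrightarrow> compactly_covered Q \<and>
    (\<forall>\<gamma> a b. leaf_curve \<gamma> a b \<and> \<gamma> a \<in> S \<and> arc_length \<gamma> a b < \<epsilon> \<longrightarrow> \<gamma> b \<in> Q)" for S \<epsilon> Q
  have "\<forall>z. \<exists>X. open (fst X) \<and> z \<in> fst X \<and> (0::real) < snd X \<and>
      (\<forall>y\<in>fst X. \<exists>Q. short (path_component_set (fst X \<inter> W y) y) (snd X) Q)"
  proof
    fix z
    obtain U \<epsilon> where "open U" "z \<in> U" "0 < \<epsilon>"
      "\<And>y. y \<in> U \<Longrightarrow> \<exists>Q. short (path_component_set (U \<inter> W y) y) \<epsilon> Q"
      unfolding short_def by (rule short_curves_local[of z]) blast
    then show "\<exists>X. open (fst X) \<and> z \<in> fst X \<and> (0::real) < snd X \<and>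
      (\<forall>y\<in>fst X. \<exists>Q. short (path_component_set (fst X \<inter> W y) y) (snd X) Q)"
      by (intro exI[of _ "(U, \<epsilon>)"]) simp
  qed
  from choice[OF this] obtain X where X: "\<forall>z. open (fst (X z)) \<and> z \<in> fst (X z) \<and> (0::real) < snd (X z) \<and>
      (\<forall>y\<in>fst (X z). \<exists>Q. short (path_component_set (fst (X z) \<inter> W y) y) (snd (X z)) Q)" ..
  obtain Z where Z: "finite Z" "UNIV \<subseteq> (\<Union>z\<in>Z. fst (X z))"
    by (rule compact_nbhd_cover[OF assms, of "\<lambda>z. fst (X z)"]) (use X in auto)
  define \<epsilon> where "\<epsilon> = Min ((\<lambda>z. snd (X z)) ` Z)"
  have "Z \<noteq> {}"
    using Z(2) by auto
  then have \<epsilon>: "0 < \<epsilon>" "\<And>z. z \<in> Z \<Longrightarrow> \<epsilon> \<le> snd (X z)"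
    using Z(1) X unfolding \<epsilon>_def by (subst Min_gr_iff; simp) (simp add: Z(1))
  have mono: "short S \<epsilon>' Q" if "short S' \<epsilon>'' Q" "S \<subseteq> S'" "\<epsilon>' \<le> \<epsilon>''" for S S' \<epsilon>' \<epsilon>'' Q
    using that unfolding short_def by (meson order_less_le_trans subsetD)
  have "\<exists>S'. short S \<epsilon> S'" if "compactly_covered S" for S
    using that
  proof (induction rule: compactly_covered_induct)
    case empty
    then show ?case
      unfolding short_def using compactly_covered_empty by blast
  next
    case (Un S T)
    then obtain Q Q' where "short S \<epsilon> Q" "short T \<epsilon> Q'" by blast
    then have "short (S \<union> T) \<epsilon> (Q \<union> Q')"
      unfolding short_def using compactly_covered_Un by blast
    then show ?case by blast
  next
    case (subset S T)
    then show ?case using mono by blast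
  next
    case (local V p u)
    obtain z where z: "z \<in> Z" "p u \<in> fst (X z)"
      using Z(2) by blast
    obtain Q where Q: "short (path_component_set (fst (X z) \<inter> W (p u)) (p u)) (snd (X z)) Q"
      using X z(2) by blast
    note p = param_leafwise[OF local(1)] param(1)[OF local(1)]
    have "open (V \<inter> p -` fst (X z))"
      using p X unfolding leafwise_def by (intro open_Int_vimage) auto
    then obtain r where r: "r > 0" "ball u r \<subseteq> V \<inter> p -` fst (X z)"
      using local(2) z(2) by (meson IntI open_contains_ball vimageI)
    have "p ` (ball u r \<inter> V) \<subseteq> path_component_set (fst (X z) \<inter> W (p u)) (p u)"
    proof (rule image_subsetI)
      fix v assume v: "v \<in> ball u r \<inter> V"
      have "leafwise (ball u r) p"
        using leafwise_subset[OF p(1)] r(2) by blast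
      then show "p v \<in> path_component_set (fst (X z) \<inter> W (p u)) (p u)"
        by (rule leafwise_path_component) (use v r in \<open>auto simp: convex_imp_path_connected\<close>)
    qed
    then have "short (p ` (ball u r \<inter> V)) \<epsilon> Q"
      using mono[OF Q] \<epsilon>(2)[OF z(1)] by blast
    then show ?case
      using r(1) by blast
  qed
  then show thesis
    using that[OF \<epsilon>(1)] unfolding short_def by blast
qed

text \<open>A curve shorter than \<open>Suc n * \<epsilon>\<close> is followed through
  \<open>Suc n\<close> pieces shorter than \<open>\<epsilon>\<close>, each of which enlarges the
  covering set once. The single point \<open>x\<close> starts the induction.\<close>

lemma bounded_curves:
  assumes "compact (UNIV :: 'm set)"
  obtains S where "compactly_covered S"
    "\<And>\<gamma> a b. leaf_curve \<gamma> a b \<Longrightarrow> \<gamma> a = x \<Longrightarrow> arc_length \<gamma> a b < r \<Longrightarrow> \<gamma> b \<in> S"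
proof -
  obtain \<epsilon> where \<epsilon>: "0 < \<epsilon>" and step: "\<And>S. compactly_covered S \<Longrightarrow> \<exists>S'. compactly_covered S' \<and>
    (\<forall>\<gamma> a b. leaf_curve \<gamma> a b \<and> \<gamma> a \<in> S \<and> arc_length \<gamma> a b < \<epsilon> \<longrightarrow> \<gamma> b \<in> S')"
    by (rule short_curves[OF assms]) blast
  have "\<exists>S. compactly_covered S \<and>
    (\<forall>\<gamma> a b. leaf_curve \<gamma> a b \<and> \<gamma> a = x \<and> arc_length \<gamma> a b < Suc n * \<epsilon> \<longrightarrow> \<gamma> b \<in> S)" for n
  proof (induction n)
    case 0
    then show ?case
      using step[OF compactly_covered_singleton[of x]] by simp
  next
    case (Suc n)
    then obtain S where S: "compactly_covered S"
      "\<And>\<gamma> a b. leaf_curve \<gamma> a b \<Longrightarrow> \<gamma> a = x \<Longrightarrow> arc_length \<gamma> a b < Suc n * \<epsilon> \<Longrightarrow> \<gamma> b \<in> S"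
      by blast
    obtain S' where S': "compactly_covered S'"
      "\<And>\<gamma> a b. leaf_curve \<gamma> a b \<Longrightarrow> \<gamma> a \<in> S \<Longrightarrow> arc_length \<gamma> a b < \<epsilon> \<Longrightarrow> \<gamma> b \<in> S'"
      using step[OF S(1)] by blast
    have "\<gamma> b \<in> S'" if curve: "leaf_curve \<gamma> a b" "\<gamma> a = x" "arc_length \<gamma> a b < Suc (Suc n) * \<epsilon>" for \<gamma> a b
    proof -
      obtain R where R: "open R" "{a..b} \<subseteq> R" "C1_into A R \<gamma>" and ab: "a \<le> b"
        and leaf: "\<gamma> ` {a..b} \<subseteq> W (\<gamma> a)"
        using curve(1) unfolding leaf_curve_def by blast
      let ?s = "\<lambda>t. tnorm g (\<gamma> t) (pdiff A \<gamma> t 1)"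
      have "continuous_on {a..b} ?s"
        by (rule continuous_on_subset[OF continuous_on_tnorm_pdiff[OF R(3,1)] R(2)])
      then have int: "?s integrable_on {a..b}"
        by (rule integrable_continuous_real)
      let ?L = "arc_length \<gamma> a b"
      have L0: "0 \<le> ?L"
        unfolding arc_length_def by (rule integral_nonneg[OF int]) simp
      define N where "N = real (Suc n)"
      have N: "0 < N" "?L < (N + 1) * \<epsilon>"
        using curve(3) by (simp_all add: N_def add_ac)
      \<comment> \<open>The cut separates the last of \<open>N + 1\<close> equal shares of the
        length, so both strict inequalities \<open>l < N * \<epsilon>\<close> and
        \<open>?L - l < \<epsilon>\<close> survive. The cutting time comes from the intermediate
        value theorem for the length function.\<close>
      define l where "l = N * (?L / (N + 1))"
      have "?L / (N + 1) < \<epsilon>"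
        using N by (simp add: pos_divide_less_eq mult.commute)
      moreover have "l + ?L / (N + 1) = ?L"
      proof -
        have "l + ?L / (N + 1) = (N + 1) * (?L / (N + 1))"
          by (simp only: l_def distrib_right mult_1)
        then show ?thesis
          using N(1) by simp
      qed
      moreover have "0 \<le> ?L / (N + 1)"
        using N(1) L0 by simp
      moreover have "0 \<le> l"
        using N(1) L0 by (simp add: l_def)
      ultimately have l: "0 \<le> l" "l \<le> ?L" "l < Suc n * \<epsilon>" "?L - l < \<epsilon>"
        using mult_strict_left_mono[of "?L / (N + 1)" \<epsilon> N] N(1) by (simp_all add: l_def N_def)
      have "continuous_on {a..b} (\<lambda>t. integral {a..t} ?s)"
        by (rule indefinite_integral_continuous_1[OF int])
      then obtain t where t: "a \<le> t" "t \<le> b" "integral {a..t} ?s = l"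
        using IVT'[of "\<lambda>t. integral {a..t} ?s" a l b] l ab by (auto simp: arc_length_def)
      have "leaf_curve \<gamma> a t"
        using R t leaf unfolding leaf_curve_def by (auto intro!: exI[of _ R])
      then have "\<gamma> t \<in> S"
        using S(2) curve(2) t(3) l(3) by (simp add: arc_length_def)
      moreover have "leaf_curve \<gamma> t b"
      proof -
        have "W (\<gamma> t) = W (\<gamma> a)"
          by (rule leaf_eq) (use leaf t in auto)
        then have "\<gamma> ` {t..b} \<subseteq> W (\<gamma> t)"
          using leaf t by auto
        then show ?thesis
          using R t unfolding leaf_curve_def by (auto intro!: exI[of _ R])
      qed
      moreover have "arc_length \<gamma> t b < \<epsilon>"
        using l(4) t Henstock_Kurzweil_Integration.integral_combine[OF t(1,2) int]
        by (simp add: arc_length_def)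
      ultimately show ?thesis
        using S'(2) by blast
    qed
    then show ?case
      using S'(1) by blast
  qed
  moreover obtain n where "r < real n * \<epsilon>"
    using reals_Archimedean3[OF \<epsilon>] by blast
  then have "r \<le> Suc n * \<epsilon>"
    using \<epsilon> by (simp add: distrib_right)
  ultimately show thesis
    using that by (meson order_less_le_trans)
qed

end

section \<open>Concatenation of curves\<close>

lemma C1_on_glue:
  fixes F G :: "real \<Rightarrow> 'a::real_normed_vector"
  assumes F: "C1_on N F" and G: "C1_on N G" and N: "open N"
    and t0: "t0 \<in> N" "F t0 = G t0"
      "frechet_derivative F (at t0) 1 = 0" "frechet_derivative G (at t0) 1 = 0"
  shows "C1_on N (\<lambda>t. if t \<le> t0 then F t else G t)"
proof (rule C1_on_I)
  let ?H = "\<lambda>t. if t \<le> t0 then F t else G t"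
  let ?D = "\<lambda>t. if t \<le> t0 then frechet_derivative F (at t) else frechet_derivative G (at t)"
  have zero: "frechet_derivative K (at t0) = (\<lambda>_. 0)"
    if "C1_on N K" "frechet_derivative K (at t0) 1 = 0" for K :: "real \<Rightarrow> 'a"
  proof
    fix h
    show "frechet_derivative K (at t0) h = 0"
      using linear_cmul[OF has_derivative_linear[OF C1_on_has_derivative[OF that(1) t0(1)]], of h 1] that(2)
      by simp
  qed
  show "(?H has_derivative ?D t) (at t)" if t: "t \<in> N" for t
  proof (cases t t0 rule: linorder_cases)
    case less
    have "\<forall>\<^sub>F s in nhds t. F s = ?H s"
      using eventually_nhds_in_open[of "{..<t0}" t] less by (auto elim!: eventually_mono)
    with C1_on_has_derivative[OF F t] less show ?thesis
      by (auto intro: has_derivative_cong_nhds)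
  next
    case greater
    have "\<forall>\<^sub>F s in nhds t. G s = ?H s"
      using eventually_nhds_in_open[of "{t0<..}" t] greater by (auto elim!: eventually_mono)
    with C1_on_has_derivative[OF G t] greater show ?thesis
      by (auto intro: has_derivative_cong_nhds)
  next
    case equal
    have "(F has_derivative (\<lambda>_. 0)) (at t0)" "(G has_derivative (\<lambda>_. 0)) (at t0)"
      using C1_on_has_derivative[OF F t0(1)] C1_on_has_derivative[OF G t0(1)]
      by (simp_all add: zero[OF F t0(3)] zero[OF G t0(4)])
    then have FG: "\<exists>d>0. \<forall>y. norm (y - t0) < d \<longrightarrow> norm (F y - F t0) \<le> e * norm (y - t0)"
      "\<exists>d>0. \<forall>y. norm (y - t0) < d \<longrightarrow> norm (G y - G t0) \<le> e * norm (y - t0)" if "e > 0" for e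
      using that unfolding has_derivative_at_alt by simp_all
    have "(?H has_derivative (\<lambda>_. 0)) (at t0)"
      unfolding has_derivative_at_alt
    proof (intro conjI allI impI)
      fix e :: real assume e: "0 < e"
      obtain d where d: "d > 0" "\<And>y. norm (y - t0) < d \<Longrightarrow> norm (F y - F t0) \<le> e * norm (y - t0)"
        using FG(1)[OF e] by blast
      obtain d' where d': "d' > 0" "\<And>y. norm (y - t0) < d' \<Longrightarrow> norm (G y - G t0) \<le> e * norm (y - t0)"
        using FG(2)[OF e] by blast
      have "norm (?H y - ?H t0 - 0) \<le> e * norm (y - t0)" if "norm (y - t0) < min d d'" for y
        using d(2)[of y] d'(2)[of y] that t0(2) by (cases "y \<le> t0") simp_all
      then show "\<exists>d>0. \<forall>y. norm (y - t0) < d \<longrightarrow> norm (?H y - ?H t0 - 0) \<le> e * norm (y - t0)"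
        using d(1) d'(1) by (intro exI[of _ "min d d'"] conjI allI impI) simp_all
    qed simp
    then show ?thesis
      using equal zero[OF F t0(3)] by simp
  qed
  fix v
  have "continuous_on N (\<lambda>t. if t \<le> t0 then frechet_derivative F (at t) v else frechet_derivative G (at t) v)"
    using C1_on_continuous_derivative[OF F] C1_on_continuous_derivative[OF G]
    by (intro continuous_on_cases_le)
      (auto intro: continuous_on_subset simp: zero[OF F t0(3)] zero[OF G t0(4)])
  then show "continuous_on N (\<lambda>t. ?D t v)"
    by (simp add: if_distribR)
qed

context atlas begin

lemma pdiff_reparam:
  assumes "mdifferentiable p (\<sigma> t)" "(\<sigma> has_derivative \<sigma>') (at t)"
  shows "pdiff A (p \<circ> \<sigma>) t v = pdiff A p (\<sigma> t) (\<sigma>' v)"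
proof -
  let ?c = "chart_at A (p (\<sigma> t))"
  have "((snd ?c \<circ> p) \<circ> \<sigma> has_derivative frechet_derivative (snd ?c \<circ> p) (at (\<sigma> t)) \<circ> \<sigma>') (at t)"
    by (rule diff_chain_at[OF assms(2)]) (rule mdifferentiable_chart[OF assms(1)], simp_all)
  from frechet_derivative_at[OF this] show ?thesis
    by (simp add: pdiff_def o_assoc fun_eq_iff)
qed

lemma pdiff_cong_nhds:
  assumes "\<forall>\<^sub>F s in nhds t. p s = q s"
  shows "pdiff A p t v = pdiff A q t v"
proof -
  have eq: "p t = q t"
    using assms eventually_nhds_x_imp_x by blast
  have "frechet_derivative (snd c \<circ> p) (at t) = frechet_derivative (snd c \<circ> q) (at t)" for c :: "('m, 'e) chart"
  proof -
    have "\<forall>\<^sub>F s in nhds t. (snd c \<circ> p) s = (snd c \<circ> q) s" "\<forall>\<^sub>F s in nhds t. (snd c \<circ> q) s = (snd c \<circ> p) s"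
      using assms by (auto elim: eventually_mono)
    then have "((snd c \<circ> p) has_derivative D) (at t) \<longleftrightarrow> ((snd c \<circ> q) has_derivative D) (at t)" for D
      using has_derivative_cong_nhds by blast
    then show ?thesis
      by (simp add: frechet_derivative_def)
  qed
  then show ?thesis
    by (simp add: pdiff_def eq)
qed

lemma C1_into_glue:
  fixes p q :: "real \<Rightarrow> 'm"
  assumes S: "open S" "t0 \<in> S" and p: "C1_into A S p" and q: "C1_into A S q"
    and t0: "p t0 = q t0" "pdiff A p t0 1 = 0" "pdiff A q t0 1 = 0"
  shows "C1_into A S (\<lambda>t. if t \<le> t0 then p t else q t)"
    and "t \<in> S \<Longrightarrow> pdiff A (\<lambda>t. if t \<le> t0 then p t else q t) t 1 =
      (if t \<le> t0 then pdiff A p t 1 else pdiff A q t 1)"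
proof -
  let ?\<eta> = "\<lambda>t. if t \<le> t0 then p t else q t"
  let ?c = "chart_at A (p t0)"
  have cont: "continuous_on S ?\<eta>"
    using p q t0(1) unfolding C1_into_iff
    by (intro continuous_on_cases_le) (auto intro: continuous_on_subset)
  obtain N where N: "open N" "t0 \<in> N" "N \<subseteq> S" "p ` N \<subseteq> fst ?c" "C1_on N (snd ?c \<circ> p)"
    by (rule C1_into_nbhd[OF p S, of ?c]) auto
  obtain N' where N': "open N'" "t0 \<in> N'" "N' \<subseteq> S" "q ` N' \<subseteq> fst ?c" "C1_on N' (snd ?c \<circ> q)"
    by (rule C1_into_nbhd[OF q S, of ?c]) (auto simp: t0(1)[symmetric])
  have z: "frechet_derivative (snd ?c \<circ> p) (at t0) 1 = 0" "frechet_derivative (snd ?c \<circ> q) (at t0) 1 = 0"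
    using t0 by (simp_all add: pdiff_def)
  have "C1_on (N \<inter> N') (\<lambda>t. if t \<le> t0 then (snd ?c \<circ> p) t else (snd ?c \<circ> q) t)"
    by (rule C1_on_glue[OF C1_on_mono[OF N(5)] C1_on_mono[OF N'(5)] _ _ _ z]) (use N N' t0(1) in auto)
  moreover have comp: "(\<lambda>t. if t \<le> t0 then (snd ?c \<circ> p) t else (snd ?c \<circ> q) t) = snd ?c \<circ> ?\<eta>"
    by auto
  ultimately have glue: "C1_on (N \<inter> N') (snd ?c \<circ> ?\<eta>)"
    by simp
  show C1: "C1_into A S ?\<eta>"
  proof (rule C1_into_local[OF S(1)])
    fix u assume u: "u \<in> S"
    have "\<exists>c\<in>A. \<exists>N. open N \<and> u \<in> N \<and> ?\<eta> ` N \<subseteq> fst c \<and> C1_on N (snd c \<circ> ?\<eta>)"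
    proof (cases u t0 rule: linorder_cases)
      case less
      let ?d = "chart_at A (p u)"
      obtain M where M: "open M" "u \<in> M" "M \<subseteq> S" "p ` M \<subseteq> fst ?d" "C1_on M (snd ?d \<circ> p)"
        by (rule C1_into_nbhd[OF p S(1) u, of ?d]) auto
      have "C1_on (M \<inter> {..<t0}) (snd ?d \<circ> ?\<eta>)"
        by (rule C1_on_cong[OF C1_on_mono[OF M(5)]]) (use M(1) in auto)
      then show ?thesis
        using M less by (intro bexI[of _ ?d] exI[of _ "M \<inter> {..<t0}"]) auto
    next
      case greater
      let ?d = "chart_at A (q u)"
      obtain M where M: "open M" "u \<in> M" "M \<subseteq> S" "q ` M \<subseteq> fst ?d" "C1_on M (snd ?d \<circ> q)"
        by (rule C1_into_nbhd[OF q S(1) u, of ?d]) auto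
      have "C1_on (M \<inter> {t0<..}) (snd ?d \<circ> ?\<eta>)"
        by (rule C1_on_cong[OF C1_on_mono[OF M(5)]]) (use M(1) in auto)
      then show ?thesis
        using M greater by (intro bexI[of _ ?d] exI[of _ "M \<inter> {t0<..}"]) auto
    next
      case equal
      then show ?thesis
        using N N' glue by (intro bexI[of _ ?c] exI[of _ "N \<inter> N'"]) auto
    qed
    moreover have "isCont ?\<eta> u"
      using iffD1[OF continuous_on_eq_continuous_at[OF S(1)] cont] u by blast
    ultimately show "isCont ?\<eta> u \<and> (\<exists>c\<in>A. \<exists>N. open N \<and> u \<in> N \<and> ?\<eta> ` N \<subseteq> fst c \<and> C1_on N (snd c \<circ> ?\<eta>))"
      by blast
  qed
  assume t: "t \<in> S"
  show "pdiff A ?\<eta> t 1 = (if t \<le> t0 then pdiff A p t 1 else pdiff A q t 1)"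
  proof (cases t t0 rule: linorder_cases)
    case less
    have "\<forall>\<^sub>F s in nhds t. ?\<eta> s = p s"
      using eventually_nhds_in_open[of "{..<t0}" t] less by (auto elim!: eventually_mono)
    from pdiff_cong_nhds[OF this] show ?thesis
      using less by simp
  next
    case greater
    have "\<forall>\<^sub>F s in nhds t. ?\<eta> s = q s"
      using eventually_nhds_in_open[of "{t0<..}" t] greater by (auto elim!: eventually_mono)
    from pdiff_cong_nhds[OF this] show ?thesis
      using greater by simp
  next
    case equal
    have d: "(snd ?c \<circ> ?\<eta> has_derivative frechet_derivative (snd ?c \<circ> ?\<eta>) (at t0)) (at t0)"
      "(snd ?c \<circ> p has_derivative frechet_derivative (snd ?c \<circ> p) (at t0)) (at t0)"
      using C1_on_has_derivative[OF glue, of t0] C1_on_has_derivative[OF N(5), of t0] N N' by auto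
    \<comment> \<open>The glued curve agrees with \<open>p\<close> only to the left of
      \<open>t0\<close>, but a derivative is already determined by its restriction to a half
      line.\<close>
    have "frechet_derivative (snd ?c \<circ> ?\<eta>) (at t0) = frechet_derivative (snd ?c \<circ> p) (at t0)"
    proof (rule frechet_derivative_unique_within[of _ _ t0 "{..t0}"])
      show "(snd ?c \<circ> p has_derivative frechet_derivative (snd ?c \<circ> p) (at t0)) (at t0 within {..t0})"
        by (rule has_derivative_at_withinI[OF d(2)])
      show "(snd ?c \<circ> p has_derivative frechet_derivative (snd ?c \<circ> ?\<eta>) (at t0)) (at t0 within {..t0})"
        by (rule has_derivative_transform[OF _ _ has_derivative_at_withinI[OF d(1)]]) auto
      fix i :: real and e :: real assume "i \<in> Basis" "0 < e"
      then show "\<exists>d. 0 < \<bar>d\<bar> \<and> \<bar>d\<bar> < e \<and> t0 + d *\<^sub>R i \<in> {..t0}"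
        by (intro exI[of _ "- e / 2"]) auto
    qed
    then show ?thesis
      using equal by (simp add: pdiff_def)
  qed
qed

end

context foliated_manifold begin

section \<open>Leaf distance and leaf disks\<close>

definition leaf_lengths :: "'m \<Rightarrow> 'm \<Rightarrow> real set" where
  "leaf_lengths x y = {curve_length A g \<gamma> | \<gamma> S. open S \<and> {0..1} \<subseteq> S \<and> C1_into A S \<gamma> \<and>
            \<gamma> ` {0..1} \<subseteq> W x \<and> \<gamma> 0 = x \<and> \<gamma> 1 = y}"

lemma leaf_dist_eq: "leaf_dist A g W x y = Inf (leaf_lengths x y)"
  unfolding leaf_dist_def leaf_lengths_def ..

lemma speed_integrable:
  fixes \<gamma> :: "real \<Rightarrow> 'm"
  assumes "C1_into A S \<gamma>" "open S" "{a..b} \<subseteq> S"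
  shows "(\<lambda>t. tnorm g (\<gamma> t) (pdiff A \<gamma> t 1)) integrable_on {a..b}"
  by (rule integrable_continuous_real)
    (rule continuous_on_subset[OF continuous_on_tnorm_pdiff[OF assms(1,2)] assms(3)])

lemma leaf_lengths_nonneg: "l \<in> leaf_lengths x y \<Longrightarrow> 0 \<le> l"
  unfolding leaf_lengths_def curve_length_def
  by (auto intro!: integral_nonneg speed_integrable)

text \<open>Both curves are run through with velocity tending to 0 at the junction, so that their
  concatenation is again \<open>C1\<close>.\<close>

lemma extend_curve:
  assumes l: "l \<in> leaf_lengths x (p u)" and p: "(V, p) \<in> P"
    and seg: "\<And>s. s \<in> {0..1} \<Longrightarrow> u + s *\<^sub>R (w - u) \<in> V"
    and L: "\<And>s. s \<in> {0..1} \<Longrightarrow>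
      tnorm g (p (u + s *\<^sub>R (w - u))) (pdiff A p (u + s *\<^sub>R (w - u)) (w - u)) \<le> L"
  obtains l' where "l' \<in> leaf_lengths x (p w)" "l' \<le> l + 2 * L"
proof -
  obtain \<gamma> S where \<gamma>: "open S" "{0..1} \<subseteq> S" "C1_into A S \<gamma>" "\<gamma> ` {0..1} \<subseteq> W x" "\<gamma> 0 = x"
      "\<gamma> 1 = p u" and l_eq: "l = curve_length A g \<gamma>"
    using l unfolding leaf_lengths_def by blast
  \<comment> \<open>On \<open>[0, 1/2]\<close> the function \<open>h\<close> climbs from 0 to 1, and
    on \<open>[1/2, 1]\<close> the factor \<open>(2 * t - 1)^2\<close> in \<open>k\<close> does;
    both have zero derivative at \<open>1/2\<close>. Both take \<open>[0, 1]\<close> into itself, so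
    each reparametrized curve is \<open>C1\<close> near all of \<open>[0, 1]\<close> and the gluing
    can be done on one open set \<open>S'\<close>.\<close>
  define h where "h t = 4 * t - 4 * t\<^sup>2" for t :: real
  define k where "k t = u + (2 * t - 1)\<^sup>2 *\<^sub>R (w - u)" for t :: real
  have h': "(h has_real_derivative 4 - 8 * t) (at t within T)" for t T
    unfolding h_def by (auto intro!: derivative_eq_intros)
  have hd: "(h has_derivative (\<lambda>v. (4 - 8 * t) * v)) (at t)" for t
    using h'[of t UNIV] by (simp add: has_field_derivative_def)
  have kd: "(k has_derivative (\<lambda>v. v *\<^sub>R ((4 * (2 * t - 1)) *\<^sub>R (w - u)))) (at t)" for t
    unfolding k_def by (auto intro!: derivative_eq_intros simp: algebra_simps)
  have hC1: "C1_on T h" for T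
    by (rule C1_on_I[OF hd]) (intro continuous_intros)
  have kC1: "C1_on T k" for T
    by (rule C1_on_I[OF kd]) (intro continuous_intros)
  have hk01: "h t \<in> {0..1}" "(2 * t - 1)\<^sup>2 \<in> {0..1}" if "t \<in> {0..1}" for t
  proof -
    have eq: "h t = 1 - (2 * t - 1)\<^sup>2"
      by (simp add: h_def power2_eq_square algebra_simps)
    have "(2 * t - 1)\<^sup>2 \<le> 1"
      using that by (auto simp: abs_square_le_1 abs_le_iff)
    then show "h t \<in> {0..1}" "(2 * t - 1)\<^sup>2 \<in> {0..1}"
      by (simp_all add: eq)
  qed
  define S' where "S' = (UNIV \<inter> h -` S) \<inter> (UNIV \<inter> k -` V)"
  have S'o: "open S'"
    unfolding S'_def using \<gamma>(1) param(1)[OF p] C1_on_continuous_on[OF hC1] C1_on_continuous_on[OF kC1]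
    by (intro open_Int open_Int_vimage) auto
  have S'01: "{0..1} \<subseteq> S'"
    using subsetD[OF \<gamma>(2) hk01(1)] seg[OF hk01(2)] by (auto simp: S'_def k_def)
  have 1: "C1_into A S' (\<gamma> \<circ> h)"
    by (rule C1_into_reparam[OF \<gamma>(3,1) S'o hC1]) (auto simp: S'_def)
  have 2: "C1_into A S' (p \<circ> k)"
    by (rule C1_into_reparam[OF param(2,1)[OF p] S'o kC1]) (auto simp: S'_def)
  have md1: "mdifferentiable \<gamma> (h t)" if "t \<in> {0..1}" for t
    using C1_into_mdifferentiable[OF \<gamma>(3,1)] \<gamma>(2) hk01(1)[OF that] by blast
  have kV: "k t \<in> V" if "t \<in> {0..1}" for t
    using seg[OF hk01(2)[OF that]] by (simp add: k_def)
  have md2: "mdifferentiable p (k t)" if "t \<in> {0..1}" for t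
    using C1_into_mdifferentiable[OF param(2,1)[OF p] kV[OF that]] .
  have pd1: "pdiff A (\<gamma> \<circ> h) t 1 = (4 - 8 * t) *\<^sub>R pdiff A \<gamma> (h t) 1" if "t \<in> {0..1}" for t
    using pdiff_reparam[OF md1[OF that] hd, of 1] linear_cmul[OF linear_pdiff[OF md1[OF that]], of "4 - 8 * t" 1]
    by simp
  have pd2: "pdiff A (p \<circ> k) t 1 = (4 * (2 * t - 1)) *\<^sub>R pdiff A p (k t) (w - u)" if "t \<in> {0..1}" for t
    using pdiff_reparam[OF md2[OF that] kd, of 1] linear_cmul[OF linear_pdiff[OF md2[OF that]]]
    by simp
  define \<eta> where "\<eta> = (\<lambda>t. if t \<le> 1/2 then (\<gamma> \<circ> h) t else (p \<circ> k) t)"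
  have half: "1/2 \<in> S'" "(\<gamma> \<circ> h) (1/2) = (p \<circ> k) (1/2)" "pdiff A (\<gamma> \<circ> h) (1/2) 1 = 0"
      "pdiff A (p \<circ> k) (1/2) 1 = 0"
    using S'01 \<gamma>(6) pd1[of "1/2"] pd2[of "1/2"] by (auto simp: h_def k_def power2_eq_square)
  note glue = C1_into_glue[OF S'o half(1) 1 2 half(2-4), folded \<eta>_def]
  let ?s = "\<lambda>t. tnorm g (\<eta> t) (pdiff A \<eta> t 1)"
  have speed: "?s t = (4 - 8 * t) *\<^sub>R tnorm g (\<gamma> (h t)) (pdiff A \<gamma> (h t) 1)" if "t \<in> {0..1/2}" for t
  proof -
    have t: "t \<in> {0..1}" "t \<in> S'"
      using that subsetD[OF S'01, of t] by auto
    have "pdiff A \<eta> t 1 = (4 - 8 * t) *\<^sub>R pdiff A \<gamma> (h t) 1"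
      using glue(2)[OF t(2)] pd1[OF t(1)] that by simp
    moreover have "\<eta> t = \<gamma> (h t)"
      using that by (simp add: \<eta>_def)
    ultimately show ?thesis
      using that by (simp add: tnorm_scale)
  qed
  have subst: "((\<lambda>t. (4 - 8 * t) *\<^sub>R (\<lambda>t. tnorm g (\<gamma> t) (pdiff A \<gamma> t 1)) (h t)) has_integral
      integral {h 0..h (1/2)} (\<lambda>t. tnorm g (\<gamma> t) (pdiff A \<gamma> t 1))) {0..1/2}"
  proof (rule has_integral_substitution)
    show "h ` {0..1/2} \<subseteq> {0..1}"
      using hk01(1) by auto
    show "continuous_on {0..1} (\<lambda>t. tnorm g (\<gamma> t) (pdiff A \<gamma> t 1))"
      by (rule continuous_on_subset[OF continuous_on_tnorm_pdiff[OF \<gamma>(3,1)] \<gamma>(2)])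
    show "(h has_real_derivative 4 - 8 * t) (at t within {0..1/2})" for t
      by (rule h')
  qed (auto simp: h_def power2_eq_square)
  have h01: "h 0 = 0" "h (1/2) = 1"
    by (simp_all add: h_def power2_eq_square)
  have int1: "(?s has_integral l) {0..1/2}"
  proof (rule has_integral_eq)
    show "((\<lambda>t. (4 - 8 * t) *\<^sub>R tnorm g (\<gamma> (h t)) (pdiff A \<gamma> (h t) 1)) has_integral l) {0..1/2}"
      using subst by (simp only: h01 l_eq curve_length_def)
  qed (simp only: speed)
  have L0: "0 \<le> L"
    by (rule order_trans[OF tnorm_nonneg L[of 0]]) simp
  \<comment> \<open>The speed factor \<open>4 * (2 * t - 1)\<close> is at most 4 on an interval of
    length \<open>1/2\<close>, hence the crude contribution \<open>2 * L\<close> to the total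
    length.\<close>
  have bound: "?s t \<le> 4 * L" if t: "t \<in> {1/2..1}" for t
  proof (cases "t = 1/2")
    case True
    have "pdiff A \<eta> (1/2) 1 = 0"
      using glue(2)[OF half(1)] half(3) by simp
    then show ?thesis
      unfolding True using L0 by (simp add: tnorm_def bilinear_lzero[OF metric_inner(1)])
  next
    case False
    have t': "t \<in> {0..1}" "t \<in> S'"
      using t subsetD[OF S'01, of t] by auto
    have "pdiff A \<eta> t 1 = (4 * (2 * t - 1)) *\<^sub>R pdiff A p (k t) (w - u)"
      using glue(2)[OF t'(2)] pd2[OF t'(1)] t False by simp
    moreover have "\<eta> t = p (k t)"
      using t False by (simp add: \<eta>_def)
    ultimately have "?s t = (4 * (2 * t - 1)) * tnorm g (p (k t)) (pdiff A p (k t) (w - u))"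
      using t by (simp add: tnorm_scale)
    also have "\<dots> \<le> 4 * L"
      using t L[OF hk01(2)[of t]] L0 by (intro mult_mono) (auto simp: k_def)
    finally show ?thesis .
  qed
  have int: "?s integrable_on {0..1}" "?s integrable_on {1/2..1}"
    by (rule speed_integrable[OF glue(1) S'o], use S'01 in auto)+
  have "integral {1/2..1} ?s \<le> integral {1/2..1} (\<lambda>t::real. 4 * L)"
    using bound int(2) by (intro integral_le) auto
  then have "integral {1/2..1} ?s \<le> 2 * L"
    by simp
  moreover have "integral {0..1} ?s = integral {0..1/2} ?s + integral {1/2..1} ?s"
    by (rule Henstock_Kurzweil_Integration.integral_combine[symmetric, OF _ _ int(1)]) auto
  ultimately have "curve_length A g \<eta> \<le> l + 2 * L"
    using integral_unique[OF int1] by (simp add: curve_length_def)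
  moreover have "curve_length A g \<eta> \<in> leaf_lengths x (p w)"
  proof -
    have "\<gamma> 1 \<in> \<gamma> ` {0..1}"
      by simp
    then have pu: "p u \<in> W x"
      using \<gamma>(4,6) by auto
    have uV: "u \<in> V"
      using seg[of 0] by simp
    have "p ` V \<subseteq> W x"
      using param(5)[OF p uV] leaf_eq[OF pu] by simp
    then have "\<eta> ` {0..1} \<subseteq> W x"
      using \<gamma>(4) hk01(1) kV by (auto simp: \<eta>_def subset_iff)
    moreover have "\<eta> 0 = x" "\<eta> 1 = p w"
      using \<gamma>(5) by (simp_all add: \<eta>_def h_def k_def)
    ultimately show ?thesis
      unfolding leaf_lengths_def using S'o S'01 glue(1) by blast
  qed
  ultimately show thesis
    using that by blast
qed

text \<open>The coefficients of the metric pulled back by \<open>p\<close> are continuous, so near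
  \<open>u\<close> the sum of their absolute values is below its value at \<open>u\<close> plus 1;
  the square root of that bound serves as \<open>B\<close>.\<close>

lemma param_locally_lipschitz:
  assumes p: "(V, p) \<in> P" "u \<in> V"
  obtains r B where "0 < r" "0 \<le> B" "ball u r \<subseteq> V"
    "\<And>z v. z \<in> ball u r \<Longrightarrow> tnorm g (p z) (pdiff A p z v) \<le> B * norm v"
proof -
  let ?G = "\<lambda>z i j. g (p z) (pdiff A p z i) (pdiff A p z j)"
  let ?f = "\<lambda>z. \<Sum>i\<in>Basis. \<Sum>j\<in>Basis. \<bar>?G z i j\<bar>"
  have "continuous_on V (\<lambda>z. ?G z i j)" for i j
    using tensor_continuous_pdiff[OF metric_tensor param(2,1)[OF p(1)], of "\<lambda>n. if n = 0 then i else j"]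
    by simp
  then have "continuous_on V ?f"
    by (intro continuous_intros)
  then have "open (V \<inter> ?f -` {..<?f u + 1})"
    using param(1)[OF p(1)] by (intro open_Int_vimage) auto
  moreover have "u \<in> V \<inter> ?f -` {..<?f u + 1}"
    using p(2) by simp
  ultimately obtain r where r: "r > 0" "ball u r \<subseteq> V \<inter> ?f -` {..<?f u + 1}"
    by (meson open_contains_ball)
  have "tnorm g (p z) (pdiff A p z v) \<le> sqrt (?f u + 1) * norm v" if z: "z \<in> ball u r" for z v
  proof -
    have zV: "z \<in> V" "?f z \<le> ?f u + 1"
      using r(2) z by auto
    have lin: "linear (pdiff A p z)"
      using linear_pdiff[OF C1_into_mdifferentiable[OF param(2,1)[OF p(1)] zV(1)]] .
    have l1: "linear (\<lambda>a. ?G z a v)" for v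
      using metric_inner(1)[of "p z"] linear_compose[OF lin, of "\<lambda>a. g (p z) a (pdiff A p z v)"]
      by (simp add: bilinear_def o_def)
    have l2: "linear (\<lambda>b. ?G z i b)" for i
      using metric_inner(1)[of "p z"] linear_compose[OF lin, of "\<lambda>b. g (p z) (pdiff A p z i) b"]
      by (simp add: bilinear_def o_def)
    have "?G z v v = (\<Sum>i\<in>Basis. (v \<bullet> i) * ?G z i v)"
      using linear_sum_Basis[OF l1, of v v] by simp
    also have "\<dots> = (\<Sum>i\<in>Basis. \<Sum>j\<in>Basis. (v \<bullet> i) * ((v \<bullet> j) * ?G z i j))"
      by (intro sum.cong refl)
        (subst linear_sum_Basis[OF l2, where v = v], simp add: sum_distrib_left)
    also have "\<dots> \<le> (\<Sum>i\<in>Basis. \<Sum>j\<in>Basis. norm v * (norm v * \<bar>?G z i j\<bar>))"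
    proof (intro sum_mono)
      fix i j :: "real^'k::{finite,wellorder}" assume "i \<in> Basis" "j \<in> Basis"
      then have "\<bar>(v \<bullet> i) * ((v \<bullet> j) * ?G z i j)\<bar> \<le> norm v * (norm v * \<bar>?G z i j\<bar>)"
        unfolding abs_mult by (intro mult_mono) (auto simp: Basis_le_norm)
      then show "(v \<bullet> i) * ((v \<bullet> j) * ?G z i j) \<le> norm v * (norm v * \<bar>?G z i j\<bar>)"
        by linarith
    qed
    also have "\<dots> = (norm v)\<^sup>2 * ?f z"
      by (simp add: sum_distrib_left power2_eq_square mult.assoc)
    also have "\<dots> \<le> (norm v)\<^sup>2 * (?f u + 1)"
      using zV(2) by (intro mult_left_mono) auto
    finally have "sqrt (?G z v v) \<le> sqrt ((norm v)\<^sup>2 * (?f u + 1))"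
      by simp
    then show ?thesis
      by (simp add: tnorm_def real_sqrt_mult mult.commute)
  qed
  moreover have "0 \<le> ?f u + 1"
    by (intro add_nonneg_nonneg sum_nonneg) auto
  ultimately show thesis
    using that[of r "sqrt (?f u + 1)"] r by auto
qed

lemma extend_curve_ball:
  assumes "l \<in> leaf_lengths x (p v)" "(V, p) \<in> P" "ball u r \<subseteq> V" "v \<in> ball u r" "w \<in> ball u r"
    and B: "\<And>z v. z \<in> ball u r \<Longrightarrow> tnorm g (p z) (pdiff A p z v) \<le> B * norm v"
  obtains l' where "l' \<in> leaf_lengths x (p w)" "l' \<le> l + 2 * (B * norm (w - v))"
proof (rule extend_curve[OF assms(1,2), of w "B * norm (w - v)"])
  have *: "v + s *\<^sub>R (w - v) \<in> ball u r" if "s \<in> {0..1}" for s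
  proof -
    have "(1 - s) *\<^sub>R v + s *\<^sub>R w \<in> ball u r"
      using that assms(4,5) by (intro convexD[OF convex_ball]) auto
    then show ?thesis
      by (simp add: algebra_simps)
  qed
  show "v + s *\<^sub>R (w - v) \<in> V" if "s \<in> {0..1}" for s
    using *[OF that] assms(3) by blast
  show "tnorm g (p (v + s *\<^sub>R (w - v))) (pdiff A p (v + s *\<^sub>R (w - v)) (w - v)) \<le> B * norm (w - v)"
    if "s \<in> {0..1}" for s
    by (rule B[OF *[OF that]])
qed (use that in blast)

lemma leaf_lengths_refl: "leaf_lengths x x \<noteq> {}"
proof -
  have "C1_on S (\<lambda>t::real. c)" for S and c :: 'e
    by (rule C1_on_I[of _ _ "\<lambda>_ _. 0"]) auto
  then have "C1_into A UNIV (\<lambda>t::real. x)"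
    unfolding C1_into_iff by (auto simp: o_def)
  then have "curve_length A g (\<lambda>t. x) \<in> leaf_lengths x x"
    unfolding leaf_lengths_def using leaf_refl by blast
  then show ?thesis by blast
qed

text \<open>Leaves are given as path connected by merely continuous paths. Along such a path, being
  reachable from \<open>x\<close> by a \<open>C1\<close> curve is locally constant, since nearby
  points lie in one parametrized ball, where curves can be prolonged along segments. Connectedness
  of \<open>[0, 1]\<close> then transports it from \<open>x\<close> to \<open>y\<close>.\<close>

lemma leaf_lengths_nonempty:
  assumes y: "y \<in> W x"
  shows "leaf_lengths x y \<noteq> {}"
proof -
  obtain c where c: "path c" "path_image c \<subseteq> W x" "pathstart c = x" "pathfinish c = y"
    using leaf_path_connected[of x] y leaf_refl[of x] unfolding path_connected_def by blast
  have lw: "leafwise {0..1} c"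
    unfolding leafwise_def
  proof (intro conjI ballI)
    show "continuous_on {0..1} c"
      using c(1) by (simp add: path_def)
    fix u assume "u \<in> {0..1::real}"
    then have "c u \<in> W x"
      using c(2) by (auto simp: path_image_def)
    then show "c ` {0..1} \<subseteq> W (c u)"
      using leaf_eq c(2) by (simp add: path_image_def)
  qed
  have "(leaf_lengths x (c 0) \<noteq> {}) = (leaf_lengths x (c 1) \<noteq> {})"
  proof (rule connected_local_const[of "{0..1::real}" 0 1 "\<lambda>t. leaf_lengths x (c t) \<noteq> {}"])
    show "\<forall>a\<in>{0..1}. \<forall>\<^sub>F b in at a within {0..1}. (leaf_lengths x (c a) \<noteq> {}) = (leaf_lengths x (c b) \<noteq> {})"
    proof
      fix a :: real assume a: "a \<in> {0..1}"
      obtain V p u where p: "(V, p) \<in> P" "u \<in> V" "p u = c a"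
        by (rule param_cover)
      obtain r B where r: "0 < r" "0 \<le> B" "ball u r \<subseteq> V"
        "\<And>z v. z \<in> ball u r \<Longrightarrow> tnorm g (p z) (pdiff A p z v) \<le> B * norm v"
        by (rule param_locally_lipschitz[OF p(1,2)]) blast
      have eq: "leaf_lengths x (p w) \<noteq> {}" if vw: "v \<in> ball u r" "w \<in> ball u r" "leaf_lengths x (p v) \<noteq> {}" for v w
      proof -
        obtain l where "l \<in> leaf_lengths x (p v)"
          using vw(3) by blast
        then show ?thesis
          by (rule extend_curve_ball[OF _ p(1) r(3) vw(1,2) r(4)]) blast+
      qed
      have "leaf_open W (p ` ball u r)"
        by (rule param(6)[OF p(1) open_ball r(3)])
      moreover have "c a \<in> p ` ball u r"
        using p(3) r(1) by (metis centre_in_ball imageI)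
      ultimately obtain e where e: "e > 0" "c ` (ball a e \<inter> {0..1}) \<subseteq> p ` ball u r"
        by (rule leafwise_into_leaf_open[OF lw convex_closed_interval a])
      have "(leaf_lengths x (c a) \<noteq> {}) = (leaf_lengths x (c b) \<noteq> {})" if "b \<in> {0..1}" "dist b a < e" for b
      proof -
        have "c b \<in> p ` ball u r"
          using e(2) that by (auto simp: dist_commute)
        then obtain w where "w \<in> ball u r" "c b = p w" by blast
        then show ?thesis
          using eq[of u w] eq[of w u] p(3) r(1) by auto
      qed
      then show "\<forall>\<^sub>F b in at a within {0..1}. (leaf_lengths x (c a) \<noteq> {}) = (leaf_lengths x (c b) \<noteq> {})"
        using e(1) unfolding eventually_at by blast
    qed
  qed auto
  then show ?thesis
    using leaf_lengths_refl[of x] c(3,4) by (simp add: pathstart_def pathfinish_def)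
qed

text \<open>An infimum over the empty set would be meaningless; nonemptiness makes membership in the
  disk equivalent to a curve shorter than \<open>r\<close>.\<close>

lemma leaf_disk_iff: "y \<in> leaf_disk A g W x r \<longleftrightarrow> y \<in> W x \<and> (\<exists>l\<in>leaf_lengths x y. l < r)"
proof -
  have "leaf_dist A g W x y < r \<longleftrightarrow> (\<exists>l\<in>leaf_lengths x y. l < r)" if "y \<in> W x"
    unfolding leaf_dist_eq
    by (rule cInf_less_iff[OF leaf_lengths_nonempty[OF that]])
      (auto intro: bdd_belowI[of _ 0] leaf_lengths_nonneg)
  then show ?thesis
    unfolding leaf_disk_def by blast
qed

lemma leaf_disk_leaf_open: "leaf_open W (leaf_disk A g W x \<rho>)"
  unfolding leaf_open_def
proof
  fix y assume "y \<in> leaf_disk A g W x \<rho>"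
  then obtain l where y: "y \<in> W x" "l \<in> leaf_lengths x y" "l < \<rho>"
    unfolding leaf_disk_iff by blast
  obtain V p u where p: "(V, p) \<in> P" "u \<in> V" "p u = y"
    by (rule param_cover)
  obtain r B where r: "0 < r" "0 \<le> B" "ball u r \<subseteq> V"
    "\<And>z v. z \<in> ball u r \<Longrightarrow> tnorm g (p z) (pdiff A p z v) \<le> B * norm v"
    by (rule param_locally_lipschitz[OF p(1,2)]) blast
  \<comment> \<open>Prolonging a curve of length \<open>l\<close> into the ball of radius
    \<open>s\<close> costs at most \<open>2 * B * s\<close>. The summand 1 keeps the denominator
    positive when \<open>B = 0\<close> and makes the final inequality strict.\<close>
  define s where "s = min r ((\<rho> - l) / (2 * (B + 1)))"
  have s: "0 < s" "s \<le> r" "2 * (B + 1) * s \<le> \<rho> - l"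
  proof -
    show "0 < s" "s \<le> r"
      using r y by (simp_all add: s_def)
    have "s \<le> (\<rho> - l) / (2 * (B + 1))"
      by (simp add: s_def)
    then have "s * (2 * (B + 1)) \<le> \<rho> - l"
      using r(2) by (subst (asm) pos_le_divide_eq) auto
    then show "2 * (B + 1) * s \<le> \<rho> - l"
      by (simp only: mult.commute)
  qed
  have "p ` ball u s \<subseteq> leaf_disk A g W x \<rho>"
  proof (rule image_subsetI)
    fix w assume w: "w \<in> ball u s"
    then have wr: "w \<in> ball u r"
      using s by auto
    have "l \<in> leaf_lengths x (p u)"
      using y(2) p(3) by simp
    then obtain l' where l': "l' \<in> leaf_lengths x (p w)" "l' \<le> l + 2 * (B * norm (w - u))"
      by (rule extend_curve_ball[OF _ p(1) r(3) _ wr r(4)]) (use r(1) in auto)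
    have "2 * (B * norm (w - u)) \<le> 2 * (B * s)"
      using w r(2) by (intro mult_left_mono) (auto simp: dist_norm norm_minus_commute)
    also have "\<dots> < 2 * (B + 1) * s"
      using s(1) by (simp add: algebra_simps)
    finally have "l' < \<rho>"
      using l'(2) s(3) by linarith
    moreover have "p w \<in> W x"
      using param(5)[OF p(1,2)] leaf_eq[OF y(1)] p(3) subsetD[OF r(3) wr] by blast
    ultimately show "p w \<in> leaf_disk A g W x \<rho>"
      unfolding leaf_disk_iff using l'(1) by blast
  qed
  moreover have "leaf_open W (p ` ball u s)"
    using s r by (intro param(6)[OF p(1)]) auto
  moreover have "y \<in> p ` ball u s"
    using p(3) s(1) by (metis centre_in_ball imageI)
  ultimately show "\<exists>U. open U \<and> y \<in> U \<and> path_component_set (U \<inter> W y) y \<subseteq> leaf_disk A g W x \<rho>"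
    unfolding leaf_open_def by (meson subset_trans)
qed

lemma leaf_disk_compactly_covered:
  assumes "compact (UNIV :: 'm set)"
  shows "compactly_covered (leaf_disk A g W x r)"
proof -
  obtain S where S: "compactly_covered S"
    "\<And>\<gamma> a b. leaf_curve \<gamma> a b \<Longrightarrow> \<gamma> a = x \<Longrightarrow> arc_length \<gamma> a b < r \<Longrightarrow> \<gamma> b \<in> S"
    by (rule bounded_curves[OF assms]) blast
  have "leaf_disk A g W x r \<subseteq> S"
  proof
    fix y assume "y \<in> leaf_disk A g W x r"
    then obtain \<gamma> R where "open R" "{0..1} \<subseteq> R" "C1_into A R \<gamma>" "\<gamma> ` {0..1} \<subseteq> W x" "\<gamma> 0 = x"
      "\<gamma> 1 = y" "curve_length A g \<gamma> < r"
      unfolding leaf_disk_iff leaf_lengths_def by blast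
    then show "y \<in> S"
      using S(2)[of \<gamma> 0 1] unfolding leaf_curve_def arc_length_def curve_length_def by auto
  qed
  then show ?thesis
    by (rule compactly_covered_subset[OF S(1)])
qed

end

section \<open>Alternating forms and Gram determinants\<close>

definition row_multilinear :: "(real^'n^'n \<Rightarrow> real) \<Rightarrow> bool" where
  "row_multilinear \<psi> \<longleftrightarrow> (\<forall>M i. linear (\<lambda>x. \<psi> (\<chi> l. if l = i then x else M $ l)))"

definition row_alternating :: "(real^'n^'n \<Rightarrow> real) \<Rightarrow> bool" where
  "row_alternating \<psi> \<longleftrightarrow> (\<forall>M i j. i \<noteq> j \<and> M $ i = M $ j \<longrightarrow> \<psi> M = 0)"

lemma row_update_same: "(\<chi> l. if l = i then M $ i else M $ l) = M"
  by (simp add: vec_eq_iff)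

lemma row_alternating_swap:
  fixes \<psi> :: "real^'n^'n \<Rightarrow> real"
  assumes lin: "row_multilinear \<psi>" and alt: "row_alternating \<psi>" and "m \<noteq> n"
  shows "\<psi> (\<chi> l. M $ Transposition.transpose m n l) = - \<psi> M"
proof -
  define D where "D x y = \<psi> (\<chi> l. if l = m then x else if l = n then y else M $ l)" for x y
  have D1: "linear (\<lambda>x. D x y)" for y
    using lin[unfolded row_multilinear_def, rule_format, of m "\<chi> l. if l = n then y else M $ l"]
    by (simp add: D_def cong: if_cong)
  have "(\<chi> l. if l = n then y else (\<chi> l. if l = m then x else M $ l) $ l) =
      (\<chi> l. if l = m then x else if l = n then y else M $ l)" for x y
    using \<open>m \<noteq> n\<close> by (auto simp: vec_eq_iff)
  then have D2: "linear (\<lambda>y. D x y)" for x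
    using lin[unfolded row_multilinear_def, rule_format, of n "\<chi> l. if l = m then x else M $ l"]
    by (simp add: D_def)
  have D0: "D x x = 0" for x
  proof -
    have "(\<chi> l. if l = m then x else if l = n then x else M $ l) $ m =
        (\<chi> l. if l = m then x else if l = n then x else M $ l) $ n"
      by simp
    with alt \<open>m \<noteq> n\<close> show ?thesis
      unfolding row_alternating_def D_def by blast
  qed
  have "D (x + y) (x + y) = D x x + D x y + (D y x + D y y)" for x y
    by (simp add: linear_add[OF D1] linear_add[OF D2])
  from this[of "M $ m" "M $ n"] have "D (M $ n) (M $ m) = - D (M $ m) (M $ n)"
    by (simp add: D0)
  moreover have "D (M $ m) (M $ n) = \<psi> M"
    unfolding D_def by (rule arg_cong[of _ _ \<psi>]) (simp add: vec_eq_iff)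
  moreover have "D (M $ n) (M $ m) = \<psi> (\<chi> l. M $ Transposition.transpose m n l)"
    unfolding D_def by (rule arg_cong[of _ _ \<psi>]) (simp add: vec_eq_iff Transposition.transpose_def)
  ultimately show ?thesis by simp
qed

text \<open>The uniqueness of the determinant among alternating multilinear functions of the rows,
  by reduction to diagonal matrices through elementary operations.\<close>

lemma row_alternating_det:
  fixes M :: "real^'n^'n"
  assumes "row_multilinear \<psi>" "row_alternating \<psi>"
  shows "\<psi> M = det M * \<psi> (mat 1)"
proof -
  \<comment> \<open>The function must be general in the induction. Swapping two columns is not an
    operation on rows as arguments; it is absorbed into a new function \<open>\<psi>'\<close> that
    permutes the entries of every row first, and the hypothesis is applied to
    \<open>\<psi>'\<close>.\<close>
  have "\<forall>\<psi>. row_multilinear \<psi> \<and> row_alternating \<psi> \<longrightarrow> \<psi> M = det M * \<psi> (mat 1)"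
  proof (induction M rule: induct_matrix_row_operations)
    case (1 A i)
    have "\<psi> A = 0" if "row_multilinear \<psi>" for \<psi>
    proof -
      have "A $ i = 0"
        using 1 by (simp add: row_def vec_eq_iff)
      then have "\<psi> A = \<psi> (\<chi> l. if l = i then 0 else A $ l)"
        by (intro arg_cong[of _ _ \<psi>]) (simp add: vec_eq_iff)
      then show ?thesis
        using linear_0[OF that[unfolded row_multilinear_def, rule_format, of i A]] by simp
    qed
    then show ?case
      using det_zero_row[OF 1] by simp
  next
    case (2 A)
    show ?case
    proof (intro allI impI)
      fix \<psi> :: "real^'n^'n \<Rightarrow> real" assume \<psi>: "row_multilinear \<psi> \<and> row_alternating \<psi>"
      have "\<psi> (\<chi> i. if i \<in> S then A $ i else mat 1 $ i) = (\<Prod>i\<in>S. A $ i $ i) * \<psi> (mat 1)" for S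
      proof (induction S rule: infinite_finite_induct)
        case (insert s S)
        let ?B = "\<chi> i. if i \<in> S then A $ i else (mat 1 :: real^'n^'n) $ i"
        have eq: "A $ s = (A $ s $ s) *\<^sub>R (mat 1 :: real^'n^'n) $ s"
          using 2 by (auto simp: vec_eq_iff mat_def)
        have lin: "linear (\<lambda>x. \<psi> (\<chi> l. if l = s then x else ?B $ l))"
          using \<psi> unfolding row_multilinear_def by blast
        have "\<psi> (\<chi> i. if i \<in> insert s S then A $ i else mat 1 $ i) =
            \<psi> (\<chi> l. if l = s then A $ s else ?B $ l)"
          by (rule arg_cong[of _ _ \<psi>]) (simp add: vec_eq_iff)
        also have "\<dots> = A $ s $ s * \<psi> (\<chi> l. if l = s then mat 1 $ s else ?B $ l)"
          by (subst eq) (simp only: linear_cmul[OF lin] real_scaleR_def)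
        also have "(\<chi> l. if l = s then mat 1 $ s else ?B $ l) = ?B"
          using insert by (simp add: vec_eq_iff)
        finally show ?case
          using insert by simp
      qed simp_all
      from this[of UNIV] show "\<psi> A = det A * \<psi> (mat 1)"
        using 2 by (simp add: det_diagonal)
    qed
  next
    case (3 A m n)
    show ?case
    proof (intro allI impI)
      fix \<psi> :: "real^'n^'n \<Rightarrow> real" assume \<psi>: "row_multilinear \<psi> \<and> row_alternating \<psi>"
      let ?\<tau> = "Transposition.transpose m n"
      define s :: "real^'n \<Rightarrow> real^'n" where "s x = (\<chi> j. x $ ?\<tau> j)" for x
      define \<psi>' where "\<psi>' B = \<psi> (\<chi> i. s (B $ i))" for B
      have s: "linear s"
        by (rule linearI) (simp_all add: s_def vec_eq_iff)
      have "row_multilinear \<psi>'"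
        unfolding row_multilinear_def
      proof (intro allI)
        fix M i
        have "linear ((\<lambda>x. \<psi> (\<chi> l. if l = i then x else (\<chi> l. s (M $ l)) $ l)) \<circ> s)"
          using \<psi> unfolding row_multilinear_def by (intro linear_compose s) blast
        moreover have "(\<chi> l. if l = i then s x else (\<chi> l. s (M $ l)) $ l) =
            (\<chi> l. s ((\<chi> l. if l = i then x else M $ l) $ l))" for x
          by (simp add: vec_eq_iff)
        ultimately show "linear (\<lambda>x. \<psi>' (\<chi> l. if l = i then x else M $ l))"
          by (simp only: \<psi>'_def o_def)
      qed
      moreover have "row_alternating \<psi>'"
        unfolding row_alternating_def
      proof (intro allI impI)
        fix M :: "real^'n^'n" and i j assume "i \<noteq> j \<and> M $ i = M $ j"
        then have "i \<noteq> j \<and> (\<chi> i. s (M $ i)) $ i = (\<chi> i. s (M $ i)) $ j"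
          by simp
        then show "\<psi>' M = 0"
          using \<psi> unfolding row_alternating_def \<psi>'_def by blast
      qed
      ultimately have "\<psi>' A = det A * \<psi>' (mat 1)"
        using 3(1) by blast
      moreover have "\<psi>' (mat 1) = - \<psi> (mat 1)"
      proof -
        have "(\<chi> i. s (mat 1 $ i)) = (\<chi> l. (mat 1 :: real^'n^'n) $ ?\<tau> l)"
          by (auto simp: vec_eq_iff s_def mat_def Transposition.transpose_def)
        then show ?thesis
          unfolding \<psi>'_def using row_alternating_swap[of \<psi> m n "mat 1"] \<psi> 3(2) by simp
      qed
      moreover have "\<psi>' A = \<psi> (\<chi> i j. A $ i $ ?\<tau> j)"
        by (simp add: \<psi>'_def s_def)
      moreover have "det (\<chi> i j. A $ i $ ?\<tau> j) = - det A"
        using det_permute_columns[of ?\<tau> A] 3(2) by (simp add: sign_swap_id permutes_swap_id)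
      ultimately show "\<psi> (\<chi> i j. A $ i $ ?\<tau> j) = det (\<chi> i j. A $ i $ ?\<tau> j) * \<psi> (mat 1)"
        by simp
    qed
  next
    case (4 A m n c)
    let ?B = "\<chi> i. if i = m then row m A + c *\<^sub>R row n A else row i A"
    show ?case
    proof (intro allI impI)
      fix \<psi> :: "real^'n^'n \<Rightarrow> real" assume \<psi>: "row_multilinear \<psi> \<and> row_alternating \<psi>"
      have row: "row i A = A $ i" for i
        by (simp add: row_def vec_eq_iff)
      have lin: "linear (\<lambda>x. \<psi> (\<chi> l. if l = m then x else A $ l))"
        using \<psi> unfolding row_multilinear_def by blast
      have "\<psi> ?B = \<psi> (\<chi> l. if l = m then A $ m else A $ l) + c * \<psi> (\<chi> l. if l = m then A $ n else A $ l)"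
        by (simp only: row linear_add[OF lin] linear_cmul[OF lin] real_scaleR_def)
      moreover have "\<psi> (\<chi> l. if l = m then A $ n else A $ l) = 0"
      proof -
        have "(\<chi> l. if l = m then A $ n else A $ l) $ m = (\<chi> l. if l = m then A $ n else A $ l) $ n"
          using 4(2) by simp
        with \<psi> 4(2) show ?thesis
          unfolding row_alternating_def by blast
      qed
      ultimately have "\<psi> ?B = \<psi> A"
        by (simp add: row_update_same)
      moreover have "det ?B = det A"
        using det_row_operation[OF 4(2), of A c] by (simp only: scalar_mult_eq_scaleR)
      moreover have "\<psi> A = det A * \<psi> (mat 1)"
        using 4(1) \<psi> by blast
      ultimately show "\<psi> ?B = det ?B * \<psi> (mat 1)"
        by simp
    qed
  qed
  with assms show ?thesis by blast
qed

text \<open>Gram-Schmidt, by means of a maximal orthonormal set.\<close>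

lemma orthonormalizing_map:
  fixes G :: "'a::euclidean_space \<Rightarrow> 'a \<Rightarrow> real"
  assumes bil: "bilinear G" and sym: "\<And>v w. G v w = G w v" and pos: "\<And>v. v \<noteq> 0 \<Longrightarrow> 0 < G v v"
  obtains T :: "'a \<Rightarrow> 'a" where "linear T" "\<And>a b. G (T a) (T b) = a \<bullet> b"
proof -
  define ON where "ON S \<longleftrightarrow> finite S \<and> (\<forall>s\<in>S. \<forall>t\<in>S. G s t = (if s = t then 1 else 0))" for S
  have lin: "linear (\<lambda>x. G x y)" for y
    using bil by (simp add: bilinear_def)
  have sumG: "G (\<Sum>s\<in>S. u s *\<^sub>R s) t = u t" if "ON S" "t \<in> S" for S t u
  proof -
    have "G (\<Sum>s\<in>S. u s *\<^sub>R s) t = (\<Sum>s\<in>S. u s * G s t)"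
      using linear_sum[OF lin, of "\<lambda>s. u s *\<^sub>R s" S t] linear_cmul[OF lin] by simp
    also have "\<dots> = (\<Sum>s\<in>S. if s = t then u s else 0)"
      using that by (intro sum.cong) (auto simp: ON_def)
    finally show ?thesis
      using that by (simp add: ON_def)
  qed
  have ind: "independent S" if S: "ON S" for S
  proof -
    have "finite S" using S by (simp add: ON_def)
    moreover have "u t = 0" if "(\<Sum>s\<in>S. u s *\<^sub>R s) = 0" "t \<in> S" for u t
      using sumG[OF S that(2), of u] linear_0[OF lin] that(1) by simp
    ultimately show ?thesis
      using dependent_finite by blast
  qed
  \<comment> \<open>Orthonormal sets are independent, so the dimension bounds their size. A maximal
    one must span, since otherwise the normalized orthogonal part of a vector outside the span could
    be added.\<close>
  have "\<exists>S. ON S \<and> (\<forall>S'. ON S' \<longrightarrow> card S' \<le> card S)"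
  proof (rule ex_has_greatest_nat)
    show "\<forall>S. ON S \<longrightarrow> card S < Suc DIM('a)"
      using ind independent_bound by (auto simp: less_Suc_eq_le)
    show "ON {}"
      by (simp add: ON_def)
  qed
  then obtain S where S: "ON S" and max: "\<And>S'. ON S' \<Longrightarrow> card S' \<le> card S"
    by blast
  have fin: "finite S"
    using S by (simp add: ON_def)
  have "span S = UNIV"
  proof (rule ccontr)
    assume "span S \<noteq> UNIV"
    then obtain v where v: "v \<notin> span S" by blast
    define v' where "v' = v - (\<Sum>s\<in>S. G v s *\<^sub>R s)"
    have "(\<Sum>s\<in>S. G v s *\<^sub>R s) \<in> span S"
      by (intro span_sum span_scale span_base)
    then have "v' \<noteq> 0"
      using v by (auto simp: v'_def)
    then have gp: "G v' v' > 0"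
      by (rule pos)
    have orth: "G v' t = 0" if "t \<in> S" for t
      using linear_diff[OF lin, of v "\<Sum>s\<in>S. G v s *\<^sub>R s" t] sumG[OF S that, of "G v"]
      by (simp add: v'_def)
    define w where "w = (1 / sqrt (G v' v')) *\<^sub>R v'"
    have "G w w = (1 / sqrt (G v' v')) * ((1 / sqrt (G v' v')) * G v' v')"
      by (simp add: w_def bilinear_lmul[OF bil] bilinear_rmul[OF bil])
    then have ww: "G w w = 1"
      using gp by simp
    have wt: "G w t = 0" if "t \<in> S" for t
      using orth[OF that] by (simp add: w_def bilinear_lmul[OF bil])
    have wS: "w \<notin> S"
      using ww wt by fastforce
    have "ON (insert w S)"
      unfolding ON_def
    proof (intro conjI ballI)
      fix s t assume "s \<in> insert w S" "t \<in> insert w S"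
      then show "G s t = (if s = t then 1 else 0)"
        using S ww wt wS sym[of s t] unfolding ON_def by auto
    qed (use fin in simp)
    from max[OF this] show False
      using wS fin by simp
  qed
  then have "card S = DIM('a)"
    using dim_eq_card_independent[OF ind[OF S]] dim_span[of S] by simp
  then obtain \<beta> where \<beta>: "bij_betw \<beta> (Basis :: 'a set) S"
    using finite_same_card_bij[OF finite_Basis fin] by metis
  define T where "T v = (\<Sum>b\<in>Basis. (v \<bullet> b) *\<^sub>R \<beta> b)" for v
  have "linear T"
    unfolding T_def by (rule linearI)
      (simp_all add: inner_add_left scaleR_add_left sum.distrib scaleR_sum_right)
  moreover have "G (T x) (T y) = x \<bullet> y" for x y
  proof -
    have "G (\<beta> b) (T y) = y \<bullet> b" if b: "b \<in> Basis" for b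
    proof -
      have "T y = (\<Sum>s\<in>S. (y \<bullet> inv_into Basis \<beta> s) *\<^sub>R s)"
      proof -
        have "(\<Sum>s\<in>S. (y \<bullet> inv_into Basis \<beta> s) *\<^sub>R s) =
            (\<Sum>b\<in>Basis. (y \<bullet> inv_into Basis \<beta> (\<beta> b)) *\<^sub>R \<beta> b)"
          by (rule sum.reindex_bij_betw[OF \<beta>, symmetric])
        then show ?thesis
          unfolding T_def by (simp add: bij_betw_inv_into_left[OF \<beta>])
      qed
      then have "G (T y) (\<beta> b) = y \<bullet> inv_into Basis \<beta> (\<beta> b)"
        using sumG[OF S, of "\<beta> b"] \<beta> b by (simp add: bij_betwE)
      then show ?thesis
        using bij_betw_inv_into_left[OF \<beta> b] sym by metis
    qed
    moreover have "G (T x) (T y) = (\<Sum>b\<in>Basis. (x \<bullet> b) * G (\<beta> b) (T y))"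
      using linear_sum[OF lin, of "\<lambda>b. (x \<bullet> b) *\<^sub>R \<beta> b" Basis "T y"] linear_cmul[OF lin, of _ _ "T y"]
      by (simp add: T_def[of x])
    ultimately show ?thesis
      by (simp add: euclidean_inner[of x y])
  qed
  ultimately show thesis by (rule that)
qed

definition gram_det :: "('e \<Rightarrow> 'e \<Rightarrow> real) \<Rightarrow> (real^'k \<Rightarrow> 'e) \<Rightarrow> real" where
  "gram_det G L = det (\<chi> i j. G (L (axis i 1)) (L (axis j 1)))"

text \<open>Under a change of basis with matrix \<open>M\<close> the Gram matrix becomes
  \<open>transpose M ** Gr ** M\<close>.\<close>

lemma gram_det_compose:
  fixes L :: "real^'k \<Rightarrow> 'e::euclidean_space"
  assumes bil: "bilinear G" and L: "linear L" and T: "linear T"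
  shows "gram_det G (L \<circ> T) = (det (matrix T))\<^sup>2 * gram_det G L"
proof -
  let ?M = "matrix T"
  let ?Gr = "\<chi> i j. G (L (axis i 1)) (L (axis j 1))"
  have T_axis: "T (axis i 1) = (\<Sum>a\<in>UNIV. (?M $ a $ i) *\<^sub>R axis a 1)" for i
    by (subst basis_expansion[symmetric, of "T (axis i 1)"])
      (simp add: matrix_def scalar_mult_eq_scaleR)
  have l1: "linear (\<lambda>x. G (L x) y)" for y
    using bil linear_compose[OF L, of "\<lambda>x. G x y"] by (simp add: bilinear_def o_def)
  have l2: "linear (\<lambda>x. G y (L x))" for y
    using bil linear_compose[OF L, of "\<lambda>x. G y x"] by (simp add: bilinear_def o_def)
  have "G (L (T (axis i 1))) (L (T (axis j 1))) =
      (\<Sum>b\<in>UNIV. (\<Sum>a\<in>UNIV. ?M $ a $ i * G (L (axis a 1)) (L (axis b 1))) * ?M $ b $ j)" for i j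
  proof -
    have "G (L (T (axis i 1))) (L (T (axis j 1))) =
        (\<Sum>b\<in>UNIV. ?M $ b $ j * G (L (T (axis i 1))) (L (axis b 1)))"
      by (subst T_axis[of j]) (simp add: linear_sum[OF l2] linear_cmul[OF l2])
    also have "\<dots> = (\<Sum>b\<in>UNIV. ?M $ b $ j * (\<Sum>a\<in>UNIV. ?M $ a $ i * G (L (axis a 1)) (L (axis b 1))))"
      by (subst T_axis[of i]) (simp add: linear_sum[OF l1] linear_cmul[OF l1])
    finally show ?thesis
      by (simp add: mult.commute)
  qed
  then have "(\<chi> i j. G ((L \<circ> T) (axis i 1)) ((L \<circ> T) (axis j 1))) = transpose ?M ** ?Gr ** ?M"
    by (simp add: vec_eq_iff matrix_matrix_mult_def transpose_def)
  then show ?thesis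
    by (simp add: gram_det_def det_mul det_transpose power2_eq_square)
qed

lemma std_frame_index:
  "bij_betw (\<lambda>i. sorted_list_of_set (UNIV :: 'k::{finite,wellorder} set) ! i) {..<CARD('k)} UNIV"
  using bij_betw_nth[of "sorted_list_of_set (UNIV :: 'k set)" "{..<CARD('k)}" UNIV] by simp

section \<open>Forms compared with Gram determinants\<close>

context riemannian_atlas begin

text \<open>As a function of the matrix whose rows are fed into \<open>L\<close>, the form is
  multilinear and alternating, hence a multiple of the determinant. The transposed matrix of
  \<open>T\<close> has the images of the standard basis as rows. The map \<open>ix\<close>
  translates argument positions into indices of type \<open>'k\<close>.\<close>

lemma diff_form_linear_image:
  fixes L :: "real^'k::{finite,wellorder} \<Rightarrow> 'e"
  assumes \<omega>: "diff_form A CARD('k) \<omega>" and L: "linear L" and T: "linear T"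
  shows "\<omega> y (\<lambda>i. L (T (std_frame i))) = det (matrix T) * \<omega> y (\<lambda>i. L (std_frame i))"
proof -
  let ?k = "CARD('k)"
  define ix where "ix i = sorted_list_of_set (UNIV :: 'k set) ! i" for i
  have ix: "bij_betw ix {..<?k} UNIV"
    unfolding ix_def by (rule std_frame_index)
  have ix_inj: "ix i = ix j \<longleftrightarrow> i = j" if "i < ?k" "j < ?k" for i j
    using ix that by (auto simp: bij_betw_def inj_on_eq_iff)
  have ix_surj: "\<exists>i<?k. ix i = r" for r
    using bij_betw_imp_surj_on[OF ix] by (metis UNIV_I imageE lessThan_iff)
  define \<psi> where "\<psi> M = \<omega> y (\<lambda>i. L (M $ ix i))" for M :: "((real, 'k) vec, 'k) vec"
  have "row_multilinear \<psi>"
    unfolding row_multilinear_def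
  proof (intro allI)
    fix M :: "((real, 'k) vec, 'k) vec" and r
    obtain n where n: "n < ?k" "ix n = r"
      using ix_surj by blast
    have "\<psi> (\<chi> l. if l = r then x else M $ l) = \<omega> y ((\<lambda>i. L (M $ ix i))(n := L x))" for x
      unfolding \<psi>_def using n ix_inj by (intro tensor_cong[OF diff_form_tensor[OF \<omega>]]) auto
    then show "linear (\<lambda>x. \<psi> (\<chi> l. if l = r then x else M $ l))"
      using linear_compose[OF L tensor_linear[OF diff_form_tensor[OF \<omega>] n(1)]] by (simp add: o_def)
  qed
  moreover have "row_alternating \<psi>"
    unfolding row_alternating_def
  proof (intro allI impI)
    fix M :: "((real, 'k) vec, 'k) vec" and r s assume rs: "r \<noteq> s \<and> M $ r = M $ s"
    obtain i j where ij: "i < ?k" "ix i = r" "j < ?k" "ix j = s"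
      using ix_surj by meson
    have alt: "\<omega> y v = 0" if "i < l" "l < ?k" "v i = v l" for v i l
      using \<omega> that unfolding diff_form_def by blast
    consider "i < j" | "j < i"
      using rs ij by (metis linorder_neqE_nat)
    then show "\<psi> M = 0"
      unfolding \<psi>_def by cases (use ij rs in \<open>auto intro: alt\<close>)
  qed
  ultimately have "\<psi> (Finite_Cartesian_Product.transpose (matrix T)) = det (Finite_Cartesian_Product.transpose (matrix T)) * \<psi> (mat 1)"
    by (rule row_alternating_det)
  moreover have "\<psi> (mat 1) = \<omega> y (\<lambda>i. L (std_frame i))"
  proof -
    have "mat 1 $ ix i = (std_frame i :: real^'k::_)" for i
      by (simp add: std_frame_def ix_def vec_eq_iff mat_def axis_def)
    then show ?thesis by (simp add: \<psi>_def)
  qed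
  moreover have "Finite_Cartesian_Product.transpose (matrix T) $ ix i = T (std_frame i)" for i
    by (simp add: std_frame_def ix_def vec_eq_iff transpose_def matrix_def)
  ultimately show ?thesis
    by (simp add: \<psi>_def det_transpose)
qed

text \<open>Orthonormalizing the metric pulled back by \<open>L\<close> makes the Gram matrix of
  \<open>L \<circ> T\<close> the identity; the last equation is its determinant.\<close>

lemma orthonormal_frame:
  fixes L :: "real^'k::{finite,wellorder} \<Rightarrow> 'e"
  assumes L: "linear L" "inj L"
  obtains T :: "real^'k::_ \<Rightarrow> real^'k::_" where "linear T" "\<And>i. tnorm g y (L (T (std_frame i))) = 1"
    "(det (matrix T))\<^sup>2 * gram_det (g y) L = 1"
proof -
  let ?G = "\<lambda>a b. g y (L a) (L b)"
  have "bilinear ?G"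
    using metric_inner(1)[of y] linear_compose[OF L(1), of "\<lambda>a. g y a w" for w]
      linear_compose[OF L(1), of "\<lambda>a. g y w a" for w] by (simp add: bilinear_def o_def)
  moreover have "0 < ?G v v" if "v \<noteq> 0" for v
    using linear_injective_0[OF L(1)] L(2) that by (intro metric_inner(3)) blast
  ultimately obtain T :: "real^'k::_ \<Rightarrow> real^'k::_" where T: "linear T" "\<And>a b. ?G (T a) (T b) = a \<bullet> b"
    using orthonormalizing_map[of ?G] metric_inner(2)[of y] by blast
  have "gram_det (g y) (L \<circ> T) = det (mat 1 :: ((real, 'k) vec, 'k) vec)"
    unfolding gram_det_def
    by (rule arg_cong[of _ _ det]) (simp add: vec_eq_iff T(2) mat_def inner_axis_axis)
  then have "(det (matrix T))\<^sup>2 * gram_det (g y) L = 1"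
    using gram_det_compose[OF metric_inner(1)[of y] L(1) T(1)] by simp
  moreover have "tnorm g y (L (T (std_frame i))) = 1" for i
    by (simp add: tnorm_def T(2) std_frame_def inner_axis_axis)
  ultimately show thesis
    using that T(1) by blast
qed

lemma gram_det_pos:
  fixes L :: "real^'k::{finite,wellorder} \<Rightarrow> 'e"
  assumes "linear L" "inj L"
  shows "0 < gram_det (g y) L"
proof -
  obtain T :: "real^'k::_ \<Rightarrow> real^'k::_" where "(det (matrix T))\<^sup>2 * gram_det (g y) L = 1"
    by (rule orthonormal_frame[OF assms, of y])
  then show ?thesis
    by (metis zero_less_mult_pos zero_less_one zero_less_power2 mult_zero_left zero_neq_one power_zero_numeral)
qed

text \<open>On an orthonormal frame the form is at most \<open>M\<close> and the Gram determinant is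
  1. A change of frame by \<open>T\<close> multiplies the form by the determinant of
  \<open>T\<close> and the square root of the Gram determinant by its absolute value, so the
  inequality passes to every frame.\<close>

lemma form_le_gram_det:
  fixes L :: "real^'k::{finite,wellorder} \<Rightarrow> 'e"
  assumes \<omega>: "diff_form A CARD('k) \<omega>" "form_bound CARD('k) \<omega> M" and L: "linear L" "inj L"
  shows "\<bar>\<omega> y (\<lambda>i. L (std_frame i))\<bar> \<le> M * sqrt (gram_det (g y) L)"
proof -
  obtain T :: "real^'k::_ \<Rightarrow> real^'k::_" where T: "linear T" "\<And>i. tnorm g y (L (T (std_frame i))) = 1"
    "(det (matrix T))\<^sup>2 * gram_det (g y) L = 1"
    by (rule orthonormal_frame[OF L, of y]) blast
  have "\<bar>\<omega> y (\<lambda>i. L (T (std_frame i)))\<bar> \<le> M"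
    using \<omega>(2) T(2) unfolding form_bound_def by (metis order_refl)
  then have le: "\<bar>det (matrix T)\<bar> * \<bar>\<omega> y (\<lambda>i. L (std_frame i))\<bar> \<le> M"
    by (simp add: diff_form_linear_image[OF \<omega>(1) L(1) T(1)] abs_mult)
  have "\<bar>det (matrix T)\<bar> * sqrt (gram_det (g y) L) = 1"
    using arg_cong[OF T(3), of sqrt] by (simp add: real_sqrt_mult)
  then have "\<bar>\<omega> y (\<lambda>i. L (std_frame i))\<bar> =
      (\<bar>det (matrix T)\<bar> * \<bar>\<omega> y (\<lambda>i. L (std_frame i))\<bar>) * sqrt (gram_det (g y) L)"
    by (simp add: mult_ac)
  also have "\<dots> \<le> M * sqrt (gram_det (g y) L)"
    using le gram_det_pos[OF L, of y] by (intro mult_right_mono) auto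
  finally show ?thesis .
qed

end

section \<open>Integration over pieces of leaves\<close>

lemma set_integral_change_of_variables:
  fixes h :: "real^'m::{finite,wellorder} \<Rightarrow> real^'m::_" and k :: "real^'m::_ \<Rightarrow> real"
  assumes E: "E \<in> sets borel" and h: "\<And>u. u \<in> E \<Longrightarrow> (h has_derivative H u) (at u)"
    and inj: "inj_on h E" and f: "\<And>u. u \<in> E \<Longrightarrow> f u = \<bar>det (matrix (H u))\<bar> * k (h u)"
    and intf: "set_integrable lborel E f" and intk: "set_integrable lborel (h ` E) k"
  shows "(LINT u:E|lborel. f u) = (LINT u:h ` E|lborel. k u)"
proof -
  \<comment> \<open>Functions with values in \<open>real^1\<close> match the vector valued form of
    \<open>integral_change_of_variables\<close>.\<close>
  let ?k = "\<lambda>x. vec (k x) :: real^1"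
  have "k absolutely_integrable_on h ` E"
    using intk unfolding set_integrable_def
    by (subst integrable_completion) (auto dest: borel_measurable_integrable)
  then have "?k absolutely_integrable_on h ` E"
    by (subst absolutely_integrable_on_1_iff) simp
  then have "integral (h ` E) ?k = integral E (\<lambda>x. \<bar>det (matrix (H x))\<bar> *\<^sub>R ?k (h x))"
    using E h inj by (intro integral_change_of_variables) (auto intro: has_derivative_at_withinI)
  then have "integral (h ` E) k = integral E (\<lambda>x. \<bar>det (matrix (H x))\<bar> * k (h x))"
    by (simp add: integral_on_1_eq)
  also have "\<dots> = integral E f"
    by (rule integral_cong) (simp add: f)
  finally show ?thesis
    using set_borel_integral_eq_integral(2)[OF intf] set_borel_integral_eq_integral(2)[OF intk] by simp
qed

lemma borel_vimage_open:
  fixes h :: "'a::topological_space \<Rightarrow> 'b::topological_space"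
  assumes "open D" "continuous_on D h" "C \<in> sets borel"
  shows "D \<inter> h -` C \<in> sets borel"
proof -
  have "h -` C \<inter> space (restrict_space borel D) \<in> sets (restrict_space borel D)"
    using borel_measurable_continuous_on_restrict[OF assms(2)] assms(3) by (rule measurable_sets)
  then show ?thesis
    using assms(1) by (subst (asm) sets_restrict_space_iff) (auto simp: space_restrict_space Int_commute)
qed

text \<open>A transition on the overlap of two parametrizations, stated for arbitrary maps so that
  it also relates parametrizations from different image atlases.\<close>

definition coordinate_change :: "'a::topological_space set \<Rightarrow> ('a \<Rightarrow> 'm) \<Rightarrow> 'b::topological_space set \<Rightarrow> ('b \<Rightarrow> 'm) \<Rightarrow> ('a \<Rightarrow> 'b) \<Rightarrow> bool" where
  "coordinate_change V p V' q h \<longleftrightarrow> open (V \<inter> p -` (q ` V')) \<and> continuous_on (V \<inter> p -` (q ` V')) h \<and>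
    (\<forall>u\<in>V \<inter> p -` (q ` V'). h u \<in> V' \<and> q (h u) = p u)"

text \<open>On the overlap, \<open>p u\<close> lies in the image of \<open>C\<close> exactly when
  \<open>h u \<in> C\<close>, by injectivity of \<open>q\<close>. This makes the set a preimage
  under a continuous map and avoids measurability of images.\<close>

lemma coordinate_change_borel:
  assumes h: "coordinate_change V p V' q h" and BC: "B \<in> sets borel" "C \<in> sets borel" "B \<subseteq> V" "C \<subseteq> V'"
    and q: "inj_on q V'"
  shows "B \<inter> p -` (q ` C) \<in> sets borel"
proof -
  let ?D = "V \<inter> p -` (q ` V')"
  have "B \<inter> p -` (q ` C) = B \<inter> (?D \<inter> h -` C)"
  proof (intro equalityI subsetI)
    fix u assume u: "u \<in> B \<inter> p -` (q ` C)"
    then obtain w where w: "w \<in> C" "p u = q w" by auto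
    then have D: "u \<in> ?D"
      using u BC by auto
    then have "h u = w"
      using h w BC(4) q unfolding coordinate_change_def by (metis inj_onD subsetD)
    then show "u \<in> B \<inter> (?D \<inter> h -` C)"
      using D u w(1) by simp
  next
    fix u assume u: "u \<in> B \<inter> (?D \<inter> h -` C)"
    then have "p u = q (h u)" "h u \<in> C"
      using h unfolding coordinate_change_def by auto
    then show "u \<in> B \<inter> p -` (q ` C)"
      using u by auto
  qed
  then show ?thesis
    using h BC borel_vimage_open[of ?D h C] unfolding coordinate_change_def by auto
qed

lemma set_integrable_subset_borel:
  fixes f :: "'a::euclidean_space \<Rightarrow> real"
  assumes "set_integrable lborel A f" "B \<in> sets borel" "B \<subseteq> A"
  shows "set_integrable lborel B f"
  by (rule set_integrable_subset[OF assms(1) _ assms(3)]) (simp only: sets_lborel assms(2))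

lemma image_subset_UN_eq:
  assumes "p ` B \<subseteq> (\<Union>j\<in>J. D j)"
  shows "B = (\<Union>j\<in>J. B \<inter> p -` D j)"
proof (intro equalityI subsetI)
  fix u assume u: "u \<in> B"
  then have "p u \<in> (\<Union>j\<in>J. D j)"
    using assms by blast
  then show "u \<in> (\<Union>j\<in>J. B \<inter> p -` D j)"
    using u by simp
qed simp

text \<open>Both sums are refined to the pieces common to the two decompositions, and on each of
  these the change of variables \<open>h\<close> identifies the two integrals. Different atlases are
  allowed, since the volume of an image is to be computed from transported parametrizations.\<close>

lemma has_leaf_integral_unique:
  fixes P1 P2 :: "('m, 'k::{finite,wellorder}) leaf_atlas"
  assumes inj: "\<And>V p. (V, p) \<in> P1 \<Longrightarrow> inj_on p V" "\<And>V p. (V, p) \<in> P2 \<Longrightarrow> inj_on p V"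
    and change: "\<And>V p V' q. (V, p) \<in> P1 \<Longrightarrow> (V', q) \<in> P2 \<Longrightarrow> \<exists>h H. coordinate_change V p V' q h \<and>
      (\<forall>u\<in>V \<inter> p -` (q ` V'). (h has_derivative H u) (at u) \<and> F p u = \<bar>det (matrix (H u))\<bar> * F q (h u))"
    and reverse: "\<And>V p V' q. (V, p) \<in> P1 \<Longrightarrow> (V', q) \<in> P2 \<Longrightarrow> \<exists>h. coordinate_change V' q V p h"
    and s: "has_leaf_integral P1 F S s" and t: "has_leaf_integral P2 F S t"
  shows "s = t"
proof -
  obtain N :: nat and V p B where B: "\<And>i. i < N \<Longrightarrow> (V i, p i) \<in> P1 \<and> B i \<in> sets borel \<and> B i \<subseteq> V i \<and>
               set_integrable lborel (B i) (F (p i))"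
    "disjoint_family_on (\<lambda>i. p i ` B i) {..<N}" "S = (\<Union>i<N. p i ` B i)"
    "s = (\<Sum>i<N. LINT u:B i|lborel. F (p i) u)"
    using s unfolding has_leaf_integral_def by (elim exE conjE) blast
  obtain M :: nat and V' q C where C: "\<And>j. j < M \<Longrightarrow> (V' j, q j) \<in> P2 \<and> C j \<in> sets borel \<and> C j \<subseteq> V' j \<and>
               set_integrable lborel (C j) (F (q j))"
    "disjoint_family_on (\<lambda>j. q j ` C j) {..<M}" "S = (\<Union>j<M. q j ` C j)"
    "t = (\<Sum>j<M. LINT u:C j|lborel. F (q j) u)"
    using t unfolding has_leaf_integral_def by (elim exE conjE) blast
  let ?E = "\<lambda>i j. B i \<inter> p i -` (q j ` C j)" and ?E' = "\<lambda>i j. C j \<inter> q j -` (p i ` B i)"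
  have E: "?E i j \<in> sets borel" "?E' i j \<in> sets borel"
    "(LINT u:?E i j|lborel. F (p i) u) = (LINT u:?E' i j|lborel. F (q j) u)"
    if i: "i < N" and j: "j < M" for i j
  proof -
    note Bi = B(1)[OF i] and Cj = C(1)[OF j]
    obtain h H where h: "coordinate_change (V i) (p i) (V' j) (q j) h"
      and H: "\<And>u. u \<in> V i \<inter> p i -` (q j ` V' j) \<Longrightarrow> (h has_derivative H u) (at u) \<and>
        F (p i) u = \<bar>det (matrix (H u))\<bar> * F (q j) (h u)"
      using change Bi Cj by meson
    obtain h' where h': "coordinate_change (V' j) (q j) (V i) (p i) h'"
      using reverse Bi Cj by meson
    have injp: "inj_on (p i) (V i)" and injq: "inj_on (q j) (V' j)"
      using inj Bi Cj by blast+
    show Eb: "?E i j \<in> sets borel"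
      using coordinate_change_borel[OF h _ _ _ _ injq] Bi Cj by blast
    show Eb': "?E' i j \<in> sets borel"
      using coordinate_change_borel[OF h' _ _ _ _ injp] Bi Cj by blast
    have D: "u \<in> V i \<inter> p i -` (q j ` V' j)" if "u \<in> ?E i j" for u
      using that Bi Cj by auto
    have hD: "h u \<in> V' j" "q j (h u) = p i u" if "u \<in> ?E i j" for u
      using h D[OF that] unfolding coordinate_change_def by blast+
    have him: "h ` ?E i j = ?E' i j"
    proof (intro equalityI subsetI)
      fix w assume "w \<in> h ` ?E i j"
      then obtain u where u: "u \<in> ?E i j" "w = h u" by blast
      then obtain w' where "w' \<in> C j" "p i u = q j w'" by auto
      then have "w = w'"
        using hD[OF u(1)] u(2) injq Cj by (metis inj_onD subsetD)
      then show "w \<in> ?E' i j"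
        using \<open>w' \<in> C j\<close> \<open>p i u = q j w'\<close> u(1) by (metis IntD1 IntI imageI vimageI)
    next
      fix w assume w: "w \<in> ?E' i j"
      then obtain u where u: "u \<in> B i" "q j w = p i u" by auto
      then have uE: "u \<in> ?E i j"
        using w by (metis IntD1 IntI imageI vimageI)
      have "w \<in> V' j"
        using w Cj by blast
      then have "h u = w"
        using hD[OF uE] u(2) injq by (metis inj_onD)
      then show "w \<in> h ` ?E i j"
        using uE by blast
    qed
    have injh: "inj_on h (?E i j)"
    proof (rule inj_onI)
      fix u v assume uv: "u \<in> ?E i j" "v \<in> ?E i j" "h u = h v"
      then have "p i u = p i v"
        using hD(2) by metis
      then show "u = v"
        using uv Bi injp by (metis IntD1 inj_onD subsetD)
    qed
    have "(LINT u:?E i j|lborel. F (p i) u) = (LINT u:h ` ?E i j|lborel. F (q j) u)"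
    proof (rule set_integral_change_of_variables[where h = h and H = H, OF Eb _ injh])
      show "(h has_derivative H u) (at u)" "F (p i) u = \<bar>det (matrix (H u))\<bar> * F (q j) (h u)"
        if "u \<in> ?E i j" for u
        using H[OF D[OF that]] by blast+
      show "set_integrable lborel (?E i j) (F (p i))"
        using set_integrable_subset_borel[OF _ Eb Int_lower1] Bi by blast
      show "set_integrable lborel (h ` ?E i j) (F (q j))"
        unfolding him using set_integrable_subset_borel[OF _ Eb' Int_lower1] Cj by blast
    qed
    then show "(LINT u:?E i j|lborel. F (p i) u) = (LINT u:?E' i j|lborel. F (q j) u)"
      by (simp only: him)
  qed
  have sB: "(LINT u:B i|lborel. F (p i) u) = (\<Sum>j<M. LINT u:?E i j|lborel. F (p i) u)" if i: "i < N" for i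
  proof -
    have "p i ` B i \<subseteq> (\<Union>j<M. q j ` C j)"
      using B(3) C(3) i by blast
    then have eq: "B i = (\<Union>j<M. ?E i j)"
      by (rule image_subset_UN_eq)
    have "(LINT u:(\<Union>j<M. ?E i j)|lborel. F (p i) u) = (\<Sum>j<M. LINT u:?E i j|lborel. F (p i) u)"
    proof (rule set_integral_finite_Union)
      show "disjoint_family_on (?E i) {..<M}"
        using C(2) unfolding disjoint_family_on_def by blast
      show "set_integrable lborel (?E i j) (F (p i))" if "j \<in> {..<M}" for j
        using set_integrable_subset_borel[OF _ E(1)[OF i] Int_lower1] B(1)[OF i] that by blast
    qed (use E(1)[OF i] in auto)
    then show ?thesis
      by (simp only: eq[symmetric])
  qed
  have tC: "(LINT u:C j|lborel. F (q j) u) = (\<Sum>i<N. LINT u:?E' i j|lborel. F (q j) u)" if j: "j < M" for j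
  proof -
    have "q j ` C j \<subseteq> (\<Union>i<N. p i ` B i)"
      using B(3) C(3) j by blast
    then have eq: "C j = (\<Union>i<N. ?E' i j)"
      by (rule image_subset_UN_eq)
    have "(LINT u:(\<Union>i<N. ?E' i j)|lborel. F (q j) u) = (\<Sum>i<N. LINT u:?E' i j|lborel. F (q j) u)"
    proof (rule set_integral_finite_Union)
      show "disjoint_family_on (\<lambda>i. ?E' i j) {..<N}"
        using B(2) unfolding disjoint_family_on_def by blast
      show "set_integrable lborel (?E' i j) (F (q j))" if "i \<in> {..<N}" for i
        using set_integrable_subset_borel[OF _ E(2)[OF _ j] Int_lower1] C(1)[OF j] that by blast
    qed (use E(2)[OF _ j] in auto)
    then show ?thesis
      by (simp only: eq[symmetric])
  qed
  have "s = (\<Sum>i<N. \<Sum>j<M. LINT u:?E i j|lborel. F (p i) u)"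
    unfolding B(4) by (intro sum.cong refl sB) simp
  also have "\<dots> = (\<Sum>i<N. \<Sum>j<M. LINT u:?E' i j|lborel. F (q j) u)"
    by (intro sum.cong refl E(3)) simp_all
  also have "\<dots> = (\<Sum>j<M. \<Sum>i<N. LINT u:?E' i j|lborel. F (q j) u)"
    by (rule sum.swap)
  also have "\<dots> = t"
    unfolding C(4) by (intro sum.cong refl tC[symmetric]) simp
  finally show ?thesis .
qed

section \<open>Volumes and form integrals of images under leaf maps\<close>

context foliated_manifold begin

lemma leaf_map_id: "leaf_map id"
  unfolding leaf_map_def C1_diffeomorphism_def invariant_foliation_def
  by (simp add: C1_map_id)

lemma leaf_map_compose:
  assumes "leaf_map F" "leaf_map G"
  shows "leaf_map (G \<circ> F)"
proof -
  have "bij (G \<circ> F)" "inv (G \<circ> F) = inv F \<circ> inv G"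
    using leaf_mapD(3)[OF assms(1)] leaf_mapD(3)[OF assms(2)] by (simp_all add: bij_comp o_inv_distrib)
  moreover have "C1_map A (G \<circ> F)" "C1_map A (inv F \<circ> inv G)"
    by (intro C1_map_compose leaf_mapD assms)+
  moreover have "(G \<circ> F) ` W x = W ((G \<circ> F) x)" for x
    by (simp only: image_comp[symmetric] leaf_mapD(4)[OF assms(1)] leaf_mapD(4)[OF assms(2)] comp_apply)
  ultimately show ?thesis
    unfolding leaf_map_def C1_diffeomorphism_def invariant_foliation_def by (simp only: simp_thms)
qed

lemma leaf_map_inv:
  assumes "leaf_map F"
  shows "leaf_map (inv F)"
proof -
  have "inv F ` W x = W (inv F x)" for x
  proof -
    have "F ` W (inv F x) = W x"
      using leaf_mapD(4)[OF assms, of "inv F x"] leaf_mapD(3)[OF assms]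
      by (simp add: bij_is_surj surj_f_inv_f)
    then have "inv F ` F ` W (inv F x) = inv F ` W x"
      by simp
    then show ?thesis
      using leaf_mapD(3)[OF assms] by (simp add: bij_is_inj image_comp)
  qed
  then show ?thesis
    using assms unfolding leaf_map_def C1_diffeomorphism_def invariant_foliation_def
    by (simp add: bij_imp_bij_inv inv_inv_eq)
qed

lemma leaf_map_funpow: "leaf_map F \<Longrightarrow> leaf_map (F ^^ n)"
proof (induction n)
  case 0
  then show ?case using leaf_map_id by (simp add: id_def)
next
  case (Suc n)
  then show ?case
    unfolding funpow.simps by (intro leaf_map_compose)
qed

lemma param_mdifferentiable:
  assumes "leaf_map G" "(V, p) \<in> P" "u \<in> V"
  shows "mdifferentiable (G \<circ> p) u" "pdiff A (G \<circ> p) u w = mdiff A G (p u) (pdiff A p u w)"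
  using mdiff_pdiff_C1[OF leaf_mapD(1)[OF assms(1)] C1_into_mdifferentiable[OF param(2,1)[OF assms(2)] assms(3)]]
  by simp_all

lemma param_immersion:
  assumes "leaf_map G" "(V, p) \<in> P" "u \<in> V"
  shows "linear (pdiff A (G \<circ> p) u)" "inj (pdiff A (G \<circ> p) u)"
proof -
  have "inj (mdiff A G (p u))"
  proof (rule inj_on_inverseI)
    have "inv G \<circ> G = id"
      using leaf_mapD(3)[OF assms(1)] by (simp add: bij_is_inj)
    then show "mdiff A (inv G) (G (p u)) (mdiff A G (p u) v) = v" for v
      using mdiff_compose[OF leaf_mapD(1,2)[OF assms(1)], of "p u" v] by (simp add: mdiff_id)
  qed
  then have "inj (mdiff A G (p u) \<circ> pdiff A p u)"
    by (rule inj_compose[OF _ param(4)[OF assms(2,3)]])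
  moreover have "pdiff A (G \<circ> p) u = mdiff A G (p u) \<circ> pdiff A p u"
    using param_mdifferentiable(2)[OF assms] by (simp add: fun_eq_iff)
  ultimately show "inj (pdiff A (G \<circ> p) u)"
    by (simp only:)
qed (rule linear_pdiff[OF param_mdifferentiable(1)[OF assms]])

text \<open>Passing from \<open>G \<circ> p\<close> to \<open>G' \<circ> q\<close> means taking leaf
  coordinates of the leafwise map \<open>inv G' \<circ> G \<circ> p\<close> with respect to
  \<open>q\<close>, to which the results on single parametrizations apply.\<close>

lemma param_change:
  assumes G: "leaf_map G" "leaf_map G'" and p: "(V, p) \<in> P" and q: "(V', q) \<in> P"
  defines "D \<equiv> V \<inter> (G \<circ> p) -` ((G' \<circ> q) ` V')" and "h \<equiv> inv_into V' q \<circ> (inv G' \<circ> G \<circ> p)"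
  shows "coordinate_change V (G \<circ> p) V' (G' \<circ> q) h"
    and "u \<in> D \<Longrightarrow> (h has_derivative frechet_derivative h (at u)) (at u)"
    and "u \<in> D \<Longrightarrow> pdiff A (G \<circ> p) u w = pdiff A (G' \<circ> q) (h u) (frechet_derivative h (at u) w)"
proof -
  let ?c = "inv G' \<circ> G \<circ> p"
  have K: "leaf_map (inv G' \<circ> G)"
    by (intro leaf_map_compose G leaf_map_inv)
  have c: "leafwise V ?c"
    by (rule leaf_map_leafwise[OF K param_leafwise[OF p]])
  have bij: "G' (inv G' x) = x" "inv G' (G' x) = x" for x
    using leaf_mapD(3)[OF G(2)] by (simp_all add: bij_is_surj surj_f_inv_f bij_is_inj)
  have D: "D = V \<inter> ?c -` (q ` V')"
    unfolding D_def using bij by (auto simp: image_iff) metis+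
  have hD: "h u \<in> V'" "q (h u) = ?c u" if "u \<in> D" for u
    using that unfolding D h_def by (auto simp: f_inv_into_f inv_into_into)
  show "coordinate_change V (G \<circ> p) V' (G' \<circ> q) h"
    unfolding coordinate_change_def D_def[symmetric]
  proof (intro conjI ballI)
    show "open D"
      unfolding D by (rule open_vimage_param[OF c param(1)[OF p] q])
    show "continuous_on D h"
      unfolding D h_def by (rule leaf_coordinates_continuous[OF c param(1)[OF p] q])
  qed (use hD in \<open>auto simp: bij\<close>)
  assume u: "u \<in> D"
  then have uV: "u \<in> V" "?c u \<in> q ` V'"
    unfolding D by auto
  note md = param_mdifferentiable(1)[OF K p uV(1)]
  show "(h has_derivative frechet_derivative h (at u)) (at u)"
    unfolding h_def by (rule leaf_coordinates_derivative(1)[OF c param(1)[OF p] q uV md])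
  have "pdiff A ?c u w = pdiff A q (h u) (frechet_derivative h (at u) w)"
    using leaf_coordinates_derivative(2)[OF c param(1)[OF p] q uV md] by (simp add: h_def)
  moreover have "G \<circ> p = G' \<circ> ?c"
    by (auto simp: bij)
  ultimately show "pdiff A (G \<circ> p) u w = pdiff A (G' \<circ> q) (h u) (frechet_derivative h (at u) w)"
    using mdiff_pdiff_C1(2)[OF leaf_mapD(1)[OF G(2)] md, of w] hD[OF u]
      param_mdifferentiable(2)[OF G(2) q hD(1)[OF u]] by simp
qed

definition vol_density :: "(real^'k::_ \<Rightarrow> 'm) \<Rightarrow> real^'k::_ \<Rightarrow> real" where
  "vol_density p u = sqrt (gram_det (g (p u)) (pdiff A p u))"

definition form_density :: "('m, 'e) form \<Rightarrow> (real^'k::_ \<Rightarrow> 'm) \<Rightarrow> real^'k::_ \<Rightarrow> real" where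
  "form_density \<omega> p u = \<omega> (p u) (\<lambda>i. pdiff A p u (std_frame i))"

lemma leaf_vol_eq: "leaf_vol A g P S = leaf_integral P vol_density S"
  by (simp add: leaf_vol_def vol_density_def[abs_def] gram_det_def)

lemma form_integral_eq: "form_integral A Q S \<omega> = leaf_integral Q (form_density \<omega>) S"
  by (simp add: form_integral_def form_density_def[abs_def])

lemma image_atlas_inj: "leaf_map G \<Longrightarrow> (V, p) \<in> image_atlas G P \<Longrightarrow> inj_on p V"
  unfolding image_atlas_def using leaf_mapD(3)[of G] param(3)
  by (auto intro!: comp_inj_on intro: inj_on_subset[OF bij_is_inj subset_UNIV])

lemma image_atlas_integral_unique:
  assumes G: "leaf_map G" "leaf_map G'"
    and F: "\<And>V p V' q h u. (V, p) \<in> P \<Longrightarrow> (V', q) \<in> P \<Longrightarrow> h = inv_into V' q \<circ> (inv G' \<circ> G \<circ> p) \<Longrightarrow>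
      u \<in> V \<Longrightarrow> G (p u) \<in> (G' \<circ> q) ` V' \<Longrightarrow> F (G \<circ> p) u = \<bar>det (matrix (frechet_derivative h (at u)))\<bar> * F (G' \<circ> q) (h u)"
    and s: "has_leaf_integral (image_atlas G P) F S s" and t: "has_leaf_integral (image_atlas G' P) F S t"
  shows "s = t"
proof (rule has_leaf_integral_unique[OF image_atlas_inj[OF G(1)] image_atlas_inj[OF G(2)] _ _ s t])
  fix V p0 V' q0 assume "(V, p0) \<in> image_atlas G P" "(V', q0) \<in> image_atlas G' P"
  then obtain p q where p: "(V, p) \<in> P" "p0 = G \<circ> p" and q: "(V', q) \<in> P" "q0 = G' \<circ> q"
    unfolding image_atlas_def by auto
  let ?h = "inv_into V' q \<circ> (inv G' \<circ> G \<circ> p)"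
  show "\<exists>h. coordinate_change V' q0 V p0 h"
    unfolding p q using param_change(1)[OF G(2,1) q(1) p(1)] by blast
  show "\<exists>h H. coordinate_change V p0 V' q0 h \<and> (\<forall>u\<in>V \<inter> p0 -` (q0 ` V').
      (h has_derivative H u) (at u) \<and> F p0 u = \<bar>det (matrix (H u))\<bar> * F q0 (h u))"
    unfolding p q
  proof (intro exI[of _ ?h] exI[of _ "\<lambda>u. frechet_derivative ?h (at u)"] conjI ballI)
    show "coordinate_change V (G \<circ> p) V' (G' \<circ> q) ?h"
      by (rule param_change(1)[OF G p(1) q(1)])
    fix u assume u: "u \<in> V \<inter> (G \<circ> p) -` ((G' \<circ> q) ` V')"
    then show "(?h has_derivative frechet_derivative ?h (at u)) (at u)"
      by (rule param_change(2)[OF G p(1) q(1)])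
    show "F (G \<circ> p) u = \<bar>det (matrix (frechet_derivative ?h (at u)))\<bar> * F (G' \<circ> q) (?h u)"
      by (rule F[OF p(1) q(1) refl]) (use u in auto)
  qed
qed

text \<open>The square root of a Gram determinant is multiplied by the absolute value of the
  Jacobian determinant. No sign enters, so two different image atlases may be compared.\<close>

lemma vol_integral_unique:
  assumes "leaf_map G" "leaf_map G'" "has_leaf_integral (image_atlas G P) vol_density S s"
    "has_leaf_integral (image_atlas G' P) vol_density S t"
  shows "s = t"
proof (rule image_atlas_integral_unique[OF assms(1,2) _ assms(3,4)])
  fix V p V' q h u assume p: "(V, p) \<in> P" and q: "(V', q) \<in> P"
    and h: "h = inv_into V' q \<circ> (inv G' \<circ> G \<circ> p)" and u: "u \<in> V" "G (p u) \<in> (G' \<circ> q) ` V'"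
  let ?H = "frechet_derivative h (at u)"
  have uD: "u \<in> V \<inter> (G \<circ> p) -` ((G' \<circ> q) ` V')"
    using u by simp
  have hu: "h u \<in> V'" "(G' \<circ> q) (h u) = (G \<circ> p) u"
    using param_change(1)[OF assms(1,2) p q] uD unfolding coordinate_change_def h by blast+
  have "linear ?H"
    using param_change(2)[OF assms(1,2) p q uD] unfolding h by (rule has_derivative_linear)
  moreover have "pdiff A (G \<circ> p) u = pdiff A (G' \<circ> q) (h u) \<circ> ?H"
    using param_change(3)[OF assms(1,2) p q uD] unfolding h by (auto simp: fun_eq_iff)
  ultimately show "vol_density (G \<circ> p) u = \<bar>det (matrix ?H)\<bar> * vol_density (G' \<circ> q) (h u)"
    using gram_det_compose[OF metric_inner(1) param_immersion(1)[OF assms(2) q hu(1)]] hu(2)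
    by (simp add: vol_density_def real_sqrt_mult)
qed

text \<open>A form changes by the determinant itself. Within one image atlas the map
  \<open>G\<close> cancels from the transitions, leaving those of \<open>P\<close>, whose
  determinants are positive by orientation.\<close>

lemma form_integral_unique:
  assumes "leaf_map G" "diff_form A CARD('k) \<omega>" "has_leaf_integral (image_atlas G P) (form_density \<omega>) S s"
    "has_leaf_integral (image_atlas G P) (form_density \<omega>) S t"
  shows "s = t"
proof (rule image_atlas_integral_unique[OF assms(1,1) _ assms(3,4)])
  fix V p V' q h u assume p: "(V, p) \<in> P" and q: "(V', q) \<in> P"
    and h: "h = inv_into V' q \<circ> (inv G \<circ> G \<circ> p)" and u: "u \<in> V" "G (p u) \<in> (G \<circ> q) ` V'"
  let ?H = "frechet_derivative h (at u)"
  have uD: "u \<in> V \<inter> (G \<circ> p) -` ((G \<circ> q) ` V')"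
    using u by simp
  have hu: "h u \<in> V'" "(G \<circ> q) (h u) = (G \<circ> p) u"
    using param_change(1)[OF assms(1,1) p q] uD unfolding coordinate_change_def h by blast+
  have inj: "inj G"
    using leaf_mapD(3)[OF assms(1)] by (rule bij_is_inj)
  have "h = inv_into V' q \<circ> p"
    using inj by (auto simp: h)
  moreover have "p u \<in> q ` V'"
    using u(2) inj by (auto dest: injD)
  ultimately have "0 < det (matrix ?H)"
    using param_transition_det[OF p q u(1)] by simp
  moreover have "linear ?H"
    using param_change(2)[OF assms(1,1) p q uD] unfolding h by (rule has_derivative_linear)
  moreover have "pdiff A (G \<circ> p) u = (\<lambda>w. pdiff A (G \<circ> q) (h u) (?H w))"
    using param_change(3)[OF assms(1,1) p q uD] unfolding h by (auto simp: fun_eq_iff)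
  ultimately show "form_density \<omega> (G \<circ> p) u = \<bar>det (matrix ?H)\<bar> * form_density \<omega> (G \<circ> q) (h u)"
    using diff_form_linear_image[OF assms(2) param_immersion(1)[OF assms(1) q hu(1)]] hu(2)
    by (simp add: form_density_def)
qed

text \<open>Pieces as in \<open>has_leaf_integral\<close>, but with integrability replaced by
  containment in a compact part of the parameter domain. Continuous densities of all iterates are
  then integrable over the same pieces.\<close>

definition decomposition ::
  "'m set \<Rightarrow> nat \<Rightarrow> (nat \<Rightarrow> (real^'k::_) set) \<Rightarrow> (nat \<Rightarrow> real^'k::_ \<Rightarrow> 'm) \<Rightarrow> (nat \<Rightarrow> (real^'k::_) set) \<Rightarrow> bool" where
  "decomposition S N V p B \<longleftrightarrow>
     (\<forall>i<N. (V i, p i) \<in> P \<and> B i \<in> sets borel \<and> (\<exists>C. compact C \<and> B i \<subseteq> C \<and> C \<subseteq> V i)) \<and>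
     disjoint_family_on (\<lambda>i. p i ` B i) {..<N} \<and> S = (\<Union>i<N. p i ` B i)"

lemma ex_decomposition:
  assumes S: "leaf_open W S" "compactly_covered S"
  obtains N V p B where "decomposition S N V p B"
proof -
  obtain \<C> where \<C>: "finite \<C>" "\<forall>(V, p, C)\<in>\<C>. (V, p) \<in> P \<and> compact C \<and> C \<subseteq> V" "S \<subseteq> (\<Union>(V, p, C)\<in>\<C>. p ` C)"
    using S(2) unfolding compactly_covered_def by (elim exE conjE)
  obtain l where l: "set l = \<C>"
    using finite_list[OF \<C>(1)] by blast
  define N V p C where "N = length l" and "V i = fst (l ! i)" and "p i = fst (snd (l ! i))"
    and "C i = snd (snd (l ! i))" for i
  have piece: "(V i, p i) \<in> P" "compact (C i)" "C i \<subseteq> V i" if "i < N" for i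
    using bspec[OF \<C>(2), of "l ! i"] that l nth_mem[of i l]
    by (auto simp: V_def p_def C_def N_def case_prod_beta)
  have cover: "S \<subseteq> (\<Union>i<N. p i ` C i)"
  proof
    fix x assume "x \<in> S"
    then obtain c where "c \<in> set l" "x \<in> fst (snd c) ` snd (snd c)"
      using \<C>(3) l by (auto simp: case_prod_beta)
    then show "x \<in> (\<Union>i<N. p i ` C i)"
      unfolding in_set_conv_nth by (auto simp: p_def C_def N_def)
  qed
  \<comment> \<open>Every point of \<open>S\<close> is assigned to the first piece of the list that
    contains it. The subtraction takes place in the parameter domains, where the sets are
    Borel.\<close>
  define B where "B i = C i \<inter> (V i \<inter> p i -` S) - (\<Union>j<i. C i \<inter> p i -` (p j ` C j))" for i
  have borel: "B i \<in> sets borel" if i: "i < N" for i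
  proof -
    have c: "C j \<in> sets borel" if "j < N" for j
      using piece(2)[OF that] by (rule borel_compact)
    have "V i \<inter> p i -` S \<in> sets borel"
      by (rule borel_open, rule leaf_open_vimage[OF param_leafwise[OF piece(1)[OF i]] param(1)[OF piece(1)[OF i]] S(1)])
    moreover have "C i \<inter> p i -` (p j ` C j) \<in> sets borel" if "j \<in> {..<i}" for j
    proof -
      have j: "j < N" using that i by simp
      have "coordinate_change (V i) (p i) (V j) (p j) (inv_into (V j) (p j) \<circ> (inv id \<circ> id \<circ> p i))"
        using param_change(1)[OF leaf_map_id leaf_map_id piece(1)[OF i] piece(1)[OF j]] by simp
      from coordinate_change_borel[OF this c[OF i] c[OF j] piece(3)[OF i] piece(3)[OF j] param(3)[OF piece(1)[OF j]]]
      show ?thesis .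
    qed
    then have "(\<Union>j<i. C i \<inter> p i -` (p j ` C j)) \<in> sets borel"
      by (intro sets.finite_UN) simp_all
    ultimately show ?thesis
      unfolding B_def using sets.Diff[OF sets.Int[OF c[OF i]]] by blast
  qed
  have "decomposition S N V p B"
    unfolding decomposition_def
  proof (intro conjI allI impI)
    fix i assume i: "i < N"
    show "(V i, p i) \<in> P" "B i \<in> sets borel"
      using piece(1)[OF i] borel[OF i] .
    show "\<exists>C. compact C \<and> B i \<subseteq> C \<and> C \<subseteq> V i"
      using piece(2,3)[OF i] by (intro exI[of _ "C i"]) (auto simp: B_def)
  next
    have "p i ` B i \<inter> p j ` B j = {}" if "i < j" for i j
    proof (rule equals0I)
      fix x assume "x \<in> p i ` B i \<inter> p j ` B j"
      then obtain u w where uw: "u \<in> B i" "w \<in> B j" "p j w = p i u"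
        by auto
      then have "p j w \<in> p i ` C i"
        by (auto simp: B_def)
      then show False
        using uw(2) that unfolding B_def by blast
    qed
    then show "disjoint_family_on (\<lambda>i. p i ` B i) {..<N}"
      unfolding disjoint_family_on_def by (metis Int_commute linorder_neqE_nat)
    show "S = (\<Union>i<N. p i ` B i)"
    proof (intro equalityI subsetI)
      fix x assume x: "x \<in> S"
      then have ex: "\<exists>i. i < N \<and> x \<in> p i ` C i"
        using subsetD[OF cover x] by blast
      define i where "i = (LEAST i. i < N \<and> x \<in> p i ` C i)"
      have i: "i < N" "x \<in> p i ` C i"
        using LeastI_ex[OF ex] by (simp_all add: i_def)
      have "x \<notin> p j ` C j" if "j < i" for j
        using not_less_Least[of j "\<lambda>i. i < N \<and> x \<in> p i ` C i"] that i(1) by (auto simp: i_def)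
      moreover obtain u where "u \<in> C i" "x = p i u"
        using i(2) by blast
      ultimately have "u \<in> B i"
        using x piece(3)[OF i(1)] unfolding B_def by auto
      then show "x \<in> (\<Union>i<N. p i ` B i)"
        using i(1) \<open>x = p i u\<close> by blast
    qed (auto simp: B_def)
  qed
  then show thesis using that by blast
qed

lemma set_integrable_within_compact:
  assumes "B \<in> sets borel" "compact C" "B \<subseteq> C" "C \<subseteq> V" "continuous_on V f"
  shows "set_integrable lborel B (f :: real^'k::_ \<Rightarrow> real)"
proof (rule set_integrable_subset)
  show "set_integrable lborel C f"
    unfolding set_integrable_def
    using borel_integrable_compact[OF assms(2) continuous_on_subset[OF assms(5,4)]]
    by (simp add: indicator_def if_distrib[of "\<lambda>x. x *\<^sub>R _"] cong: if_cong)
qed (use assms in auto)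

lemma density_continuous:
  assumes G: "leaf_map G" and p: "(V, p) \<in> P"
  shows "continuous_on V (vol_density (G \<circ> p))"
    and "diff_form A CARD('k) \<omega> \<Longrightarrow> continuous_on V (form_density \<omega> (G \<circ> p))"
proof -
  have C1: "C1_into A V (G \<circ> p)" and V: "open V"
    using C1_map_compose_into[OF leaf_mapD(1)[OF G] param(2)[OF p]] param(1)[OF p] by blast+
  have "continuous_on V (\<lambda>u. g ((G \<circ> p) u) (pdiff A (G \<circ> p) u v) (pdiff A (G \<circ> p) u w))" for v w
    using tensor_continuous_pdiff[OF metric_tensor C1 V, of "\<lambda>n. if n = 0 then v else w"] by simp
  then show "continuous_on V (vol_density (G \<circ> p))"
    unfolding vol_density_def[abs_def] gram_det_def det_def
    by (intro continuous_intros) simp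
  show "diff_form A CARD('k) \<omega> \<Longrightarrow> continuous_on V (form_density \<omega> (G \<circ> p))"
    unfolding form_density_def[abs_def]
    by (rule tensor_continuous_pdiff[OF diff_form_tensor C1 V])
qed

lemma decomposition_integrable:
  assumes "decomposition S N V p B" "leaf_map G" "i < N"
  shows "set_integrable lborel (B i) (vol_density (G \<circ> p i))"
    and "diff_form A CARD('k) \<omega> \<Longrightarrow> set_integrable lborel (B i) (form_density \<omega> (G \<circ> p i))"
proof -
  obtain C where C: "(V i, p i) \<in> P" "B i \<in> sets borel" "compact C" "B i \<subseteq> C" "C \<subseteq> V i"
    using assms(1,3) unfolding decomposition_def by blast
  show "set_integrable lborel (B i) (vol_density (G \<circ> p i))"
    by (rule set_integrable_within_compact[OF C(2-5) density_continuous(1)[OF assms(2) C(1)]])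
  show "diff_form A CARD('k) \<omega> \<Longrightarrow> set_integrable lborel (B i) (form_density \<omega> (G \<circ> p i))"
    by (rule set_integrable_within_compact[OF C(2-5) density_continuous(2)[OF assms(2) C(1)]])
qed

lemma decomposition_has_leaf_integral:
  assumes d: "decomposition S N V p B" and G: "leaf_map G"
    and int: "\<And>i. i < N \<Longrightarrow> set_integrable lborel (B i) (F (G \<circ> p i))"
  shows "has_leaf_integral (image_atlas G P) F (G ` S) (\<Sum>i<N. LINT u:B i|lborel. F (G \<circ> p i) u)"
  unfolding has_leaf_integral_def
proof (rule exI[of _ N], rule exI[of _ V], rule exI[of _ "\<lambda>i. G \<circ> p i"], rule exI[of _ B],
    intro conjI allI impI)
  have inj: "inj G"
    using leaf_mapD(3)[OF G] by (rule bij_is_inj)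
  show "disjoint_family_on (\<lambda>i. (G \<circ> p i) ` B i) {..<N}"
    unfolding disjoint_family_on_def
  proof (intro ballI impI)
    fix m n assume "m \<in> {..<N}" "n \<in> {..<N}" "m \<noteq> n"
    then have "p m ` B m \<inter> p n ` B n = {}"
      using d unfolding decomposition_def disjoint_family_on_def by blast
    then show "(G \<circ> p m) ` B m \<inter> (G \<circ> p n) ` B n = {}"
      by (simp only: image_comp[symmetric] image_Int[OF inj, symmetric] image_empty)
  qed
  show "G ` S = (\<Union>i<N. (G \<circ> p i) ` B i)"
    using d unfolding decomposition_def by auto
  fix i assume i: "i < N"
  then obtain C where C: "(V i, p i) \<in> P" "B i \<in> sets borel" "B i \<subseteq> C" "C \<subseteq> V i"
    using d unfolding decomposition_def by blast
  show "(V i, G \<circ> p i) \<in> image_atlas G P"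
    unfolding image_atlas_def using C(1) by (intro rev_image_eqI[of "(V i, p i)"]) simp_all
  show "B i \<in> sets borel" "B i \<subseteq> V i" "set_integrable lborel (B i) (F (G \<circ> p i))"
    using C int[OF i] by blast+
qed simp

lemma form_integral_decomposition:
  assumes "decomposition S N V p B" "leaf_map G" "diff_form A CARD('k) \<omega>"
  shows "form_integral A (image_atlas G P) (G ` S) \<omega> = (\<Sum>i<N. LINT u:B i|lborel. form_density \<omega> (G \<circ> p i) u)"
  unfolding form_integral_eq leaf_integral_def
proof (rule the_equality)
  show *: "has_leaf_integral (image_atlas G P) (form_density \<omega>) (G ` S)
      (\<Sum>i<N. LINT u:B i|lborel. form_density \<omega> (G \<circ> p i) u)"
    using assms decomposition_integrable(2) by (intro decomposition_has_leaf_integral) blast+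
  show "s = (\<Sum>i<N. LINT u:B i|lborel. form_density \<omega> (G \<circ> p i) u)"
    if "has_leaf_integral (image_atlas G P) (form_density \<omega>) (G ` S) s" for s
    using form_integral_unique[OF assms(2,3) that *] .
qed

text \<open>The volume is defined through \<open>P\<close>, to which the maps
  \<open>G \<circ> p i\<close> need not belong. A decomposition of the image set within
  \<open>P\<close> gives existence, and uniqueness across atlases identifies its value with the
  transported sum.\<close>

lemma leaf_vol_decomposition:
  assumes d: "decomposition S N V p B" and G: "leaf_map G" and S: "leaf_open W S" "compactly_covered S"
  shows "leaf_vol A g P (G ` S) = (\<Sum>i<N. LINT u:B i|lborel. vol_density (G \<circ> p i) u)"
proof -
  have P: "image_atlas id P = P"
    by (simp add: image_atlas_def)
  obtain N' V' p' B' where d': "decomposition (G ` S) N' V' p' B'"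
    using ex_decomposition[OF leaf_map_leaf_open[OF G S(1)] leaf_map_compactly_covered[OF G S(2)]] by blast
  obtain t where t: "has_leaf_integral (image_atlas id P) vol_density (G ` S) t"
    using decomposition_has_leaf_integral[OF d' leaf_map_id, of vol_density] decomposition_integrable(1)[OF d' leaf_map_id]
    by auto
  have "leaf_vol A g P (G ` S) = t"
    unfolding leaf_vol_eq leaf_integral_def
    using t vol_integral_unique[OF leaf_map_id leaf_map_id] unfolding P by (intro the_equality) blast+
  moreover have "has_leaf_integral (image_atlas G P) vol_density (G ` S)
      (\<Sum>i<N. LINT u:B i|lborel. vol_density (G \<circ> p i) u)"
    using d G decomposition_integrable(1) by (intro decomposition_has_leaf_integral) blast+
  ultimately show ?thesis
    using vol_integral_unique[OF leaf_map_id G t] by blast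
qed

lemma form_density_bound:
  assumes "leaf_map G" "(V, p) \<in> P" "u \<in> V" "diff_form A CARD('k) \<omega>" "form_bound CARD('k) \<omega> M"
  shows "\<bar>form_density \<omega> (G \<circ> p) u\<bar> \<le> M * vol_density (G \<circ> p) u"
  unfolding form_density_def vol_density_def
  by (rule form_le_gram_det[OF assms(4,5) param_immersion[OF assms(1-3)]])

lemma vol_density_nonneg:
  assumes "leaf_map G" "(V, p) \<in> P" "u \<in> V"
  shows "0 \<le> vol_density (G \<circ> p) u"
  unfolding vol_density_def using gram_det_pos[OF param_immersion[OF assms]] by (simp add: less_imp_le)

lemma form_density_pullback:
  assumes "leaf_map F" "leaf_map G" "(V, p) \<in> P" "u \<in> V"
  shows "form_density (pullback_form A F \<omega>) (G \<circ> p) u = form_density \<omega> ((F \<circ> G) \<circ> p) u"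
  using mdiff_pdiff_C1(2)[OF leaf_mapD(1)[OF assms(1)] param_mdifferentiable(1)[OF assms(2-4)]]
  by (simp add: form_density_def pullback_form_def o_assoc)

end

section \<open>Subsequential limits of currents\<close>

text \<open>Sequential weak compactness for a separable space: a diagonal sequence converges on
  \<open>Q\<close>, and the approximation, uniform in \<open>m\<close>, spreads the Cauchy property
  to all of \<open>X\<close>.\<close>

lemma common_convergent_subsequence:
  fixes c :: "nat \<Rightarrow> 'a \<Rightarrow> real"
  assumes bound: "\<And>\<omega>. \<omega> \<in> X \<Longrightarrow> \<exists>M. \<forall>m. \<bar>c m \<omega>\<bar> \<le> M"
    and Q: "countable Q" "Q \<subseteq> X"
    and dense: "\<And>\<omega> e. \<omega> \<in> X \<Longrightarrow> 0 < e \<Longrightarrow> \<exists>q\<in>Q. \<forall>m. \<bar>c m \<omega> - c m q\<bar> \<le> e"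
  obtains r :: "nat \<Rightarrow> nat" where "strict_mono r" "\<And>\<omega>. \<omega> \<in> X \<Longrightarrow> convergent (\<lambda>i. c (r i) \<omega>)"
proof (cases "Q = {}")
  case True
  then have "X = {}"
    using dense[of _ 1] by force
  then show thesis
    using that[of id] by (simp add: strict_mono_def)
next
  case False
  define q where "q = from_nat_into Q"
  have qX: "q n \<in> X" for n
    using from_nat_into[OF False, of n] Q(2) by (auto simp: q_def)
  define R where "R n s \<longleftrightarrow> convergent (\<lambda>i. c (s i) (q n))" for n and s :: "nat \<Rightarrow> nat"
  interpret subseqs R
  proof
    fix n and s :: "nat \<Rightarrow> nat" assume "strict_mono s"
    obtain M where "\<And>m. \<bar>c m (q n)\<bar> \<le> M"
      using bound[OF qX] by blast
    then have "bounded (range (\<lambda>i. c (s i) (q n)))"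
      by (auto simp: bounded_iff)
    then obtain l r where "strict_mono r" "((\<lambda>i. c (s i) (q n)) \<circ> r) \<longlonglongrightarrow> l"
      using bounded_imp_convergent_subsequence by blast
    then show "\<exists>r'. strict_mono r' \<and> R n (s \<circ> r')"
      unfolding R_def convergent_def by (auto simp: o_def)
  qed
  have conv: "convergent (\<lambda>i. c (diagseq i) (q n))" for n
  proof -
    \<comment> \<open>Only from index \<open>Suc n\<close> on is the diagonal sequence a subsequence
      of one along which the values at \<open>q n\<close> converge; the initial segment does not
      affect convergence.\<close>
    have "R n (diagseq \<circ> (+) (Suc n))"
    proof (rule diagseq_holds)
      fix r s n assume "strict_mono (r :: nat \<Rightarrow> nat)" "R n s"
      then show "R n (s \<circ> r)"
        unfolding R_def convergent_def
        using LIMSEQ_subseq_LIMSEQ[of "\<lambda>i. c (s i) (q n)" _ r] by (auto simp: o_def)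
    qed
    then have "convergent (\<lambda>i. c (diagseq (i + Suc n)) (q n))"
      unfolding R_def by (simp add: add.commute)
    then show ?thesis
      by (simp only: convergent_ignore_initial_segment[of "\<lambda>i. c (diagseq i) (q n)"])
  qed
  have "convergent (\<lambda>i. c (diagseq i) \<omega>)" if \<omega>: "\<omega> \<in> X" for \<omega>
    unfolding Cauchy_convergent_iff[symmetric]
  proof (rule metric_CauchyI)
    fix e :: real assume e: "0 < e"
    obtain p where p: "p \<in> Q" "\<And>m. \<bar>c m \<omega> - c m p\<bar> \<le> e / 4"
      using dense[OF \<omega>, of "e / 4"] e by auto
    obtain n where n: "q n = p"
      using from_nat_into_surj[OF Q(1) p(1)] by (auto simp: q_def)
    obtain N where N: "\<And>i j. i \<ge> N \<Longrightarrow> j \<ge> N \<Longrightarrow> dist (c (diagseq i) p) (c (diagseq j) p) < e / 4"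
      using metric_CauchyD[OF convergent_Cauchy[OF conv[of n]], of "e / 4"] e unfolding n by auto
    have "dist (c (diagseq i) \<omega>) (c (diagseq j) \<omega>) < e" if "i \<ge> N" "j \<ge> N" for i j
      using N[OF that] p(2)[of "diagseq i"] p(2)[of "diagseq j"] e unfolding dist_real_def by linarith
    then show "\<exists>M. \<forall>i\<ge>M. \<forall>j\<ge>M. dist (c (diagseq i) \<omega>) (c (diagseq j) \<omega>) < e"
      by blast
  qed
  then show thesis
    using that[OF subseq_diagseq] by blast
qed

text \<open>Stolz-Cesaro with denominators \<open>n\<close>: beyond \<open>N\<close> the increments
  contribute an error of at most \<open>e / 2\<close> each, and the constant \<open>K\<close>
  collecting the initial terms is eventually less than \<open>n * (e / 2)\<close>.\<close>

lemma cesaro_difference: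
  fixes x :: "nat \<Rightarrow> real"
  assumes "(\<lambda>n. x (Suc n) - x n) \<longlonglongrightarrow> l"
  shows "(\<lambda>n. x n / real n) \<longlonglongrightarrow> l"
proof (rule LIMSEQ_I)
  fix e :: real assume e: "0 < e"
  obtain N where N: "\<And>n. n \<ge> N \<Longrightarrow> \<bar>x (Suc n) - x n - l\<bar> < e / 2"
    using LIMSEQ_D[OF assms, of "e / 2"] e by (auto simp: real_norm_def)
  have step: "\<bar>x n - x N - real (n - N) * l\<bar> \<le> real (n - N) * (e / 2)" if "n \<ge> N" for n
    using that
  proof (induction n rule: dec_induct)
    case (step n)
    have "real (Suc n - N) = real (n - N) + 1"
      using step.hyps by (simp add: Suc_diff_le)
    then show ?case
      using step.IH N[OF step.hyps(1)] by (simp only: distrib_right)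
  qed simp
  define K where "K = \<bar>x N\<bar> + real N * \<bar>l\<bar>"
  obtain n0 :: nat where n0: "2 * K / e < real n0"
    using reals_Archimedean2 by blast
  have "norm (x n / real n - l) < e" if n: "n \<ge> max (Suc N) n0" for n
  proof -
    have nN: "n \<ge> N" "0 < real n"
      using n by auto
    have "real (n - N) = real n - real N"
      using nN by (simp add: of_nat_diff)
    then have s: "\<bar>x n - x N - (real n - real N) * l\<bar> \<le> (real n - real N) * (e / 2)"
      using step[OF nN(1)] by simp
    have "\<bar>real N * l\<bar> = real N * \<bar>l\<bar>"
      by (simp add: abs_mult)
    moreover have "(real n - real N) * (e / 2) \<le> real n * (e / 2)"
      using e by (intro mult_right_mono) auto
    moreover have "x n - real n * l = (x n - x N - (real n - real N) * l) + x N - real N * l"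
      by (simp add: algebra_simps)
    ultimately have "\<bar>x n - real n * l\<bar> \<le> real n * (e / 2) + K"
      using s unfolding K_def by linarith
    moreover have "K < real n * (e / 2)"
    proof -
      have "2 * K / e < real n"
        using n0 n by linarith
      then show ?thesis
        using e by (simp add: field_simps)
    qed
    ultimately have "\<bar>x n - real n * l\<bar> < real n * e"
      by (simp add: algebra_simps)
    moreover have "x n / real n - l = (x n - real n * l) / real n"
      using nN by (simp add: field_simps)
    ultimately show ?thesis
      using nN by (simp add: abs_divide pos_divide_less_eq mult.commute)
  qed
  then show "\<exists>no. \<forall>n\<ge>no. norm (x n / real n - l) < e"
    by blast
qed

section \<open>Separability of the space of continuous forms\<close>

context riemannian_atlas begin

lemma tensor_diff:
  assumes "tensor j \<omega>" "tensor j \<eta>"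
  shows "tensor j (\<lambda>x v. \<omega> x v - \<eta> x v)"
  unfolding tensor_def
proof (intro conjI allI impI ballI)
  fix x v w assume *: "\<forall>i<j. (v i :: 'e) = w i"
  then show "\<omega> x v - \<eta> x v = \<omega> x w - \<eta> x w"
    using tensor_cong[OF assms(1), of v w x] tensor_cong[OF assms(2), of v w x] by simp
next
  fix x v i assume "i < j"
  then show "linear (\<lambda>u. \<omega> x (v(i := u)) - \<eta> x (v(i := u)))"
    by (intro linear_compose_sub tensor_linear[OF assms(1)] tensor_linear[OF assms(2)])
next
  fix c v assume "c \<in> A"
  then show "continuous_on (fst c) (\<lambda>y. \<omega> y (\<lambda>i. coord_vec A c y (v i)) - \<eta> y (\<lambda>i. coord_vec A c y (v i)))"
    using assms unfolding tensor_def by (intro continuous_on_diff) auto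
qed

text \<open>A form is determined up to a small error by finitely many rational data: a finite cover of the
  manifold by basic open sets of finitely many charts, with approximate values of the coefficients
  of the form on each of them. Choosing one form for each possible set of data gives a countable
  dense set.\<close>

lemma countable_dense_forms:
  assumes "compact (UNIV :: 'm set)"
  obtains Q where "countable Q" "Q \<subseteq> {\<omega>. diff_form A j \<omega>}"
    "\<And>\<omega> e. diff_form A j \<omega> \<Longrightarrow> 0 < e \<Longrightarrow> \<exists>\<eta>\<in>Q. form_bound j (\<lambda>x v. \<omega> x v - \<eta> x v) e"
proof -
  let ?c = "chart_at A" and ?I = "{..<j} \<rightarrow>\<^sub>E (Basis::'e set)"
  have finI: "finite ?I"
    by (intro finite_PiE) auto
  have "\<forall>z. \<exists>X. open (fst X) \<and> z \<in> fst X \<and> fst X \<subseteq> fst (?c z) \<and> 0 < (snd X :: real) \<and>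
      (\<forall>y\<in>fst X. \<forall>v. norm v \<le> snd X * tnorm g y (coord_vec A (?c z) y v))"
  proof
    fix z
    obtain K \<rho> where K: "0 < K" "0 < \<rho>" "cball (snd (?c z) z) \<rho> \<subseteq> snd (?c z) ` fst (?c z)"
      "\<And>y v. y \<in> fst (?c z) \<Longrightarrow> snd (?c z) y \<in> cball (snd (?c z) z) \<rho> \<Longrightarrow>
        norm v \<le> K * tnorm g y (coord_vec A (?c z) y v)"
      by (rule chart_norm_le[of "?c z" z]) simp_all
    have "open (fst (?c z) \<inter> snd (?c z) -` ball (snd (?c z) z) \<rho>)"
      by (intro open_Int_vimage chart_continuous chart_homeomorphism) simp_all
    then show "\<exists>X. open (fst X) \<and> z \<in> fst X \<and> fst X \<subseteq> fst (?c z) \<and> 0 < (snd X :: real) \<and>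
      (\<forall>y\<in>fst X. \<forall>v. norm v \<le> snd X * tnorm g y (coord_vec A (?c z) y v))"
      using K by (intro exI[of _ "(fst (?c z) \<inter> snd (?c z) -` ball (snd (?c z) z) \<rho>, K)"]) simp
  qed
  from choice[OF this] obtain X where X: "\<forall>z. open (fst (X z)) \<and> z \<in> fst (X z) \<and> fst (X z) \<subseteq> fst (?c z) \<and>
      0 < (snd (X z) :: real) \<and> (\<forall>y\<in>fst (X z). \<forall>v. norm v \<le> snd (X z) * tnorm g y (coord_vec A (?c z) y v))" ..
  define O' where "O' z = fst (X z)" for z
  have O': "open (O' z)" "z \<in> O' z" "O' z \<subseteq> fst (?c z)" for z
    using X by (simp_all add: O'_def)
  obtain Z where Z: "finite Z" "UNIV \<subseteq> (\<Union>z\<in>Z. O' z)"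
    by (rule compact_nbhd_cover[OF assms, of O']) (use O' in auto)
  \<comment> \<open>A sum over the finite cover gives one constant valid in all of its
    charts.\<close>
  define K where "K = (\<Sum>z\<in>Z. snd (X z))"
  have K0: "0 \<le> K"
    unfolding K_def using X by (intro sum_nonneg) (simp add: less_imp_le)
  have K: "norm v \<le> K * tnorm g y (coord_vec A (?c z) y v)" if "z \<in> Z" "y \<in> O' z" for z y v
  proof -
    have "norm v \<le> snd (X z) * tnorm g y (coord_vec A (?c z) y v)"
      using X that(2) by (simp add: O'_def)
    also have "\<dots> \<le> K * tnorm g y (coord_vec A (?c z) y v)"
      unfolding K_def using X that(1) Z(1)
      by (intro mult_right_mono member_le_sum) (simp_all add: less_imp_le)
    finally show ?thesis .
  qed
  define co where "co z b \<omega> y = \<omega> y (\<lambda>i. coord_vec A (?c z) y (b i))" for z b and \<omega> :: "('m, 'e) form" and y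
  obtain \<B> :: "'e set set" where \<B>: "countable \<B>" "topological_basis \<B>"
    using ex_countable_basis by blast
  define cell where "cell z U = O' z \<inter> snd (?c z) -` U" for z and U :: "'e set"
  have cell_open: "open (cell z U)" if "open U" for z U
    unfolding cell_def using O' that continuous_on_subset[OF chart_continuous(1)]
    by (intro open_Int_vimage) auto
  define Data where "Data = {d. finite d \<and> d \<subseteq> Z \<times> \<B> \<times> (?I \<rightarrow>\<^sub>E (\<rat> :: real set))}"
  have cD: "countable Data"
    unfolding Data_def using Z(1) \<B>(1) finI
    by (intro countable_Collect_finite_subset countable_SIGMA countable_PiE countable_rat) (auto intro: countable_finite)
  define good where "good n d \<omega> \<longleftrightarrow> (\<forall>y. \<exists>(z, U, q)\<in>d. y \<in> cell z U) \<and>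
     (\<forall>(z, U, q)\<in>d. \<forall>y\<in>cell z U. \<forall>b\<in>?I. \<bar>co z b \<omega> y - q b\<bar> < 1 / real (Suc n))" for n d \<omega>
  \<comment> \<open>Two forms fitting the same data have coefficients within
    \<open>2 / real (Suc n)\<close> of each other at every point;
    \<open>tensor_bound_unit_frame\<close> supplies the factor in front.\<close>
  have close: "form_bound j (\<lambda>x v. \<omega> x v - \<eta> x v) ((real DIM('e) * K) ^ j * (2 / real (Suc n)))"
    if d: "d \<in> Data" and good: "good n d \<omega>" "good n d \<eta>" and form: "diff_form A j \<omega>" "diff_form A j \<eta>" for n d \<omega> \<eta>
    unfolding form_bound_def
  proof (intro allI impI)
    fix y and v :: "nat \<Rightarrow> 'e" assume v: "\<forall>i<j. tnorm g y (v i) \<le> 1"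
    obtain z U q where zUq: "(z, U, q) \<in> d" "y \<in> cell z U"
      using good(1) unfolding good_def by blast
    then have zZ: "z \<in> Z" "y \<in> O' z"
      using d by (auto simp: Data_def cell_def)
    show "\<bar>\<omega> y v - \<eta> y v\<bar> \<le> (real DIM('e) * K) ^ j * (2 / real (Suc n))"
    proof (rule tensor_bound_unit_frame[OF tensor_diff[OF form[THEN diff_form_tensor]] chart_at_in(1)[of z]])
      show "y \<in> fst (?c z)"
        using O'(3) zZ(2) by blast
      show "norm v \<le> K * tnorm g y (coord_vec A (?c z) y v)" for v
        by (rule K[OF zZ])
      fix b assume b: "b \<in> ?I"
      have "\<bar>co z b \<omega> y - q b\<bar> < 1 / real (Suc n)" "\<bar>co z b \<eta> y - q b\<bar> < 1 / real (Suc n)"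
        using good zUq b unfolding good_def by blast+
      then show "\<bar>\<omega> y (\<lambda>i. coord_vec A (?c z) y (b i)) - \<eta> y (\<lambda>i. coord_vec A (?c z) y (b i))\<bar> \<le> 2 / real (Suc n)"
        unfolding co_def by linarith
    qed (use v K0 in auto)
  qed
  have ex_good: "\<exists>d\<in>Data. good n d \<omega>" if \<omega>: "diff_form A j \<omega>" for n \<omega>
  proof -
    have "\<forall>y. \<exists>t. t \<in> Z \<times> \<B> \<times> (?I \<rightarrow>\<^sub>E \<rat>) \<and> y \<in> cell (fst t) (fst (snd t)) \<and>
        (\<forall>y'\<in>cell (fst t) (fst (snd t)). \<forall>b\<in>?I. \<bar>co (fst t) b \<omega> y' - snd (snd t) b\<bar> < 1 / real (Suc n))"
    proof
      fix y
      obtain z where z: "z \<in> Z" "y \<in> O' z"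
        using Z(2) by blast
      have "\<forall>b. \<exists>q\<in>\<rat>. \<bar>co z b \<omega> y - q\<bar> < 1 / real (Suc n)"
      proof
        fix b
        obtain q where "q \<in> \<rat>" "co z b \<omega> y < q" "q < co z b \<omega> y + 1 / real (Suc n)"
          using Rats_dense_in_real[of "co z b \<omega> y" "co z b \<omega> y + 1 / real (Suc n)"] by auto
        then show "\<exists>q\<in>\<rat>. \<bar>co z b \<omega> y - q\<bar> < 1 / real (Suc n)"
          by (intro bexI[of _ q]) auto
      qed
      then obtain q where q: "\<And>b. q b \<in> \<rat>" "\<And>b. \<bar>co z b \<omega> y - q b\<bar> < 1 / real (Suc n)"
        by metis
      let ?N = "\<Inter>b\<in>?I. O' z \<inter> (\<lambda>y'. co z b \<omega> y' - q b) -` {- (1 / real (Suc n))<..<1 / real (Suc n)}"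
      let ?M = "O' z \<inter> ?N"
      have cont: "continuous_on (O' z) (co z b \<omega>)" for b
      proof -
        have "continuous_on (fst (?c z)) (co z b \<omega>)"
          using diff_form_tensor[OF \<omega>, unfolded tensor_def] chart_at_in(1)[of z]
          unfolding co_def by blast
        then show ?thesis
          using O'(3) continuous_on_subset by blast
      qed
      have "open ?N"
        using finI O'(1) cont by (intro open_INT open_Int_vimage ballI continuous_intros) auto
      then have "open ?M"
        using O'(1) by blast
      then have oM: "open (snd (?c z) ` fst (?c z) \<inter> cinv (?c z) -` ?M)"
        by (intro open_Int_vimage chart_continuous chart_homeomorphism) simp_all
      have "co z b \<omega> y - q b \<in> {- (1 / real (Suc n))<..<1 / real (Suc n)}" for b
        using q(2)[of b] unfolding abs_less_iff greaterThanLessThan_iff by linarith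
      then have yM: "y \<in> ?M"
        using z(2) by blast
      have yc: "y \<in> fst (?c z)"
        using z O'(3) by blast
      have "snd (?c z) y \<in> snd (?c z) ` fst (?c z) \<inter> cinv (?c z) -` ?M"
        using yM yc by simp
      then obtain U where U: "U \<in> \<B>" "snd (?c z) y \<in> U" "U \<subseteq> snd (?c z) ` fst (?c z) \<inter> cinv (?c z) -` ?M"
        using topological_basisE[OF \<B>(2) oM] by blast
      have "\<bar>co z b \<omega> y' - q b\<bar> < 1 / real (Suc n)" if "y' \<in> cell z U" "b \<in> ?I" for y' b
      proof -
        have "y' \<in> fst (?c z)"
          using that(1) O'(3) by (auto simp: cell_def)
        moreover have "cinv (?c z) (snd (?c z) y') \<in> ?M"
          using U(3) that(1) unfolding cell_def by blast
        ultimately have "y' \<in> ?M"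
          by (simp only: chart_simps(1)[OF chart_at_in(1)])
        then have "co z b \<omega> y' - q b \<in> {- (1 / real (Suc n))<..<1 / real (Suc n)}"
          using that(2) by blast
        then show ?thesis
          unfolding abs_less_iff greaterThanLessThan_iff by linarith
      qed
      moreover have "y \<in> cell z U"
        using z U by (simp add: cell_def)
      moreover have "(z, U, restrict q ?I) \<in> Z \<times> \<B> \<times> (?I \<rightarrow>\<^sub>E \<rat>)"
        using z U q by auto
      ultimately show "\<exists>t. t \<in> Z \<times> \<B> \<times> (?I \<rightarrow>\<^sub>E \<rat>) \<and> y \<in> cell (fst t) (fst (snd t)) \<and>
        (\<forall>y'\<in>cell (fst t) (fst (snd t)). \<forall>b\<in>?I. \<bar>co (fst t) b \<omega> y' - snd (snd t) b\<bar> < 1 / real (Suc n))"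
        by (intro exI[of _ "(z, U, restrict q ?I)"]) simp
    qed
    from choice[OF this] obtain t where t: "\<forall>y. t y \<in> Z \<times> \<B> \<times> (?I \<rightarrow>\<^sub>E \<rat>) \<and> y \<in> cell (fst (t y)) (fst (snd (t y))) \<and>
        (\<forall>y'\<in>cell (fst (t y)) (fst (snd (t y))). \<forall>b\<in>?I. \<bar>co (fst (t y)) b \<omega> y' - snd (snd (t y)) b\<bar> < 1 / real (Suc n))" ..
    have t_open: "open (cell (fst (t y)) (fst (snd (t y))))" for y
    proof (rule cell_open)
      have "fst (snd (t y)) \<in> \<B>"
        using t by (metis mem_Times_iff)
      then show "open (fst (snd (t y)))"
        using \<B>(2) topological_basis_open by blast
    qed
    obtain Y where Y: "finite Y" "UNIV \<subseteq> (\<Union>y\<in>Y. cell (fst (t y)) (fst (snd (t y))))"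
      by (rule compact_nbhd_cover[OF assms, of "\<lambda>y. cell (fst (t y)) (fst (snd (t y)))"]) (use t t_open in auto)
    have "t ` Y \<in> Data"
      using Y(1) t unfolding Data_def by blast
    moreover have "good n (t ` Y) \<omega>"
      unfolding good_def
    proof (intro conjI allI)
      fix y
      obtain y' where "y' \<in> Y" "y \<in> cell (fst (t y')) (fst (snd (t y')))"
        using Y(2) by blast
      then show "\<exists>(z, U, q)\<in>t ` Y. y \<in> cell z U"
        by (intro bexI[of _ "t y'"]) (simp_all add: case_prod_beta)
    qed (use t in \<open>simp add: case_prod_beta\<close>)
    ultimately show ?thesis by blast
  qed
  define pick where "pick n d = (SOME \<omega>. diff_form A j \<omega> \<and> good n d \<omega>)" for n d
  have pick: "diff_form A j (pick n d) \<and> good n d (pick n d)" if "diff_form A j \<omega>" "good n d \<omega>" for n d \<omega>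
    unfolding pick_def using that by (intro someI[of "\<lambda>\<omega>. diff_form A j \<omega> \<and> good n d \<omega>"]) blast
  \<comment> \<open>For data that fit no form \<open>pick\<close> returns an arbitrary value; the
    condition in the set removes those values that are not forms.\<close>
  define Q where "Q = {\<eta> \<in> (\<lambda>(n, d). pick n d) ` (UNIV \<times> Data). diff_form A j \<eta>}"
  have "countable ((\<lambda>(n, d). pick n d) ` ((UNIV :: nat set) \<times> Data))"
    using countable_SIGMA[OF countableI_type, of UNIV "\<lambda>_. Data"] cD by (intro countable_image) simp
  then have "countable Q"
    by (rule countable_subset[rotated]) (simp only: Q_def Collect_restrict)
  moreover have "Q \<subseteq> {\<omega>. diff_form A j \<omega>}"
    by (auto simp: Q_def)
  moreover have "\<exists>\<eta>\<in>Q. form_bound j (\<lambda>x v. \<omega> x v - \<eta> x v) e" if \<omega>: "diff_form A j \<omega>" and e: "0 < e" for \<omega> e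
  proof -
    let ?L = "(real DIM('e) * K) ^ j"
    have L0: "0 \<le> ?L"
      using K0 by simp
    obtain n :: nat where n: "2 * ?L / e < real n"
      using reals_Archimedean2 by blast
    have "?L * (2 / real (Suc n)) \<le> e"
    proof -
      have "2 * ?L < real n * e"
        using n e by (simp add: pos_divide_less_eq)
      also have "\<dots> \<le> real (Suc n) * e"
        using e by (intro mult_right_mono) auto
      finally show ?thesis
        by (simp add: divide_le_eq mult.commute del: of_nat_Suc)
    qed
    obtain d where d: "d \<in> Data" "good n d \<omega>"
      using ex_good[OF \<omega>] by blast
    note p = pick[OF \<omega> d(2)]
    have "form_bound j (\<lambda>x v. \<omega> x v - pick n d x v) e"
      using close[OF d(1,2) _ \<omega>, of "pick n d"] p \<open>?L * (2 / real (Suc n)) \<le> e\<close>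
      unfolding form_bound_def by (meson order_trans)
    moreover have "pick n d \<in> Q"
      using p d(1) by (auto simp: Q_def)
    ultimately show ?thesis by blast
  qed
  ultimately show thesis by (rule that)
qed

end

section \<open>Volume growth\<close>

locale compact_foliated_system = foliated_manifold A g W P
  for A :: "('m::t2_space, 'e::euclidean_space) chart set" and g and W
    and P :: "('m, 'k::{finite,wellorder}) leaf_atlas" +
  fixes f :: "'m \<Rightarrow> 'm"
  assumes compact_space: "compact (UNIV :: 'm set)"
    and f: "leaf_map f"
begin

abbreviation disk_vol :: "'m \<Rightarrow> real \<Rightarrow> nat \<Rightarrow> real" where
  "disk_vol x r m \<equiv> iterate_vol A g f W P x r m"

abbreviation disk_integral :: "'m \<Rightarrow> real \<Rightarrow> nat \<Rightarrow> ('m, 'e) form \<Rightarrow> real" where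
  "disk_integral x r m \<omega> \<equiv> form_integral A (image_atlas (f ^^ m) P) ((f ^^ m) ` leaf_disk A g W x r) \<omega>"

abbreviation disk_current :: "'m \<Rightarrow> real \<Rightarrow> nat \<Rightarrow> ('m, 'e) form \<Rightarrow> real" where
  "disk_current x r m \<omega> \<equiv> iterate_current A g f W P x r m \<omega>"

lemma disk_decomposition:
  obtains N V p B where "decomposition (leaf_disk A g W x r) N V p B"
    "\<And>m. disk_vol x r m = (\<Sum>i<N. LINT u:B i|lborel. vol_density ((f ^^ m) \<circ> p i) u)"
    "\<And>m \<omega>. diff_form A CARD('k) \<omega> \<Longrightarrow>
      disk_integral x r m \<omega> = (\<Sum>i<N. LINT u:B i|lborel. form_density \<omega> ((f ^^ m) \<circ> p i) u)"
proof -
  note disk = leaf_disk_leaf_open leaf_disk_compactly_covered[OF compact_space]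
  obtain N V p B where d: "decomposition (leaf_disk A g W x r) N V p B"
    by (rule ex_decomposition[OF disk])
  show thesis
  proof (rule that[OF d])
    show "disk_vol x r m = (\<Sum>i<N. LINT u:B i|lborel. vol_density ((f ^^ m) \<circ> p i) u)" for m
      unfolding iterate_vol_def by (rule leaf_vol_decomposition[OF d leaf_map_funpow[OF f] disk])
    show "disk_integral x r m \<omega> = (\<Sum>i<N. LINT u:B i|lborel. form_density \<omega> ((f ^^ m) \<circ> p i) u)"
      if "diff_form A CARD('k) \<omega>" for m \<omega>
      by (rule form_integral_decomposition[OF d leaf_map_funpow[OF f] that])
  qed
qed

lemma decomposition_point:
  assumes "decomposition S N V p B" "i < N" "u \<in> B i"
  shows "(V i, p i) \<in> P" "u \<in> V i"
  using assms unfolding decomposition_def by blast+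

lemma disk_vol_nonneg: "0 \<le> disk_vol x r m"
proof -
  obtain N V p B where d: "decomposition (leaf_disk A g W x r) N V p B"
    "\<And>m. disk_vol x r m = (\<Sum>i<N. LINT u:B i|lborel. vol_density ((f ^^ m) \<circ> p i) u)"
    "\<And>m \<omega>. diff_form A CARD('k) \<omega> \<Longrightarrow>
      disk_integral x r m \<omega> = (\<Sum>i<N. LINT u:B i|lborel. form_density \<omega> ((f ^^ m) \<circ> p i) u)"
    by (rule disk_decomposition[of x r]) blast
  have "0 \<le> (LINT u:B i|lborel. vol_density ((f ^^ m) \<circ> p i) u)" if "i < N" for i
    unfolding set_lebesgue_integral_def
    by (rule Bochner_Integration.integral_nonneg)
      (auto simp: indicator_def intro!: vol_density_nonneg[OF leaf_map_funpow[OF f] decomposition_point[OF d(1) that]])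
  then show ?thesis
    unfolding d(2) by (intro sum_nonneg) simp
qed

text \<open>The density of the difference form is at most \<open>M\<close> times the volume density
  at every point. Phrasing the mass estimate for a difference serves both boundedness, by comparison
  with the zero form, and approximation by a dense set.\<close>

lemma disk_integral_bound:
  assumes \<omega>: "diff_form A CARD('k) \<omega>" and \<eta>: "diff_form A CARD('k) \<eta>"
    and M: "form_bound CARD('k) (\<lambda>x v. \<omega> x v - \<eta> x v) M"
  shows "\<bar>disk_integral x r m \<omega> - disk_integral x r m \<eta>\<bar> \<le> M * disk_vol x r m"
proof -
  obtain N V p B where d: "decomposition (leaf_disk A g W x r) N V p B"
    "\<And>m. disk_vol x r m = (\<Sum>i<N. LINT u:B i|lborel. vol_density ((f ^^ m) \<circ> p i) u)"
    "\<And>m \<omega>. diff_form A CARD('k) \<omega> \<Longrightarrow>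
      disk_integral x r m \<omega> = (\<Sum>i<N. LINT u:B i|lborel. form_density \<omega> ((f ^^ m) \<circ> p i) u)"
    by (rule disk_decomposition[of x r]) blast
  let ?G = "f ^^ m" and ?\<delta> = "\<lambda>x v. \<omega> x v - \<eta> x v"
  note G = leaf_map_funpow[OF f, of m]
  have \<delta>: "diff_form A CARD('k) ?\<delta>"
  proof -
    have "\<forall>x v. \<forall>i l. i < l \<and> l < CARD('k) \<and> v i = v l \<longrightarrow> ?\<delta> x v = 0"
      using \<omega> \<eta> unfolding diff_form_def by simp
    then show ?thesis
      using tensor_diff[OF diff_form_tensor[OF \<omega>] diff_form_tensor[OF \<eta>]]
      unfolding tensor_def diff_form_def by blast
  qed
  have "\<bar>(LINT u:B i|lborel. form_density \<omega> (?G \<circ> p i) u) - (LINT u:B i|lborel. form_density \<eta> (?G \<circ> p i) u)\<bar>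
      \<le> M * (LINT u:B i|lborel. vol_density (?G \<circ> p i) u)" if i: "i < N" for i
  proof -
    note int = decomposition_integrable(2)[OF d(1) G i \<omega>] decomposition_integrable(2)[OF d(1) G i \<eta>]
      decomposition_integrable(2)[OF d(1) G i \<delta>]
    have vint: "set_integrable lborel (B i) (\<lambda>u. M * vol_density (?G \<circ> p i) u)"
      using decomposition_integrable(1)[OF d(1) G i] by (intro set_integrable_mult_right)
    have le: "\<bar>form_density ?\<delta> (?G \<circ> p i) u\<bar> \<le> M * vol_density (?G \<circ> p i) u" if "u \<in> B i" for u
      by (rule form_density_bound[OF G decomposition_point[OF d(1) i that] \<delta> M])
    have "(LINT u:B i|lborel. form_density ?\<delta> (?G \<circ> p i) u) \<le> (LINT u:B i|lborel. M * vol_density (?G \<circ> p i) u)"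
      using le by (intro set_integral_mono int vint) fastforce
    moreover have "(LINT u:B i|lborel. - form_density ?\<delta> (?G \<circ> p i) u) \<le> (LINT u:B i|lborel. M * vol_density (?G \<circ> p i) u)"
      using le int(3) by (intro set_integral_mono vint) (auto simp: set_integrable_def abs_le_iff)
    moreover have "(LINT u:B i|lborel. form_density ?\<delta> (?G \<circ> p i) u) =
        (LINT u:B i|lborel. form_density \<omega> (?G \<circ> p i) u) - (LINT u:B i|lborel. form_density \<eta> (?G \<circ> p i) u)"
      using set_integral_diff(2)[OF int(1,2)] by (simp add: form_density_def)
    moreover have "(LINT u:B i|lborel. - form_density ?\<delta> (?G \<circ> p i) u) = - (LINT u:B i|lborel. form_density ?\<delta> (?G \<circ> p i) u)"
      by (simp add: set_lebesgue_integral_def)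
    moreover have "(LINT u:B i|lborel. M * vol_density (?G \<circ> p i) u) = M * (LINT u:B i|lborel. vol_density (?G \<circ> p i) u)"
      by (rule set_integral_mult_right)
    ultimately show ?thesis
      by linarith
  qed
  then have "(\<Sum>i<N. \<bar>(LINT u:B i|lborel. form_density \<omega> (?G \<circ> p i) u) - (LINT u:B i|lborel. form_density \<eta> (?G \<circ> p i) u)\<bar>)
      \<le> (\<Sum>i<N. M * (LINT u:B i|lborel. vol_density (?G \<circ> p i) u))"
    by (intro sum_mono) simp
  then show ?thesis
    unfolding d(2) d(3)[OF \<omega>] d(3)[OF \<eta>] sum_subtractf[symmetric] sum_distrib_left
    by (rule order_trans[OF sum_abs])
qed

text \<open>Over the common parameter sets the two integrands coincide by the chain rule, so no
  change of variables is needed.\<close>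

lemma disk_integral_pullback:
  assumes \<omega>: "diff_form A CARD('k) \<omega>"
  shows "disk_integral x r m (pullback_form A f \<omega>) = disk_integral x r (Suc m) \<omega>"
proof -
  obtain N V p B where d: "decomposition (leaf_disk A g W x r) N V p B"
    "\<And>m. disk_vol x r m = (\<Sum>i<N. LINT u:B i|lborel. vol_density ((f ^^ m) \<circ> p i) u)"
    "\<And>m \<omega>. diff_form A CARD('k) \<omega> \<Longrightarrow>
      disk_integral x r m \<omega> = (\<Sum>i<N. LINT u:B i|lborel. form_density \<omega> ((f ^^ m) \<circ> p i) u)"
    by (rule disk_decomposition[of x r]) blast
  have "(LINT u:B i|lborel. form_density (pullback_form A f \<omega>) ((f ^^ m) \<circ> p i) u) =
      (LINT u:B i|lborel. form_density \<omega> ((f ^^ Suc m) \<circ> p i) u)" if i: "i < N" for i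
  proof (rule set_lebesgue_integral_cong)
    show "B i \<in> sets lborel"
      using d(1) i unfolding decomposition_def by simp
    show "\<forall>u. u \<in> B i \<longrightarrow> form_density (pullback_form A f \<omega>) ((f ^^ m) \<circ> p i) u =
        form_density \<omega> ((f ^^ Suc m) \<circ> p i) u"
      using form_density_pullback[OF f leaf_map_funpow[OF f, of m] decomposition_point[OF d(1) i]]
      by simp
  qed
  then show ?thesis
    unfolding d(3)[OF \<omega>] d(3)[OF diff_form_pullback[OF \<omega> leaf_mapD(1)[OF f]]]
    by (intro sum.cong) simp_all
qed

text \<open>Normalization cancels the volume from the mass estimate. If the volume were 0, both
  currents would vanish by the convention for division.\<close>

lemma disk_current_close:
  assumes "diff_form A CARD('k) \<omega>" "diff_form A CARD('k) \<eta>" "0 \<le> M"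
    "form_bound CARD('k) (\<lambda>x v. \<omega> x v - \<eta> x v) M"
  shows "\<bar>disk_current x r m \<omega> - disk_current x r m \<eta>\<bar> \<le> M"
proof (cases "disk_vol x r m = 0")
  case False
  then have V: "0 < disk_vol x r m"
    using disk_vol_nonneg[of x r m] by simp
  have "disk_current x r m \<omega> - disk_current x r m \<eta> =
      (disk_integral x r m \<omega> - disk_integral x r m \<eta>) / disk_vol x r m"
    by (simp add: iterate_current_def diff_divide_distrib)
  then show ?thesis
    using disk_integral_bound[OF assms(1,2,4), where x = x and r = r and m = m] V by (simp add: abs_divide pos_divide_le_eq)
qed (use assms in \<open>simp add: iterate_current_def\<close>)

lemma zero_diff_form: "diff_form A j (\<lambda>x v. 0)"
  unfolding diff_form_def by (simp add: module_hom_zero linear_zero)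

lemma disk_current_bounded:
  assumes "diff_form A CARD('k) \<omega>"
  obtains M where "\<And>m. \<bar>disk_current x r m \<omega>\<bar> \<le> M"
proof -
  obtain M where M: "0 \<le> M" "form_bound CARD('k) \<omega> M"
    by (rule ex_form_bound[OF compact_space diff_form_tensor[OF assms]])
  have "disk_integral x r m (\<lambda>x v. 0) = 0" for m
  proof -
  obtain N V p B where d: "decomposition (leaf_disk A g W x r) N V p B"
    "\<And>m. disk_vol x r m = (\<Sum>i<N. LINT u:B i|lborel. vol_density ((f ^^ m) \<circ> p i) u)"
    "\<And>m \<omega>. diff_form A CARD('k) \<omega> \<Longrightarrow>
      disk_integral x r m \<omega> = (\<Sum>i<N. LINT u:B i|lborel. form_density \<omega> ((f ^^ m) \<circ> p i) u)"
    by (rule disk_decomposition[of x r]) blast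
    show ?thesis
      unfolding d(3)[OF zero_diff_form] by (simp add: form_density_def set_lebesgue_integral_def)
  qed
  then have "disk_current x r m (\<lambda>x v. 0) = 0" for m
    by (simp add: iterate_current_def)
  then have "\<bar>disk_current x r m \<omega>\<bar> \<le> M" for m
    using disk_current_close[OF assms zero_diff_form M(1), of x r m] M(2) by simp
  then show thesis using that by blast
qed

text \<open>Any sequence of times \<open>s\<close> may be prescribed, so that later a limit can be
  taken along times violating a supposed estimate, or along shifted times.\<close>

lemma ex_subsequential_limit:
  fixes s :: "nat \<Rightarrow> nat"
  assumes s: "filterlim s at_top sequentially"
  obtains t C where "strict_mono (t :: nat \<Rightarrow> nat)" "subsequential_limit A g f W P x r C"
    "\<And>\<omega>. diff_form A CARD('k) \<omega> \<Longrightarrow> (\<lambda>i. disk_current x r (s (t i)) \<omega>) \<longlonglongrightarrow> C \<omega>"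
proof -
  obtain Q where Q: "countable Q" "Q \<subseteq> {\<omega>. diff_form A CARD('k) \<omega>}"
    "\<And>\<omega> e. diff_form A CARD('k) \<omega> \<Longrightarrow> 0 < e \<Longrightarrow>
      \<exists>\<eta>\<in>Q. form_bound CARD('k) (\<lambda>x v. \<omega> x v - \<eta> x v) e"
    by (rule countable_dense_forms[OF compact_space]) blast
  have "\<exists>M. \<forall>m. \<bar>disk_current x r (s m) \<omega>\<bar> \<le> M" if "\<omega> \<in> {\<omega>. diff_form A CARD('k) \<omega>}" for \<omega>
    using disk_current_bounded[of \<omega> x r] that by (metis mem_Collect_eq)
  moreover have "\<exists>q\<in>Q. \<forall>m. \<bar>disk_current x r (s m) \<omega> - disk_current x r (s m) q\<bar> \<le> e"
    if \<omega>: "\<omega> \<in> {\<omega>. diff_form A CARD('k) \<omega>}" and e: "0 < e" for \<omega> e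
  proof -
    obtain q where q: "q \<in> Q" "form_bound CARD('k) (\<lambda>x v. \<omega> x v - q x v) e"
      using Q(3) \<omega> e by blast
    have "\<bar>disk_current x r (s m) \<omega> - disk_current x r (s m) q\<bar> \<le> e" for m
      using \<omega> q Q(2) e by (intro disk_current_close) auto
    then show ?thesis
      using q(1) by blast
  qed
  ultimately obtain t :: "nat \<Rightarrow> nat" where t: "strict_mono t"
    "\<And>\<omega>. \<omega> \<in> {\<omega>. diff_form A CARD('k) \<omega>} \<Longrightarrow> convergent (\<lambda>i. disk_current x r (s (t i)) \<omega>)"
    by (rule common_convergent_subsequence[OF _ Q(1,2), of "\<lambda>m. disk_current x r (s m)"]) blast+
  define C where "C \<omega> = lim (\<lambda>i. disk_current x r (s (t i)) \<omega>)" for \<omega>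
  have C: "(\<lambda>i. disk_current x r (s (t i)) \<omega>) \<longlonglongrightarrow> C \<omega>" if "diff_form A CARD('k) \<omega>" for \<omega>
    unfolding C_def using t(2)[of \<omega>] that by (simp add: convergent_LIMSEQ_iff)
  moreover have "filterlim (\<lambda>i. s (t i)) at_top sequentially"
    by (rule filterlim_compose[OF s filterlim_subseq[OF t(1)]])
  ultimately have "subsequential_limit A g f W P x r C"
    unfolding subsequential_limit_def by (intro exI[of _ "\<lambda>i. s (t i)"]) blast
  with t(1) C show thesis
    using that by blast
qed

end

section \<open>Homology of the limits and the growth rate\<close>

locale unique_homology_system = compact_foliated_system A g W P f
  for A :: "('m::t2_space, 'e::euclidean_space) chart set" and g and W
    and P :: "('m, 'k::{finite,wellorder}) leaf_atlas" and f +
  fixes h :: "('m, 'e) form \<Rightarrow> real"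
  assumes unique: "carries_unique_homology A g f W P h"
begin

lemma closed_form_diff_form: "closed_form A TYPE('k) \<omega> \<Longrightarrow> diff_form A CARD('k) \<omega>"
  unfolding closed_form_def by blast

lemma homology_not_closed: "\<not> closed_form A TYPE('k) \<omega> \<Longrightarrow> h \<omega> = 0"
  using unique unfolding carries_unique_homology_def real_homology_def by blast

text \<open>The form in which uniqueness is applied: on closed forms every limit is a multiple of
  \<open>h\<close>, with one lower bound \<open>\<delta>\<close> for all points, radii and sequences
  of times.\<close>

lemma limit_homology:
  obtains \<delta> where "0 < \<delta>"
    "\<And>x r s. 0 < r \<Longrightarrow> filterlim s at_top sequentially \<Longrightarrow> \<exists>t c. strict_mono (t :: nat \<Rightarrow> nat) \<and> \<delta> \<le> c \<and>
      (\<forall>\<omega>. closed_form A TYPE('k) \<omega> \<longrightarrow> (\<lambda>i. disk_current x r (s (t i)) \<omega>) \<longlonglongrightarrow> c * h \<omega>)"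
proof -
  obtain \<delta> where \<delta>: "0 < \<delta>" "\<And>x r C. 0 < r \<Longrightarrow> subsequential_limit A g f W P x r C \<Longrightarrow>
      \<exists>c\<ge>\<delta>. current_class A TYPE('k) C = (\<lambda>\<omega>. c * h \<omega>)"
    using unique unfolding carries_unique_homology_def by blast
  have "\<exists>t c. strict_mono (t :: nat \<Rightarrow> nat) \<and> \<delta> \<le> c \<and>
      (\<forall>\<omega>. closed_form A TYPE('k) \<omega> \<longrightarrow> (\<lambda>i. disk_current x r (s (t i)) \<omega>) \<longlonglongrightarrow> c * h \<omega>)"
    if r: "0 < r" and s: "filterlim s at_top sequentially" for x r s
  proof -
    obtain t C where t: "strict_mono (t :: nat \<Rightarrow> nat)" "subsequential_limit A g f W P x r C"
      "\<And>\<omega>. diff_form A CARD('k) \<omega> \<Longrightarrow> (\<lambda>i. disk_current x r (s (t i)) \<omega>) \<longlonglongrightarrow> C \<omega>"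
      by (rule ex_subsequential_limit[OF s, of x r]) blast
    obtain c where c: "\<delta> \<le> c" "current_class A TYPE('k) C = (\<lambda>\<omega>. c * h \<omega>)"
      using \<delta>(2)[OF r t(2)] by blast
    have "C \<omega> = c * h \<omega>" if "closed_form A TYPE('k) \<omega>" for \<omega>
      using fun_cong[OF c(2), of \<omega>] that by (simp add: current_class_def)
    then have "(\<lambda>i. disk_current x r (s (t i)) \<omega>) \<longlonglongrightarrow> c * h \<omega>" if "closed_form A TYPE('k) \<omega>" for \<omega>
      using t(3)[OF closed_form_diff_form[OF that]] that by simp
    then show ?thesis
      using t(1) c(1) by blast
  qed
  with \<delta>(1) show thesis
    by (rule that)
qed

lemma homology_nontrivial:
  obtains \<omega> where "closed_form A TYPE('k) \<omega>" "h \<omega> \<noteq> 0"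
  using unique homology_not_closed unfolding carries_unique_homology_def by (metis ext)

text \<open>If the current were below half of \<open>\<delta> * \<bar>h \<omega>\<bar>\<close>
  infinitely often, a limit along those times would contradict the lower bound on the factors. A
  nonzero current excludes volume 0, because division by 0 gives 0.\<close>

lemma disk_vol_eventually_pos:
  assumes r: "0 < r" and \<omega>: "closed_form A TYPE('k) \<omega>" "h \<omega> \<noteq> 0"
  obtains e where "0 < e" "\<forall>\<^sub>F m in sequentially. e \<le> \<bar>disk_current x r m \<omega>\<bar>"
    "\<forall>\<^sub>F m in sequentially. 0 < disk_vol x r m"
proof -
  obtain \<delta> where \<delta>: "0 < \<delta>" and lim: "\<And>x r s. 0 < r \<Longrightarrow> filterlim s at_top sequentially \<Longrightarrow>
      \<exists>t c. strict_mono (t :: nat \<Rightarrow> nat) \<and> \<delta> \<le> c \<and>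
      (\<forall>\<omega>. closed_form A TYPE('k) \<omega> \<longrightarrow> (\<lambda>i. disk_current x r (s (t i)) \<omega>) \<longlonglongrightarrow> c * h \<omega>)"
    by (rule limit_homology) blast
  define e where "e = \<delta> * \<bar>h \<omega>\<bar> / 2"
  have e: "0 < e"
    using \<delta> \<omega>(2) by (simp add: e_def)
  have ev: "\<forall>\<^sub>F m in sequentially. e \<le> \<bar>disk_current x r m \<omega>\<bar>"
  proof (rule ccontr)
    assume "\<not> ?thesis"
    then obtain s :: "nat \<Rightarrow> nat" where s: "strict_mono s" "\<And>n. \<not> e \<le> \<bar>disk_current x r (s n) \<omega>\<bar>"
      using not_eventually_sequentiallyD by blast
    obtain t c where t: "\<delta> \<le> c" "(\<lambda>i. disk_current x r (s (t i)) \<omega>) \<longlonglongrightarrow> c * h \<omega>"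
      using lim[OF r filterlim_subseq[OF s(1)], of x] \<omega>(1) by blast
    have "(\<lambda>i. \<bar>disk_current x r (s (t i)) \<omega>\<bar>) \<longlonglongrightarrow> \<bar>c * h \<omega>\<bar>"
      by (rule tendsto_rabs[OF t(2)])
    then have "\<bar>c * h \<omega>\<bar> \<le> e"
      by (rule LIMSEQ_le_const2) (use s(2) in \<open>meson linear\<close>)
    moreover have "\<delta> * \<bar>h \<omega>\<bar> \<le> \<bar>c * h \<omega>\<bar>"
      using t(1) \<delta> by (simp add: abs_mult mult_right_mono)
    ultimately show False
      using e by (simp add: e_def)
  qed
  moreover have "\<forall>\<^sub>F m in sequentially. 0 < disk_vol x r m"
    using ev
  proof eventually_elim
    case (elim m)
    then have "disk_vol x r m \<noteq> 0"
      using e by (auto simp: iterate_current_def)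
    then show ?case
      using disk_vol_nonneg[of x r m] by simp
  qed
  ultimately show thesis
    using e that by blast
qed

text \<open>The quotients of consecutive volumes converge along a subsequence, because of
  the identity of the integrals of \<open>\<omega>\<close> over the next iterate and of its pullback over the current
  one; the class of the limit current and that of its push forward are both multiples of \<open>h\<close>.\<close>

lemma homology_eigenvector:
  obtains lam where "0 < lam" "\<And>\<omega>. closed_form A TYPE('k) \<omega> \<Longrightarrow> h (pullback_form A f \<omega>) = lam * h \<omega>"
proof -
  obtain \<omega>1 where \<omega>1: "closed_form A TYPE('k) \<omega>1" "h \<omega>1 \<noteq> 0"
    by (rule homology_nontrivial)
  obtain \<delta> where \<delta>: "0 < \<delta>" and lim: "\<And>x r s. 0 < r \<Longrightarrow> filterlim s at_top sequentially \<Longrightarrow>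
      \<exists>t c. strict_mono (t :: nat \<Rightarrow> nat) \<and> \<delta> \<le> c \<and>
      (\<forall>\<omega>. closed_form A TYPE('k) \<omega> \<longrightarrow> (\<lambda>i. disk_current x r (s (t i)) \<omega>) \<longlonglongrightarrow> c * h \<omega>)"
    by (rule limit_homology) blast
  fix x :: 'm
  obtain t c where t: "strict_mono (t :: nat \<Rightarrow> nat)" "\<delta> \<le> c"
    "\<And>\<omega>. closed_form A TYPE('k) \<omega> \<Longrightarrow> (\<lambda>i. disk_current x 1 (t i) \<omega>) \<longlonglongrightarrow> c * h \<omega>"
    using lim[OF zero_less_one filterlim_ident, of x] by blast
  \<comment> \<open>A second extraction, applied to the shifted times, makes the currents at
    \<open>s i\<close> and at \<open>Suc (s i)\<close> converge simultaneously, with possibly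
    different factors \<open>c\<close> and \<open>c'\<close>.\<close>
  have "filterlim (\<lambda>i. Suc (t i)) at_top sequentially"
    by (rule filterlim_compose[OF filterlim_Suc filterlim_subseq[OF t(1)]])
  from lim[OF zero_less_one this, of x] obtain t' c' where t': "strict_mono (t' :: nat \<Rightarrow> nat)" "\<delta> \<le> c'"
    "\<And>\<omega>. closed_form A TYPE('k) \<omega> \<Longrightarrow> (\<lambda>i. disk_current x 1 (Suc (t (t' i))) \<omega>) \<longlonglongrightarrow> c' * h \<omega>"
    by blast
  define s where "s i = t (t' i)" for i
  have s: "strict_mono s"
    using t(1) t'(1) by (simp add: s_def strict_mono_def)
  have C: "(\<lambda>i. disk_current x 1 (s i) \<omega>) \<longlonglongrightarrow> c * h \<omega>"
    "(\<lambda>i. disk_current x 1 (Suc (s i)) \<omega>) \<longlonglongrightarrow> c' * h \<omega>" if "closed_form A TYPE('k) \<omega>" for \<omega>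
    using LIMSEQ_subseq_LIMSEQ[OF t(3)[OF that] t'(1)] t'(3)[OF that] by (simp_all add: s_def o_def)
  have cc: "0 < c" "0 < c'"
    using t(2) t'(2) \<delta> by auto
  note f_inv = leaf_mapD(1,2)[OF f]
  have pull: "closed_form A TYPE('k) (pullback_form A f \<omega>)" if "closed_form A TYPE('k) \<omega>" for \<omega>
    by (rule closed_form_pullback[OF that f_inv(1)])
  \<comment> \<open>This choice makes the pullback of \<open>\<omega>2\<close> equal to
    \<open>\<omega>1\<close>, whose current has a nonzero limit. The volume quotient can thus be
    solved for, before anything is known about \<open>h\<close> on pullbacks.\<close>
  define \<omega>2 where "\<omega>2 = pullback_form A (inv f) \<omega>1"
  have \<omega>2: "closed_form A TYPE('k) \<omega>2"
    unfolding \<omega>2_def by (rule closed_form_pullback[OF \<omega>1(1) f_inv(2)])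
  have pull\<omega>2: "pullback_form A f \<omega>2 = \<omega>1"
    unfolding \<omega>2_def using leaf_mapD(3)[OF f] by (intro pullback_form_inverse f_inv) (simp add: bij_is_inj)
  obtain e where ev: "\<forall>\<^sub>F m in sequentially. 0 < disk_vol x 1 m"
    by (rule disk_vol_eventually_pos[OF zero_less_one \<omega>1, of x])
  define q where "q i = disk_vol x 1 (s i) / disk_vol x 1 (Suc (s i))" for i
  have evs: "\<forall>\<^sub>F i in sequentially. 0 < disk_vol x 1 (s i)"
    using ev filterlim_subseq[OF s] by (auto simp: filterlim_iff)
  have step: "\<forall>\<^sub>F i in sequentially. disk_current x 1 (Suc (s i)) \<omega> =
      q i * disk_current x 1 (s i) (pullback_form A f \<omega>)" if "closed_form A TYPE('k) \<omega>" for \<omega>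
    using evs
  proof eventually_elim
    case (elim i)
    then show ?case
      using disk_integral_pullback[OF closed_form_diff_form[OF that], where x = x and r = 1 and m = "s i"]
      by (simp add: iterate_current_def q_def del: funpow.simps)
  qed
  have "\<forall>\<^sub>F i in sequentially. disk_current x 1 (s i) \<omega>1 \<noteq> 0"
    using tendsto_imp_eventually_ne[OF C(1)[OF \<omega>1(1)], of 0] cc(1) \<omega>1(2) by simp
  then have "\<forall>\<^sub>F i in sequentially. disk_current x 1 (Suc (s i)) \<omega>2 / disk_current x 1 (s i) \<omega>1 = q i"
    using step[OF \<omega>2] by eventually_elim (simp add: pull\<omega>2)
  moreover have "(\<lambda>i. disk_current x 1 (Suc (s i)) \<omega>2 / disk_current x 1 (s i) \<omega>1) \<longlonglongrightarrow>
      c' * h \<omega>2 / (c * h \<omega>1)"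
    using cc(1) \<omega>1(2) by (intro tendsto_divide C \<omega>1 \<omega>2) simp
  ultimately have "q \<longlonglongrightarrow> c' * h \<omega>2 / (c * h \<omega>1)"
    using Lim_transform_eventually by blast
  then obtain l where q: "q \<longlonglongrightarrow> l"
    by blast
  have key: "c' * h \<omega> = l * (c * h (pullback_form A f \<omega>))" if \<omega>: "closed_form A TYPE('k) \<omega>" for \<omega>
  proof (rule LIMSEQ_unique[OF C(2)[OF \<omega>]])
    have "(\<lambda>i. q i * disk_current x 1 (s i) (pullback_form A f \<omega>)) \<longlonglongrightarrow> l * (c * h (pullback_form A f \<omega>))"
      by (intro tendsto_mult q C(1) pull \<omega>)
    then show "(\<lambda>i. disk_current x 1 (Suc (s i)) \<omega>) \<longlonglongrightarrow> l * (c * h (pullback_form A f \<omega>))"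
      by (rule Lim_transform_eventually) (use step[OF \<omega>] in \<open>auto elim: eventually_mono\<close>)
  qed
  \<comment> \<open>Otherwise \<open>key\<close> would force \<open>c' * h \<omega>1 = 0\<close>.
    Together with the sign of volumes this makes the eigenvalue positive.\<close>
  have "l \<noteq> 0"
    using key[OF \<omega>1(1)] cc(2) \<omega>1(2) by auto
  moreover have "0 \<le> l"
    by (rule LIMSEQ_le_const[OF q]) (auto simp: q_def disk_vol_nonneg)
  ultimately have qpos: "0 < l" by simp
  have "h (pullback_form A f \<omega>) = c' / (l * c) * h \<omega>" if "closed_form A TYPE('k) \<omega>" for \<omega>
    using key[OF that] cc qpos by (simp add: field_simps)
  moreover have "0 < c' / (l * c)"
    using cc qpos by simp
  ultimately show thesis
    using that by blast
qed

text \<open>The \<open>THE\<close> in the definition is justified by a closed form on which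
  \<open>h\<close> does not vanish: evaluating there leaves only one possible factor.\<close>

lemma topological_growth_eigenvalue:
  "0 < topological_growth A TYPE('k) f h"
  "closed_form A TYPE('k) \<omega> \<Longrightarrow> h (pullback_form A f \<omega>) = topological_growth A TYPE('k) f h * h \<omega>"
proof -
  obtain lam where lam: "0 < lam" "\<And>\<omega>. closed_form A TYPE('k) \<omega> \<Longrightarrow> h (pullback_form A f \<omega>) = lam * h \<omega>"
    by (rule homology_eigenvector) blast
  obtain \<omega>1 where \<omega>1: "closed_form A TYPE('k) \<omega>1" "h \<omega>1 \<noteq> 0"
    by (rule homology_nontrivial)
  have "topological_growth A TYPE('k) f h = lam"
    unfolding topological_growth_def
  proof (rule the_equality)
    show "homology_push A TYPE('k) f h = (\<lambda>\<omega>. lam * h \<omega>)"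
      using lam(2) homology_not_closed by (auto simp: homology_push_def)
    fix \<mu> assume "homology_push A TYPE('k) f h = (\<lambda>\<omega>. \<mu> * h \<omega>)"
    from fun_cong[OF this, of \<omega>1] show "\<mu> = lam"
      using \<omega>1 lam(2) by (simp add: homology_push_def)
  qed
  then show "0 < topological_growth A TYPE('k) f h"
    "closed_form A TYPE('k) \<omega> \<Longrightarrow> h (pullback_form A f \<omega>) = topological_growth A TYPE('k) f h * h \<omega>"
    using lam by simp_all
qed

lemma disk_vol_growth:
  assumes r: "0 < r"
  shows "(\<lambda>m. 1 / real m * ln (disk_vol x r m)) \<longlonglongrightarrow> ln (topological_growth A TYPE('k) f h)"
proof -
  define lam where "lam = topological_growth A TYPE('k) f h"
  have lam: "0 < lam" "\<And>\<omega>. closed_form A TYPE('k) \<omega> \<Longrightarrow> h (pullback_form A f \<omega>) = lam * h \<omega>"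
    using topological_growth_eigenvalue by (simp_all add: lam_def)
  obtain \<omega> where \<omega>: "closed_form A TYPE('k) \<omega>" "h \<omega> \<noteq> 0"
    by (rule homology_nontrivial)
  note form = closed_form_diff_form[OF \<omega>(1)]
  have pull: "closed_form A TYPE('k) (pullback_form A f \<omega>)"
    by (rule closed_form_pullback[OF \<omega>(1) leaf_mapD(1)[OF f]])
  obtain \<delta> where lim: "\<And>x r s. 0 < r \<Longrightarrow> filterlim s at_top sequentially \<Longrightarrow>
      \<exists>t c. strict_mono (t :: nat \<Rightarrow> nat) \<and> \<delta> \<le> c \<and>
      (\<forall>\<omega>. closed_form A TYPE('k) \<omega> \<longrightarrow> (\<lambda>i. disk_current x r (s (t i)) \<omega>) \<longlonglongrightarrow> c * h \<omega>)"
    by (rule limit_homology) blast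
  obtain e where e: "0 < e" "\<forall>\<^sub>F m in sequentially. e \<le> \<bar>disk_current x r m \<omega>\<bar>"
    and V: "\<forall>\<^sub>F m in sequentially. 0 < disk_vol x r m"
    by (rule disk_vol_eventually_pos[OF r \<omega>])
  let ?C = "\<lambda>m. disk_current x r m \<omega>" and ?D = "\<lambda>m. disk_current x r m (pullback_form A f \<omega>)"
    and ?a = "\<lambda>m. disk_integral x r m \<omega>"
  \<comment> \<open>Neither sequence need converge by itself, as the factor \<open>c\<close> depends
    on the subsequence. It cancels in this combination: every limit equals \<open>c\<close> times
    the eigenvalue relation, hence 0.\<close>
  have CD: "(\<lambda>m. ?D m - lam * ?C m) \<longlonglongrightarrow> 0"
  proof (rule ccontr)
    assume "\<not> ?thesis"
    then obtain b where b: "0 < b" "\<not> (\<forall>\<^sub>F m in sequentially. dist (?D m - lam * ?C m) 0 < b)"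
      unfolding tendsto_iff by blast
    then obtain s :: "nat \<Rightarrow> nat" where s: "strict_mono s" "\<And>n. \<not> dist (?D (s n) - lam * ?C (s n)) 0 < b"
      using not_eventually_sequentiallyD by blast
    obtain t c where t: "\<And>\<omega>. closed_form A TYPE('k) \<omega> \<Longrightarrow> (\<lambda>i. disk_current x r (s (t i)) \<omega>) \<longlonglongrightarrow> c * h \<omega>"
      using lim[OF r filterlim_subseq[OF s(1)], of x] by blast
    have "(\<lambda>i. ?D (s (t i)) - lam * ?C (s (t i))) \<longlonglongrightarrow> c * h (pullback_form A f \<omega>) - lam * (c * h \<omega>)"
      by (intro tendsto_intros t pull \<omega>(1))
    then have "(\<lambda>i. ?D (s (t i)) - lam * ?C (s (t i))) \<longlonglongrightarrow> 0"
      by (simp add: lam(2)[OF \<omega>(1)])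
    from tendstoD[OF this b(1)] have "\<forall>\<^sub>F i in sequentially. dist (?D (s (t i)) - lam * ?C (s (t i))) 0 < b" .
    then show False
      using s(2) by simp
  qed
  \<comment> \<open>The division is harmless because \<open>?C m\<close> is eventually at least
    \<open>e\<close> in absolute value.\<close>
  have "(\<lambda>m. (?D m - lam * ?C m) / ?C m) \<longlonglongrightarrow> 0"
  proof (rule Lim_null_comparison)
    show "\<forall>\<^sub>F m in sequentially. norm ((?D m - lam * ?C m) / ?C m) \<le> \<bar>?D m - lam * ?C m\<bar> / e"
      using e(2) by eventually_elim (use e(1) in \<open>auto simp: abs_divide intro!: divide_left_mono mult_pos_pos\<close>)
    show "(\<lambda>m. \<bar>?D m - lam * ?C m\<bar> / e) \<longlonglongrightarrow> 0"
      using tendsto_divide[OF tendsto_rabs_zero[OF CD] tendsto_const, of e] e(1) by simp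
  qed
  then have "(\<lambda>m. lam + (?D m - lam * ?C m) / ?C m) \<longlonglongrightarrow> lam + 0"
    by (intro tendsto_add tendsto_const)
  moreover have "\<forall>\<^sub>F m in sequentially. lam + (?D m - lam * ?C m) / ?C m = ?a (Suc m) / ?a m"
    using e(2) V
  proof eventually_elim
    case (elim m)
    have a: "?a m = disk_vol x r m * ?C m" "?a (Suc m) = disk_vol x r m * ?D m"
      using elim(2) disk_integral_pullback[OF form, where x = x and r = r and m = m] by (simp_all add: iterate_current_def del: funpow.simps)
    have "?C m \<noteq> 0"
      using elim(1) e(1) by auto
    then show ?case
      unfolding a using elim(2) by (simp add: diff_divide_distrib)
  qed
  ultimately have "(\<lambda>m. ?a (Suc m) / ?a m) \<longlonglongrightarrow> lam"
    using Lim_transform_eventually by fastforce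
  \<comment> \<open>The value \<open>h \<omega>\<close> may be negative, and with it
    \<open>?a m\<close>; logarithms are therefore taken of absolute values.\<close>
  then have "(\<lambda>m. \<bar>?a (Suc m) / ?a m\<bar>) \<longlonglongrightarrow> \<bar>lam\<bar>"
    by (rule tendsto_rabs)
  then have ratio: "(\<lambda>m. ln \<bar>?a (Suc m) / ?a m\<bar>) \<longlonglongrightarrow> ln lam"
    using tendsto_ln[of _ "\<bar>lam\<bar>"] lam(1) by fastforce
  have a0: "\<forall>\<^sub>F m in sequentially. ?a m \<noteq> 0"
    using e(2) by eventually_elim (use e(1) in \<open>auto simp: iterate_current_def\<close>)
  have a1: "\<forall>\<^sub>F m in sequentially. ?a (Suc m) \<noteq> 0"
    using eventually_sequentially_Suc[of "\<lambda>m. ?a m \<noteq> 0"] a0 by blast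
  have "\<forall>\<^sub>F m in sequentially. ln \<bar>?a (Suc m) / ?a m\<bar> = ln \<bar>?a (Suc m)\<bar> - ln \<bar>?a m\<bar>"
    using a0 a1 by eventually_elim (simp add: abs_divide ln_div)
  from Lim_transform_eventually[OF ratio this]
  have "(\<lambda>m. ln \<bar>?a m\<bar> / real m) \<longlonglongrightarrow> ln lam"
    by (rule cesaro_difference)
  \<comment> \<open>The current is eventually pinched between \<open>e\<close> and \<open>M\<close>
    in absolute value, so its logarithm is bounded and passing from integrals to volumes does not
    change the exponential rate.\<close>
  moreover have "(\<lambda>m. ln \<bar>?C m\<bar> / real m) \<longlonglongrightarrow> 0"
  proof -
    obtain M where M: "\<And>m. \<bar>?C m\<bar> \<le> M"
      by (rule disk_current_bounded[OF form, of x r]) blast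
    have "\<forall>\<^sub>F m in sequentially. norm (ln \<bar>?C m\<bar> / real m) \<le> (\<bar>ln e\<bar> + \<bar>ln M\<bar>) / real m"
      using e(2)
    proof eventually_elim
      case (elim m)
      have "ln e \<le> ln \<bar>?C m\<bar>" "ln \<bar>?C m\<bar> \<le> ln M"
        using elim e(1) M[of m] by (auto intro: ln_mono)
      then have "\<bar>ln \<bar>?C m\<bar>\<bar> \<le> \<bar>ln e\<bar> + \<bar>ln M\<bar>"
        by linarith
      then show ?case
        by (simp add: abs_divide divide_right_mono)
    qed
    then show ?thesis
      by (rule Lim_null_comparison) (rule tendsto_divide_0[OF tendsto_const filterlim_real_at_infinity_sequentially])
  qed
  ultimately have "(\<lambda>m. ln \<bar>?a m\<bar> / real m - ln \<bar>?C m\<bar> / real m) \<longlonglongrightarrow> ln lam - 0"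
    by (rule tendsto_diff)
  moreover have "\<forall>\<^sub>F m in sequentially. ln \<bar>?a m\<bar> / real m - ln \<bar>?C m\<bar> / real m = 1 / real m * ln (disk_vol x r m)"
    using e(2) V
  proof eventually_elim
    case (elim m)
    have "?a m = disk_vol x r m * ?C m"
      using elim(2) by (simp add: iterate_current_def)
    then have "ln \<bar>?a m\<bar> = ln (disk_vol x r m) + ln \<bar>?C m\<bar>"
      using elim e(1) by (simp add: abs_mult ln_mult)
    then show ?case
      by (simp add: add_divide_distrib)
  qed
  ultimately show ?thesis
    unfolding lam_def[symmetric] using Lim_transform_eventually by fastforce
qed

end

theorem theorem3p3:
  fixes A :: "('m::t2_space, 'e::euclidean_space) chart set"
    and g :: "'m \<Rightarrow> 'e \<Rightarrow> 'e \<Rightarrow> real"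
    and f :: "'m \<Rightarrow> 'm"
    and W :: "'m \<Rightarrow> 'm set"
    and P :: "('m, 'k::{finite,wellorder}) leaf_atlas"
    and h\<^sub>W :: "('m, 'e) form \<Rightarrow> real"
    and lam\<^sub>W :: real
  assumes "compact (UNIV :: 'm set)"
    and "smooth_atlas A"
    and "riemannian_metric A g"
    and "C1_diffeomorphism A f"
    and "oriented_C1_foliation A W P"
    and "invariant_foliation f W"
    and "uniformly_expanding A g f P"
    and "carries_unique_homology A g f W P h\<^sub>W"
    and "lam\<^sub>W = topological_growth A TYPE('k) f h\<^sub>W"
  shows "0 < lam\<^sub>W \<and>
    (\<forall>x. \<forall>r>0.
       volume_growth A g f W P x r = ereal (ln lam\<^sub>W) \<and>
       (\<lambda>i. 1 / real i * ln (iterate_vol A g f W P x r i)) \<longlonglongrightarrow> ln lam\<^sub>W)"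
proof -
  interpret foliated_manifold A g W P
    using assms(2,3,5) by unfold_locales (simp_all add: oriented_C1_foliation_def)
  interpret unique_homology_system A g W P f h\<^sub>W
    using assms(1,4,6,8) by unfold_locales (simp_all add: leaf_map_def)
  have lim: "(\<lambda>i. 1 / real i * ln (iterate_vol A g f W P x r i)) \<longlonglongrightarrow> ln lam\<^sub>W" if "0 < r" for x r
    unfolding assms(9) by (rule disk_vol_growth[OF that])
  moreover have "volume_growth A g f W P x r = ereal (ln lam\<^sub>W)" if "0 < r" for x r
    unfolding volume_growth_def
    by (rule lim_imp_Limsup) (use lim[OF that, of x] in \<open>simp_all add: tendsto_ereal\<close>)
  ultimately show ?thesis
    using topological_growth_eigenvalue(1) assms(9) by simp
qed

end
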